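(* Let $M$ be a highest weight $\mathfrak g$-supermodule. Then its Dirac cohomology $H_D(M)$ is non-trivial, i.e. $H_D(M)\neq\{0\}$.
   Context: Ground field $\mathbb C$; $p(\cdot)$ denotes parity. $\mathfrak g=\mathfrak g_0\oplus\mathfrak g_1$ is a basic classical Lie superalgebra with $\mathfrak g_1\neq0$, i.e. $\mathfrak{gl}(m|n)$ ($m,n\ge1$) or simple of type $A(m|n),B(m|n),C(n),D(m|n),F(4),G(3)$ or $D(2,1;\alpha)$ with $\alpha\in\mathbb R$; $(\cdot,\cdot)$ is a fixed non-degenerate invariant supersymmetric bilinear form with $(\mathfrak g_0,\mathfrak g_1)=0$. $\mathfrak h\subset\mathfrak g_0$ is a Cartan subalgebra, $\Phi$ the set of roots, $\mathfrak g^\alpha$ the root spaces, $\Phi^+$ a fixed positive system, $\mathfrak n^+=\bigoplus_{\alpha\in\Phi^+}\mathfrak g^{\alpha}$. A $\mathfrak g$-supermodule $M$ is a highest weight supermodule with highest weight $\Lambda\in\mathfrak h^*$ if it is generated over $\mathfrak U(\mathfrak g)$ by a nonzero vector $v_\Lambda$ with $\mathfrak n^+v_\Lambda=0$ and $Hv_\Lambda=\Lambda(H)v_\Lambda$ for $H\in\mathfrak h$. Parabolic subalgebra: given an additive map $f:\mathbb Z\Phi\to\mathbb Z$, put $\mathfrak l=\mathfrak h\oplus\bigoplus_{f(\alpha)=0}\mathfrak g^\alpha$, $\mathfrak u=\bigoplus_{f(\alpha)>0}\mathfrak g^\alpha$, $\bar{\mathfrak u}=\bigoplus_{f(\alpha)<0}\mathfrak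 g^{\alpha}$; then $\mathfrak p=\mathfrak l\ltimes\mathfrak u$ is parabolic. We fix such $\mathfrak p$ with all roots of $\mathfrak u$ in $\Phi^+$, and put $\mathfrak s=\mathfrak u\oplus\bar{\mathfrak u}$. Cubic Dirac operator: $C(\mathfrak s)$ is the Clifford superalgebra generated by $\mathfrak s$ with relations $vw+(-1)^{p(v)p(w)}wv=2(v,w)$. Let $X_1,\dots,X_{2s}$ be a homogeneous basis of $\mathfrak s$ and $X_i^*$ the dual basis, $(X_i^*,X_j)=\delta_{ij}$. Put $\phi_{\mathfrak s}=-\frac1{12}\sum_{i,j,k}(-1)^{p(X_i)p(X_j)+p(X_k)}([X_i,X_j],X_k)\,X_i^*\wedge X_j^*\wedge X_k^*$, viewed in $C(\mathfrak s)$ via super-antisymmetrization (quantization map) $\bigwedge\mathfrak s\cong C(\mathfrak s)$, and $D=D(\mathfrak g,\mathfrak l)=\sum_iX_i\otimes X_i^*+1\otimes\phi_{\mathfrak s}\in\mathfrak U(\mathfrak g)\otimes C(\mathfrak s)$. Dirac cohomology: $\overline M(\mathfrak s)=C(\mathfrak s)/C(\mathfrak s)\mathfrak u\cong\bigwedge\bar{\mathfrak u}_0\otimes\mathrm{Sym}(\bar{\mathfrak u}_1)$ is the oscillator supermodule ($\bar{\mathfrak u}$ acts by multiplication, $\mathfrak u$ by contraction). $D$ acts on $M\otimes\overline M(\mathfrak s)$ componentwise (with Koszul signs), and $H_D(M)=\ker D/(\ker D\cap\operatorname{im}D)$. *)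

theory Defs
  imports
    Complex_Main
    "HOL-Library.Function_Algebras"
    "HOL-Library.Set_Algebras"
    "HOL-Library.Poly_Mapping"
    "HOL-Combinatorics.Permutations"
    "HOL-Computational_Algebra.Group_Closure"
begin

section \<open>Lie superalgebras over the complex numbers\<close>

text \<open>The underlying space is the subspace \<open>ev L \<oplus> od L\<close> of the ambient type; the bracket
  is only relevant there.\<close>

record 'g lsa =
  scal :: "complex \<Rightarrow> 'g \<Rightarrow> 'g"
  ev :: "'g set"
  od :: "'g set"
  br :: "'g \<Rightarrow> 'g \<Rightarrow> 'g"

definition car :: "'g::ab_group_add lsa \<Rightarrow> 'g set" where
  "car L = {x + y | x y. x \<in> ev L \<and> y \<in> od L}"

definition homog :: "'g lsa \<Rightarrow> 'g set" where
  "homog L = ev L \<union> od L"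

text \<open>The parity of homogeneous elements; the value on \<open>0\<close> never matters.\<close>

definition par :: "'g lsa \<Rightarrow> 'g \<Rightarrow> nat" where
  "par L x = (if x \<in> ev L then 0 else 1)"

definition lie_superalgebra :: "'g::ab_group_add lsa \<Rightarrow> bool" where
  "lie_superalgebra L \<longleftrightarrow>
     vector_space (scal L) \<and>
     module.subspace (scal L) (ev L) \<and> module.subspace (scal L) (od L) \<and> ev L \<inter> od L = {0} \<and>
     (\<forall>x\<in>car L. \<forall>y\<in>car L. \<forall>z\<in>car L. br L (x + y) z = br L x z + br L y z) \<and>
     (\<forall>x\<in>car L. \<forall>y\<in>car L. \<forall>z\<in>car L. br L x (y + z) = br L x y + br L x z) \<and>
     (\<forall>c. \<forall>x\<in>car L. \<forall>y\<in>car L. br L (scal L c x) y = scal L c (br L x y)) \<and>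
     (\<forall>c. \<forall>x\<in>car L. \<forall>y\<in>car L. br L x (scal L c y) = scal L c (br L x y)) \<and>
     (\<forall>x\<in>ev L. \<forall>y\<in>ev L. br L x y \<in> ev L) \<and>
     (\<forall>x\<in>ev L. \<forall>y\<in>od L. br L x y \<in> od L) \<and>
     (\<forall>x\<in>od L. \<forall>y\<in>ev L. br L x y \<in> od L) \<and>
     (\<forall>x\<in>od L. \<forall>y\<in>od L. br L x y \<in> ev L) \<and>
     (\<forall>x\<in>homog L. \<forall>y\<in>homog L.
        br L x y = scal L (- ((-1) ^ (par L x * par L y))) (br L y x)) \<and>
     (\<forall>x\<in>homog L. \<forall>y\<in>homog L. \<forall>z\<in>homog L.
        br L x (br L y z) =
          br L (br L x y) z + scal L ((-1) ^ (par L x * par L y)) (br L y (br L x z)))"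

definition finite_dimensional :: "'g::ab_group_add lsa \<Rightarrow> bool" where
  "finite_dimensional L \<longleftrightarrow> (\<exists>S. finite S \<and> S \<subseteq> car L \<and> module.span (scal L) S = car L)"

definition graded_ideal :: "'g::ab_group_add lsa \<Rightarrow> 'g set \<Rightarrow> bool" where
  "graded_ideal L I \<longleftrightarrow>
     module.subspace (scal L) I \<and> I = {x + y | x y. x \<in> I \<inter> ev L \<and> y \<in> I \<inter> od L} \<and>
     (\<forall>x\<in>car L. \<forall>y\<in>I. br L x y \<in> I)"

definition simple_lsa :: "'g::ab_group_add lsa \<Rightarrow> bool" where
  "simple_lsa L \<longleftrightarrow>
     (\<exists>x\<in>car L. \<exists>y\<in>car L. br L x y \<noteq> 0) \<and>
     (\<forall>I. graded_ideal L I \<longrightarrow> I = {0} \<or> I = car L)"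

definition lsa_hom :: "'a::ab_group_add lsa \<Rightarrow> 'b::ab_group_add lsa \<Rightarrow> ('a \<Rightarrow> 'b) \<Rightarrow> bool" where
  "lsa_hom K L \<phi> \<longleftrightarrow>
     (\<forall>x\<in>ev K. \<phi> x \<in> ev L) \<and> (\<forall>x\<in>od K. \<phi> x \<in> od L) \<and>
     (\<forall>x\<in>car K. \<forall>y\<in>car K. \<phi> (x + y) = \<phi> x + \<phi> y) \<and>
     (\<forall>c. \<forall>x\<in>car K. \<phi> (scal K c x) = scal L c (\<phi> x)) \<and>
     (\<forall>x\<in>car K. \<forall>y\<in>car K. \<phi> (br K x y) = br L (\<phi> x) (\<phi> y))"

definition lsa_iso :: "'a::ab_group_add lsa \<Rightarrow> 'b::ab_group_add lsa \<Rightarrow> bool" where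
  "lsa_iso K L \<longleftrightarrow> (\<exists>\<phi>. lsa_hom K L \<phi> \<and> bij_betw \<phi> (car K) (car L))"

text \<open>\<open>L\<close> is isomorphic to the quotient of \<open>K\<close> by \<open>I\<close>.\<close>

definition lsa_quotient :: "'a::ab_group_add lsa \<Rightarrow> 'a set \<Rightarrow> 'b::ab_group_add lsa \<Rightarrow> bool" where
  "lsa_quotient K I L \<longleftrightarrow>
     (\<exists>\<phi>. lsa_hom K L \<phi> \<and> \<phi> ` car K = car L \<and> {x \<in> car K. \<phi> x = 0} = I)"


section \<open>Basic classical Lie superalgebras\<close>

text \<open>Supermatrices are functions supported on \<open>{..<m+n} \<times> {..<m+n}\<close>; indices below \<open>m\<close> are
  even, the others are odd.\<close>

definition idx_par :: "nat \<Rightarrow> nat \<Rightarrow> nat" where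
  "idx_par m i = (if i < m then 0 else 1)"

definition gl :: "nat \<Rightarrow> nat \<Rightarrow> (nat \<Rightarrow> nat \<Rightarrow> complex) lsa" where
  "gl m n =
     \<lparr> scal = (\<lambda>c A i j. c * A i j),
       ev = {A. \<forall>i j. A i j \<noteq> 0 \<longrightarrow> i < m + n \<and> j < m + n \<and> idx_par m i = idx_par m j},
       od = {A. \<forall>i j. A i j \<noteq> 0 \<longrightarrow> i < m + n \<and> j < m + n \<and> idx_par m i \<noteq> idx_par m j},
       br = (\<lambda>A B i j. \<Sum>l<m + n. (A i l * B l j
              - (-1) ^ ((idx_par m i + idx_par m l) * (idx_par m l + idx_par m j)) * B i l * A l j)) \<rparr>"

definition supertrace :: "nat \<Rightarrow> nat \<Rightarrow> (nat \<Rightarrow> nat \<Rightarrow> complex) \<Rightarrow> complex" where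
  "supertrace m n A = (\<Sum>i<m + n. (-1) ^ idx_par m i * A i i)"

definition sl :: "nat \<Rightarrow> nat \<Rightarrow> (nat \<Rightarrow> nat \<Rightarrow> complex) lsa" where
  "sl m n = (gl m n)\<lparr> ev := {A \<in> ev (gl m n). supertrace m n A = 0} \<rparr>"

definition scalar_matrices :: "nat \<Rightarrow> (nat \<Rightarrow> nat \<Rightarrow> complex) set" where
  "scalar_matrices k = {\<lambda>i j. if i = j \<and> i < k then c else 0 | c. True}"

text \<open>The Gram matrix of the even supersymmetric form on the superspace of dimension \<open>k|2n\<close>:
  identity on the even part, standard symplectic on the odd part.\<close>

definition osp_gram :: "nat \<Rightarrow> nat \<Rightarrow> nat \<Rightarrow> nat \<Rightarrow> complex" where
  "osp_gram k n i j =
     (if i < k \<and> i = j then 1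
      else if k \<le> i \<and> i < k + n \<and> j = i + n then 1
      else if k \<le> j \<and> j < k + n \<and> i = j + n then - 1
      else 0)"

text \<open>\<open>osp_inv k n p A\<close> states \<open>F(A v, w) + (-1)^(p p(v)) F(v, A w) = 0\<close> on the standard basis.\<close>

definition osp_inv :: "nat \<Rightarrow> nat \<Rightarrow> nat \<Rightarrow> (nat \<Rightarrow> nat \<Rightarrow> complex) \<Rightarrow> bool" where
  "osp_inv k n p A \<longleftrightarrow>
     (\<forall>i<k + 2 * n. \<forall>j<k + 2 * n.
        (\<Sum>l<k + 2 * n. A l i * osp_gram k n l j)
        + (-1) ^ (p * idx_par k i) * (\<Sum>l<k + 2 * n. osp_gram k n i l * A l j) = 0)"

definition osp :: "nat \<Rightarrow> nat \<Rightarrow> (nat \<Rightarrow> nat \<Rightarrow> complex) lsa" where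
  "osp k n = (gl k (2 * n))
     \<lparr> ev := {A \<in> ev (gl k (2 * n)). osp_inv k n 0 A},
       od := {A \<in> od (gl k (2 * n)). osp_inv k n 1 A} \<rparr>"

text \<open>Simple Lie superalgebras with Chevalley generators for a Cartan matrix \<open>A\<close> (a list of rows)
  and a set \<open>T\<close> of odd simple root indices. For invertible indecomposable \<open>A\<close> this determines the
  algebra up to isomorphism, as the contragredient Lie superalgebra of \<open>(A, T)\<close>.\<close>

definition chevalley_generated ::
    "'g::ab_group_add lsa \<Rightarrow> complex list list \<Rightarrow> nat set \<Rightarrow> bool" where
  "chevalley_generated L A T \<longleftrightarrow>
     (\<exists>e f h. let r = length A in
        (\<forall>i<r. h i \<in> ev L \<and> (if i \<in> T then e i \<in> od L \<and> f i \<in> od L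
                                          else e i \<in> ev L \<and> f i \<in> ev L)) \<and>
        (\<forall>i<r. \<forall>j<r. br L (h i) (h j) = 0 \<and>
           br L (e i) (f j) = (if i = j then h i else 0) \<and>
           br L (h i) (e j) = scal L (A ! i ! j) (e j) \<and>
           br L (h i) (f j) = scal L (- (A ! i ! j)) (f j)) \<and>
        (\<forall>S. module.subspace (scal L) S \<and> S \<subseteq> car L \<and> (\<forall>x\<in>S. \<forall>y\<in>S. br L x y \<in> S) \<and>
             (\<forall>i<r. e i \<in> S \<and> f i \<in> S \<and> h i \<in> S) \<longrightarrow> S = car L))"

definition cartan_type :: "'g::ab_group_add lsa \<Rightarrow> complex list list \<Rightarrow> nat set \<Rightarrow> bool" where
  "cartan_type L A T \<longleftrightarrow> simple_lsa L \<and> chevalley_generated L A T"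

definition type_A :: "nat \<Rightarrow> nat \<Rightarrow> 'g::ab_group_add lsa \<Rightarrow> bool" where
  "type_A m n L \<longleftrightarrow>
     (if m = n then n \<ge> 1 \<and> lsa_quotient (sl (n + 1) (n + 1)) (scalar_matrices (2 * n + 2)) L
      else lsa_iso (sl (m + 1) (n + 1)) L)"

definition type_B :: "nat \<Rightarrow> nat \<Rightarrow> 'g::ab_group_add lsa \<Rightarrow> bool" where
  "type_B m n L \<longleftrightarrow> n \<ge> 1 \<and> lsa_iso (osp (2 * m + 1) n) L"

definition type_C :: "nat \<Rightarrow> 'g::ab_group_add lsa \<Rightarrow> bool" where
  "type_C n L \<longleftrightarrow> n \<ge> 2 \<and> lsa_iso (osp 2 (n - 1)) L"

definition type_D :: "nat \<Rightarrow> nat \<Rightarrow> 'g::ab_group_add lsa \<Rightarrow> bool" where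
  "type_D m n L \<longleftrightarrow> m \<ge> 2 \<and> n \<ge> 1 \<and> lsa_iso (osp (2 * m) n) L"

text \<open>Distinguished Cartan matrices as in Kac's table.\<close>

definition type_F4 :: "'g::ab_group_add lsa \<Rightarrow> bool" where
  "type_F4 L \<longleftrightarrow>
     cartan_type L [[0, 1, 0, 0], [-1, 2, -2, 0], [0, -1, 2, -1], [0, 0, -1, 2]] {0}"

definition type_G3 :: "'g::ab_group_add lsa \<Rightarrow> bool" where
  "type_G3 L \<longleftrightarrow> cartan_type L [[0, 1, 0], [-1, 2, -3], [0, -1, 2]] {0}"

definition type_D21 :: "complex \<Rightarrow> 'g::ab_group_add lsa \<Rightarrow> bool" where
  "type_D21 a L \<longleftrightarrow> a \<noteq> 0 \<and> a \<noteq> -1 \<and> cartan_type L [[0, 1, a], [-1, 2, 0], [-1, 0, 2]] {0}"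

definition basic_classical :: "'g::ab_group_add lsa \<Rightarrow> bool" where
  "basic_classical L \<longleftrightarrow>
     lie_superalgebra L \<and> finite_dimensional L \<and> od L \<noteq> {0} \<and>
     ((\<exists>m\<ge>1. \<exists>n\<ge>1. lsa_iso (gl m n) L) \<or>
      (\<exists>m n. type_A m n L) \<or> (\<exists>m n. type_B m n L) \<or> (\<exists>n. type_C n L) \<or> (\<exists>m n. type_D m n L) \<or>
      type_F4 L \<or> type_G3 L \<or> (\<exists>a::real. type_D21 (complex_of_real a) L))"

definition invariant_form :: "'g::ab_group_add lsa \<Rightarrow> ('g \<Rightarrow> 'g \<Rightarrow> complex) \<Rightarrow> bool" where
  "invariant_form L B \<longleftrightarrow>
     (\<forall>x\<in>car L. \<forall>y\<in>car L. \<forall>z\<in>car L. B (x + y) z = B x z + B y z) \<and>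
     (\<forall>x\<in>car L. \<forall>y\<in>car L. \<forall>z\<in>car L. B x (y + z) = B x y + B x z) \<and>
     (\<forall>c. \<forall>x\<in>car L. \<forall>y\<in>car L. B (scal L c x) y = c * B x y \<and> B x (scal L c y) = c * B x y) \<and>
     (\<forall>x\<in>homog L. \<forall>y\<in>homog L. B x y = (-1) ^ (par L x * par L y) * B y x) \<and>
     (\<forall>x\<in>car L. \<forall>y\<in>car L. \<forall>z\<in>car L. B (br L x y) z = B x (br L y z)) \<and>
     (\<forall>x\<in>ev L. \<forall>y\<in>od L. B x y = 0) \<and>
     (\<forall>x\<in>car L. (\<forall>y\<in>car L. B x y = 0) \<longrightarrow> x = 0)"


section \<open>Roots, positive systems and parabolic subalgebras\<close>

text \<open>Cartan subalgebras of the even part: commutative, self-centralizing, and acting by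
  diagonalizable operators.\<close>

definition cartan_subalgebra :: "'g::ab_group_add lsa \<Rightarrow> 'g set \<Rightarrow> bool" where
  "cartan_subalgebra L h \<longleftrightarrow>
     module.subspace (scal L) h \<and> h \<subseteq> ev L \<and>
     (\<forall>H\<in>h. \<forall>K\<in>h. br L H K = 0) \<and>
     (\<forall>x\<in>ev L. (\<forall>H\<in>h. br L H x = 0) \<longrightarrow> x \<in> h) \<and>
     (\<forall>H\<in>h. module.span (scal L) {x \<in> car L. \<exists>c. br L H x = scal L c x} = car L)"

text \<open>Functionals on \<open>h\<close> are extended by \<open>0\<close>, so that they are determined by their values on \<open>h\<close>.\<close>

definition dual_space :: "'g::ab_group_add lsa \<Rightarrow> 'g set \<Rightarrow> ('g \<Rightarrow> complex) set" where
  "dual_space L h = {l. (\<forall>x\<in>h. \<forall>y\<in>h. l (x + y) = l x + l y) \<and>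
     (\<forall>c. \<forall>x\<in>h. l (scal L c x) = c * l x) \<and> (\<forall>x. x \<notin> h \<longrightarrow> l x = 0)}"

definition root_space :: "'g::ab_group_add lsa \<Rightarrow> 'g set \<Rightarrow> ('g \<Rightarrow> complex) \<Rightarrow> 'g set" where
  "root_space L h a = {x \<in> car L. \<forall>H\<in>h. br L H x = scal L (a H) x}"

definition roots :: "'g::ab_group_add lsa \<Rightarrow> 'g set \<Rightarrow> ('g \<Rightarrow> complex) set" where
  "roots L h = {a \<in> dual_space L h. a \<noteq> 0 \<and> root_space L h a \<noteq> {0}}"

definition real_scale :: "real \<Rightarrow> ('g \<Rightarrow> complex) \<Rightarrow> 'g \<Rightarrow> complex" where
  "real_scale r l = (\<lambda>x. complex_of_real r * l x)"

text \<open>The positive roots for a total order on the real span of the roots that is compatible with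
  its real vector space structure.\<close>

definition positive_system ::
    "'g::ab_group_add lsa \<Rightarrow> 'g set \<Rightarrow> ('g \<Rightarrow> complex) set \<Rightarrow> bool" where
  "positive_system L h P \<longleftrightarrow>
     (let E = module.span real_scale (roots L h) in
      \<exists>R. linear_order_on E R \<and>
        (\<forall>x y z. (x, y) \<in> R \<and> z \<in> E \<longrightarrow> (x + z, y + z) \<in> R) \<and>
        (\<forall>x y r. (x, y) \<in> R \<and> 0 \<le> r \<longrightarrow> (real_scale r x, real_scale r y) \<in> R) \<and>
        P = {a \<in> roots L h. (0, a) \<in> R})"

definition nplus :: "'g::ab_group_add lsa \<Rightarrow> 'g set \<Rightarrow> ('g \<Rightarrow> complex) set \<Rightarrow> 'g set" where
  "nplus L h P = module.span (scal L) (\<Union>a\<in>P. root_space L h a)"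

text \<open>The nilradical \<open>\<uu>\<close> and the opposite nilradical of the parabolic subalgebra given by an additive
  map \<open>f\<close> on the root lattice, and their sum \<open>\<ss>\<close>. The Levi subalgebra enters the Dirac operator only
  through \<open>\<ss>\<close>.\<close>

definition par_u :: "'g::ab_group_add lsa \<Rightarrow> 'g set \<Rightarrow> (('g \<Rightarrow> complex) \<Rightarrow> int) \<Rightarrow> 'g set" where
  "par_u L h f = module.span (scal L) (\<Union>a\<in>{a \<in> roots L h. f a > 0}. root_space L h a)"

definition par_ubar :: "'g::ab_group_add lsa \<Rightarrow> 'g set \<Rightarrow> (('g \<Rightarrow> complex) \<Rightarrow> int) \<Rightarrow> 'g set" where
  "par_ubar L h f = module.span (scal L) (\<Union>a\<in>{a \<in> roots L h. f a < 0}. root_space L h a)"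

definition par_s :: "'g::ab_group_add lsa \<Rightarrow> 'g set \<Rightarrow> (('g \<Rightarrow> complex) \<Rightarrow> int) \<Rightarrow> 'g set" where
  "par_s L h f = {x + y | x y. x \<in> par_u L h f \<and> y \<in> par_ubar L h f}"

definition parabolic_datum ::
    "'g::ab_group_add lsa \<Rightarrow> 'g set \<Rightarrow> ('g \<Rightarrow> complex) set \<Rightarrow> (('g \<Rightarrow> complex) \<Rightarrow> int) \<Rightarrow> bool" where
  "parabolic_datum L h P f \<longleftrightarrow>
     (\<forall>a\<in>group_closure (roots L h). \<forall>b\<in>group_closure (roots L h). f (a + b) = f a + f b) \<and>
     {a \<in> roots L h. f a > 0} \<subseteq> P"


section \<open>Highest weight supermodules\<close>

text \<open>The underlying space of a supermodule is the whole type \<open>'m\<close>.\<close>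

record ('g, 'm) supermod =
  m_scal :: "complex \<Rightarrow> 'm \<Rightarrow> 'm"
  m_ev :: "'m set"
  m_od :: "'m set"
  act :: "'g \<Rightarrow> 'm \<Rightarrow> 'm"

definition supermodule :: "'g::ab_group_add lsa \<Rightarrow> ('g, 'm::ab_group_add) supermod \<Rightarrow> bool" where
  "supermodule L M \<longleftrightarrow>
     vector_space (m_scal M) \<and>
     module.subspace (m_scal M) (m_ev M) \<and> module.subspace (m_scal M) (m_od M) \<and>
     m_ev M \<inter> m_od M = {0} \<and> (\<forall>m. \<exists>x\<in>m_ev M. \<exists>y\<in>m_od M. m = x + y) \<and>
     (\<forall>x\<in>car L. \<forall>y\<in>car L. \<forall>m. act M (x + y) m = act M x m + act M y m) \<and>
     (\<forall>c. \<forall>x\<in>car L. \<forall>m. act M (scal L c x) m = m_scal M c (act M x m)) \<and>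
     (\<forall>x\<in>car L. \<forall>m m'. act M x (m + m') = act M x m + act M x m') \<and>
     (\<forall>c. \<forall>x\<in>car L. \<forall>m. act M x (m_scal M c m) = m_scal M c (act M x m)) \<and>
     (\<forall>x\<in>ev L. \<forall>m\<in>m_ev M. act M x m \<in> m_ev M) \<and> (\<forall>x\<in>ev L. \<forall>m\<in>m_od M. act M x m \<in> m_od M) \<and>
     (\<forall>x\<in>od L. \<forall>m\<in>m_ev M. act M x m \<in> m_od M) \<and> (\<forall>x\<in>od L. \<forall>m\<in>m_od M. act M x m \<in> m_ev M) \<and>
     (\<forall>x\<in>homog L. \<forall>y\<in>homog L. \<forall>m.
        act M (br L x y) m =
          act M x (act M y m) - m_scal M ((-1) ^ (par L x * par L y)) (act M y (act M x m)))"

text \<open>The submodule generated by \<open>v\<close> over the enveloping algebra: the span of all \<open>x\<^sub>1 \<dots> x\<^sub>k v\<close>.\<close>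

definition cyclic_submodule ::
    "'g::ab_group_add lsa \<Rightarrow> ('g, 'm::ab_group_add) supermod \<Rightarrow> 'm \<Rightarrow> 'm set" where
  "cyclic_submodule L M v = module.span (m_scal M) {foldr (act M) xs v | xs. set xs \<subseteq> car L}"

definition highest_weight_supermodule ::
    "'g::ab_group_add lsa \<Rightarrow> 'g set \<Rightarrow> ('g \<Rightarrow> complex) set \<Rightarrow> ('g, 'm::ab_group_add) supermod
     \<Rightarrow> ('g \<Rightarrow> complex) \<Rightarrow> bool" where
  "highest_weight_supermodule L h P M \<Lambda> \<longleftrightarrow>
     supermodule L M \<and> \<Lambda> \<in> dual_space L h \<and>
     (\<exists>v. v \<noteq> 0 \<and> (\<forall>x\<in>nplus L h P. act M x v = 0) \<and>
          (\<forall>H\<in>h. act M H v = m_scal M (\<Lambda> H) v) \<and> cyclic_submodule L M v = UNIV)"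

text \<open>The parity operator \<open>m \<mapsto> (-1)^p(m) m\<close>.\<close>

definition parity_op :: "('g, 'm::ab_group_add) supermod \<Rightarrow> 'm \<Rightarrow> 'm" where
  "parity_op M m = (THE z. \<exists>x\<in>m_ev M. \<exists>y\<in>m_od M. m = x + y \<and> z = x - y)"


section \<open>Quotient spaces and tensor products\<close>

text \<open>Elements of a quotient \<open>V / N\<close> are the cosets \<open>a +o N\<close>. Their sum is the set sum, the zero
  vector is \<open>N\<close>, and \<open>quot_scale sc N\<close> is the induced scalar multiplication; the summand \<open>N\<close>
  there only matters for the scalar \<open>0\<close>.\<close>

definition quot :: "'a::plus set \<Rightarrow> 'a set \<Rightarrow> 'a set set" where
  "quot V N = (\<lambda>a. a +o N) ` V"

definition quot_scale ::
    "(complex \<Rightarrow> 'a::plus \<Rightarrow> 'a) \<Rightarrow> 'a set \<Rightarrow> complex \<Rightarrow> 'a set \<Rightarrow> 'a set" where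
  "quot_scale sc N c A = sc c ` A + N"

text \<open>\<open>'b \<Rightarrow>\<^sub>0 complex\<close> is the vector space with basis \<open>'b\<close>.\<close>

definition fscale :: "complex \<Rightarrow> ('b \<Rightarrow>\<^sub>0 complex) \<Rightarrow> 'b \<Rightarrow>\<^sub>0 complex" where
  "fscale c p = Poly_Mapping.map ((*) c) p"

abbreviation basis_vec :: "'b \<Rightarrow> 'b \<Rightarrow>\<^sub>0 complex" where
  "basis_vec b \<equiv> Poly_Mapping.single b 1"

definition tensor_free :: "'a set \<Rightarrow> 'b set \<Rightarrow> ('a \<times> 'b \<Rightarrow>\<^sub>0 complex) set" where
  "tensor_free V W = {t. Poly_Mapping.keys t \<subseteq> V \<times> W}"

definition tensor_rels ::
    "(complex \<Rightarrow> 'a::plus \<Rightarrow> 'a) \<Rightarrow> 'a set \<Rightarrow> (complex \<Rightarrow> 'b::plus \<Rightarrow> 'b) \<Rightarrow> 'b set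
     \<Rightarrow> ('a \<times> 'b \<Rightarrow>\<^sub>0 complex) set" where
  "tensor_rels sV V sW W = module.span fscale
     ({basis_vec (v + v', w) - basis_vec (v, w) - basis_vec (v', w) | v v' w.
         v \<in> V \<and> v' \<in> V \<and> w \<in> W} \<union>
      {basis_vec (v, w + w') - basis_vec (v, w) - basis_vec (v, w') | v w w'.
         v \<in> V \<and> w \<in> W \<and> w' \<in> W} \<union>
      {basis_vec (sV c v, w) - fscale c (basis_vec (v, w)) | c v w. v \<in> V \<and> w \<in> W} \<union>
      {basis_vec (v, sW c w) - fscale c (basis_vec (v, w)) | c v w. v \<in> V \<and> w \<in> W})"


section \<open>The Clifford superalgebra and the oscillator supermodule\<close>

text \<open>Words under concatenation, written additively so that \<open>'g list \<Rightarrow>\<^sub>0 complex\<close> becomes the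
  free associative algebra on the set \<open>'g\<close>.\<close>

instantiation list :: (type) monoid_add
begin
definition zero_list :: "'a list" where "zero_list = []"
definition plus_list :: "'a list \<Rightarrow> 'a list \<Rightarrow> 'a list" where "plus_list = append"
instance by standard (simp_all add: zero_list_def plus_list_def)
end

type_synonym 'g free_alg = "'g list \<Rightarrow>\<^sub>0 complex"

definition gen :: "'g \<Rightarrow> 'g free_alg" where
  "gen x = basis_vec [x]"

definition free_on :: "'g set \<Rightarrow> 'g free_alg set" where
  "free_on S = {a. \<forall>w\<in>Poly_Mapping.keys a. set w \<subseteq> S}"

text \<open>The two-sided ideal of relations of the Clifford superalgebra, including those that make
  the generators depend linearly on the elements of the subspace \<open>S\<close>.\<close>

definition cliff_ideal ::
    "'g::ab_group_add lsa \<Rightarrow> ('g \<Rightarrow> 'g \<Rightarrow> complex) \<Rightarrow> 'g set \<Rightarrow> 'g free_alg set" where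
  "cliff_ideal L B S = module.span fscale {a * r * b | a r b. a \<in> free_on S \<and> b \<in> free_on S \<and>
     r \<in> {gen (x + y) - gen x - gen y | x y. x \<in> S \<and> y \<in> S} \<union>
         {gen (scal L c x) - fscale c (gen x) | c x. x \<in> S} \<union>
         {gen x * gen y + fscale ((-1) ^ (par L x * par L y)) (gen y * gen x)
            - fscale (2 * B x y) 1 | x y. x \<in> S \<inter> homog L \<and> y \<in> S \<inter> homog L}}"

definition clifford ::
    "'g::ab_group_add lsa \<Rightarrow> ('g \<Rightarrow> 'g \<Rightarrow> complex) \<Rightarrow> 'g set \<Rightarrow> 'g free_alg set set" where
  "clifford L B S = quot (free_on S) (cliff_ideal L B S)"

text \<open>The left ideal of the Clifford superalgebra generated by \<open>U\<close>.\<close>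

definition cliff_left_ideal ::
    "'g::ab_group_add lsa \<Rightarrow> ('g \<Rightarrow> 'g \<Rightarrow> complex) \<Rightarrow> 'g set \<Rightarrow> 'g set \<Rightarrow> 'g free_alg set set" where
  "cliff_left_ideal L B S U =
     (\<lambda>a. a +o cliff_ideal L B S) ` module.span fscale {a * gen x | a x. a \<in> free_on S \<and> x \<in> U}"

definition oscillator ::
    "'g::ab_group_add lsa \<Rightarrow> ('g \<Rightarrow> 'g \<Rightarrow> complex) \<Rightarrow> 'g set \<Rightarrow> 'g set
     \<Rightarrow> 'g free_alg set set set" where
  "oscillator L B S U = quot (clifford L B S) (cliff_left_ideal L B S U)"

definition osc_scale ::
    "'g::ab_group_add lsa \<Rightarrow> ('g \<Rightarrow> 'g \<Rightarrow> complex) \<Rightarrow> 'g set \<Rightarrow> 'g set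
     \<Rightarrow> complex \<Rightarrow> 'g free_alg set set \<Rightarrow> 'g free_alg set set" where
  "osc_scale L B S U =
     quot_scale (quot_scale fscale (cliff_ideal L B S)) (cliff_left_ideal L B S U)"

definition osc_class ::
    "'g::ab_group_add lsa \<Rightarrow> ('g \<Rightarrow> 'g \<Rightarrow> complex) \<Rightarrow> 'g set \<Rightarrow> 'g set
     \<Rightarrow> 'g free_alg \<Rightarrow> 'g free_alg set set" where
  "osc_class L B S U a = (a +o cliff_ideal L B S) +o cliff_left_ideal L B S U"

text \<open>Left multiplication by the Clifford element represented by \<open>c\<close>; it does not depend on the
  representative chosen by \<^const>\<open>inv_into\<close>.\<close>

definition osc_act ::
    "'g::ab_group_add lsa \<Rightarrow> ('g \<Rightarrow> 'g \<Rightarrow> complex) \<Rightarrow> 'g set \<Rightarrow> 'g set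
     \<Rightarrow> 'g free_alg \<Rightarrow> 'g free_alg set set \<Rightarrow> 'g free_alg set set" where
  "osc_act L B S U c w = osc_class L B S U (c * inv_into (free_on S) (osc_class L B S U) w)"


section \<open>The cubic Dirac operator and Dirac cohomology\<close>

definition homogeneous_dual_bases ::
    "'g::ab_group_add lsa \<Rightarrow> ('g \<Rightarrow> 'g \<Rightarrow> complex) \<Rightarrow> 'g set \<Rightarrow> nat \<Rightarrow> (nat \<Rightarrow> 'g) \<Rightarrow> (nat \<Rightarrow> 'g)
     \<Rightarrow> bool" where
  "homogeneous_dual_bases L B S N X Xd \<longleftrightarrow>
     X ` {1..N} \<subseteq> homog L \<and> inj_on X {1..N} \<and>
     \<not> module.dependent (scal L) (X ` {1..N}) \<and> module.span (scal L) (X ` {1..N}) = S \<and>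
     Xd ` {1..N} \<subseteq> S \<and>
     (\<forall>i\<in>{1..N}. \<forall>j\<in>{1..N}. B (Xd i) (X j) = (if i = j then 1 else 0))"

text \<open>Quantization of \<open>v\<^sub>0 \<and> \<dots> \<and> v\<^sub>k\<^sub>-\<^sub>1\<close> for homogeneous \<open>v\<^sub>i\<close>, where
  \<open>v \<and> w = -(-1)^(p(v) p(w)) w \<and> v\<close>: each inversion of a permutation contributes one such sign.\<close>

definition super_sign :: "'g lsa \<Rightarrow> 'g list \<Rightarrow> (nat \<Rightarrow> nat) \<Rightarrow> complex" where
  "super_sign L vs \<sigma> =
     (\<Prod>(i, j)\<in>{(i, j). i < j \<and> j < length vs \<and> \<sigma> j < \<sigma> i}.
        - ((-1) ^ (par L (vs ! \<sigma> i) * par L (vs ! \<sigma> j))))"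

definition quantize :: "'g lsa \<Rightarrow> 'g list \<Rightarrow> 'g free_alg" where
  "quantize L vs =
     (\<Sum>\<sigma> | \<sigma> permutes {..<length vs}.
        Poly_Mapping.single (map (\<lambda>i. vs ! \<sigma> i) [0..<length vs])
          (super_sign L vs \<sigma> / fact (length vs)))"

text \<open>A representative of the cubic term in the free algebra. It is even, since
  \<open>([X\<^sub>i, X\<^sub>j], X\<^sub>k)\<close> vanishes unless the three parities add up to an even number.\<close>

definition cubic_term ::
    "'g lsa \<Rightarrow> ('g \<Rightarrow> 'g \<Rightarrow> complex) \<Rightarrow> nat \<Rightarrow> (nat \<Rightarrow> 'g) \<Rightarrow> (nat \<Rightarrow> 'g) \<Rightarrow> 'g free_alg" where
  "cubic_term L B N X Xd =
     fscale (- 1 / 12) (\<Sum>i=1..N. \<Sum>j=1..N. \<Sum>k=1..N.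
       fscale ((-1) ^ (par L (X i) * par L (X j) + par L (X k)) * B (br L (X i) (X j)) (X k))
         (quantize L [Xd i, Xd j, Xd k]))"

text \<open>The action of \<open>\<Sum>\<^sub>i X\<^sub>i \<otimes> X\<^sub>i\<^sup>* + 1 \<otimes> \<phi>\<close> on a pure tensor \<open>m \<otimes> w\<close>, with
  \<open>(x \<otimes> c)(m \<otimes> w) = (-1)^(p(c) p(m)) x m \<otimes> c w\<close>.\<close>

definition dirac_pure ::
    "'g::ab_group_add lsa \<Rightarrow> ('g \<Rightarrow> 'g \<Rightarrow> complex) \<Rightarrow> 'g set \<Rightarrow> 'g set \<Rightarrow> ('g, 'm::ab_group_add) supermod
     \<Rightarrow> nat \<Rightarrow> (nat \<Rightarrow> 'g) \<Rightarrow> (nat \<Rightarrow> 'g)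
     \<Rightarrow> 'm \<Rightarrow> 'g free_alg set set \<Rightarrow> ('m \<times> 'g free_alg set set \<Rightarrow>\<^sub>0 complex)" where
  "dirac_pure L B S U M N X Xd m w =
     (\<Sum>i=1..N. basis_vec (act M (X i) ((parity_op M ^^ par L (Xd i)) m),
                            osc_act L B S U (gen (Xd i)) w))
     + basis_vec (m, osc_act L B S U (cubic_term L B N X Xd) w)"

definition dirac_free ::
    "'g::ab_group_add lsa \<Rightarrow> ('g \<Rightarrow> 'g \<Rightarrow> complex) \<Rightarrow> 'g set \<Rightarrow> 'g set \<Rightarrow> ('g, 'm::ab_group_add) supermod
     \<Rightarrow> nat \<Rightarrow> (nat \<Rightarrow> 'g) \<Rightarrow> (nat \<Rightarrow> 'g)
     \<Rightarrow> ('m \<times> 'g free_alg set set \<Rightarrow>\<^sub>0 complex) \<Rightarrow> ('m \<times> 'g free_alg set set \<Rightarrow>\<^sub>0 complex)" where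
  "dirac_free L B S U M N X Xd t =
     (\<Sum>(m, w)\<in>Poly_Mapping.keys t.
        fscale (Poly_Mapping.lookup t (m, w)) (dirac_pure L B S U M N X Xd m w))"

definition osc_tensor_rels ::
    "'g::ab_group_add lsa \<Rightarrow> ('g \<Rightarrow> 'g \<Rightarrow> complex) \<Rightarrow> 'g set \<Rightarrow> 'g set \<Rightarrow> ('g, 'm::ab_group_add) supermod
     \<Rightarrow> ('m \<times> 'g free_alg set set \<Rightarrow>\<^sub>0 complex) set" where
  "osc_tensor_rels L B S U M =
     tensor_rels (m_scal M) UNIV (osc_scale L B S U) (oscillator L B S U)"

text \<open>The tensor product of \<open>M\<close> with the oscillator supermodule.\<close>

definition osc_tensor ::
    "'g::ab_group_add lsa \<Rightarrow> ('g \<Rightarrow> 'g \<Rightarrow> complex) \<Rightarrow> 'g set \<Rightarrow> 'g set \<Rightarrow> ('g, 'm::ab_group_add) supermod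
     \<Rightarrow> ('m \<times> 'g free_alg set set \<Rightarrow>\<^sub>0 complex) set set" where
  "osc_tensor L B S U M = quot (tensor_free UNIV (oscillator L B S U)) (osc_tensor_rels L B S U M)"

text \<open>The operator induced on the tensor product; again the representative is irrelevant.\<close>

definition dirac_op ::
    "'g::ab_group_add lsa \<Rightarrow> ('g \<Rightarrow> 'g \<Rightarrow> complex) \<Rightarrow> 'g set \<Rightarrow> 'g set \<Rightarrow> ('g, 'm::ab_group_add) supermod
     \<Rightarrow> nat \<Rightarrow> (nat \<Rightarrow> 'g) \<Rightarrow> (nat \<Rightarrow> 'g)
     \<Rightarrow> ('m \<times> 'g free_alg set set \<Rightarrow>\<^sub>0 complex) set
     \<Rightarrow> ('m \<times> 'g free_alg set set \<Rightarrow>\<^sub>0 complex) set" where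
  "dirac_op L B S U M N X Xd A =
     (let R = osc_tensor_rels L B S U M in
      dirac_free L B S U M N X Xd
        (inv_into (tensor_free UNIV (oscillator L B S U)) (\<lambda>t. t +o R) A) +o R)"

definition dirac_ker ::
    "'g::ab_group_add lsa \<Rightarrow> ('g \<Rightarrow> 'g \<Rightarrow> complex) \<Rightarrow> 'g set \<Rightarrow> 'g set \<Rightarrow> ('g, 'm::ab_group_add) supermod
     \<Rightarrow> nat \<Rightarrow> (nat \<Rightarrow> 'g) \<Rightarrow> (nat \<Rightarrow> 'g)
     \<Rightarrow> ('m \<times> 'g free_alg set set \<Rightarrow>\<^sub>0 complex) set set" where
  "dirac_ker L B S U M N X Xd =
     {A \<in> osc_tensor L B S U M. dirac_op L B S U M N X Xd A = osc_tensor_rels L B S U M}"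

definition dirac_im ::
    "'g::ab_group_add lsa \<Rightarrow> ('g \<Rightarrow> 'g \<Rightarrow> complex) \<Rightarrow> 'g set \<Rightarrow> 'g set \<Rightarrow> ('g, 'm::ab_group_add) supermod
     \<Rightarrow> nat \<Rightarrow> (nat \<Rightarrow> 'g) \<Rightarrow> (nat \<Rightarrow> 'g)
     \<Rightarrow> ('m \<times> 'g free_alg set set \<Rightarrow>\<^sub>0 complex) set set" where
  "dirac_im L B S U M N X Xd = dirac_op L B S U M N X Xd ` osc_tensor L B S U M"

text \<open>The zero vector of this quotient space is \<open>dirac_ker \<inter> dirac_im\<close>.\<close>

definition dirac_cohomology ::
    "'g::ab_group_add lsa \<Rightarrow> ('g \<Rightarrow> 'g \<Rightarrow> complex) \<Rightarrow> 'g set \<Rightarrow> 'g set \<Rightarrow> ('g, 'm::ab_group_add) supermod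
     \<Rightarrow> nat \<Rightarrow> (nat \<Rightarrow> 'g) \<Rightarrow> (nat \<Rightarrow> 'g)
     \<Rightarrow> ('m \<times> 'g free_alg set set \<Rightarrow>\<^sub>0 complex) set set set" where
  "dirac_cohomology L B S U M N X Xd =
     quot (dirac_ker L B S U M N X Xd) (dirac_ker L B S U M N X Xd \<inter> dirac_im L B S U M N X Xd)"

end

theory Submission
  imports Defs
begin

text \<open>
  Write \<open>v\<close> for the highest weight vector and \<open>1\<close> for the vacuum of the oscillator supermodule. The
  vector \<open>v \<otimes> 1\<close> represents a nonzero class. Neither \<open>\<Sum>\<^sub>i X\<^sub>i \<otimes> X\<^sub>i\<^sup>*\<close> nor the cubic term modulo the Clifford
  relations depends on the basis of \<open>\<ss>\<close>, so one may use root vectors. Then in \<open>X\<^sub>i \<otimes> X\<^sub>i\<^sup>*\<close> either \<open>X\<^sub>i\<close> kills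
  \<open>v\<close> or \<open>X\<^sub>i\<^sup>*\<close> kills \<open>1\<close>; the cubic term has degree \<open>0\<close> for the grading by \<open>f\<close> and odd word length,
  whereas the degree \<open>0\<close> part of the oscillator supermodule is spanned by \<open>1\<close>, of even word length, so
  the cubic term kills \<open>1\<close>. Hence \<open>v \<otimes> 1\<close> lies in the kernel.

  It is not in the image: \<open>v\<close> does not lie in \<open>\<uu>\<^bold>-M\<close> for weight reasons, \<open>\<uu>\<^bold>-\<close> being the opposite
  nilradical, so there is a functional \<open>l\<close> with \<open>l v = 1\<close> that kills \<open>\<uu>\<^bold>-M\<close>. Let \<open>vev\<close> be the vacuum
  expectation value on the Clifford superalgebra, which kills the left ideal generated by \<open>\<uu>\<close> and the
  right ideal generated by \<open>\<uu>\<^bold>-\<close>. Then \<open>l \<otimes> vev\<close> vanishes on the image of the Dirac operator but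
  not at \<open>v \<otimes> 1\<close>.
\<close>

section \<open>Free algebras, linear functionals and joint eigenvectors\<close>

text \<open>The obstacle is that every space is a quotient of a free vector space and no basis of
  the Clifford superalgebra is at hand: that \<open>1\<close> survives in the oscillator supermodule
  has to be shown. This is what the Fock operators are for. They act on unreduced combinations of
  index words by \<open>create i + contr i\<close>, with contractions given by an asymmetric form
  \<open>cf\<close> whose super-symmetrization is \<open>2 * B\<close>. The Clifford relations then
  hold modulo an ideal without empty-word coefficient, so reading off that coefficient gives a
  well-defined \<open>vev\<close>. Identities in a quotient are tested with linear functionals that
  kill the relations. Every change of basis thereby becomes a statement about complex-valued
  bilinear maps, and the same device shows that the Dirac operator, defined through chosen
  representatives, respects the tensor relations. On the image the functional vanishes term by term:
  of two dual root vectors one has negative degree, and it is killed by \<open>l\<close> or by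
  \<open>vev\<close> according to the factor in which it stands.\<close>

lemma lookup_fscale [simp]: "Poly_Mapping.lookup (fscale c p) k = c * Poly_Mapping.lookup p k"
  by (simp add: fscale_def Poly_Mapping.map.rep_eq when_def)

interpretation fs: vector_space "fscale :: complex \<Rightarrow> ('b \<Rightarrow>\<^sub>0 complex) \<Rightarrow> _"
  by standard (auto intro!: poly_mapping_eqI simp: lookup_add algebra_simps)

lemma fscale_single [simp]: "fscale c (Poly_Mapping.single k v) = Poly_Mapping.single k (c * v)"
  by (auto intro!: poly_mapping_eqI simp: lookup_single when_def)

lemma poly_mapping_sum_monomials:
  "(\<Sum>w\<in>Poly_Mapping.keys a. Poly_Mapping.single w (Poly_Mapping.lookup a w)) = a"
proof (rule poly_mapping_eqI)
  fix k
  have "Poly_Mapping.lookup (\<Sum>w\<in>Poly_Mapping.keys a. Poly_Mapping.single w (Poly_Mapping.lookup a w)) k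
      = (\<Sum>w\<in>Poly_Mapping.keys a. if w = k then Poly_Mapping.lookup a k else 0)"
    by (simp add: lookup_sum lookup_single when_def if_distrib cong: if_cong)
  then show "Poly_Mapping.lookup (\<Sum>w\<in>Poly_Mapping.keys a. Poly_Mapping.single w (Poly_Mapping.lookup a w)) k
      = Poly_Mapping.lookup a k"
    by (simp add: in_keys_iff)
qed

lemma poly_mapping_expand:
  "a = (\<Sum>w\<in>Poly_Mapping.keys a. fscale (Poly_Mapping.lookup a w) (basis_vec w))"
  for a :: "'b \<Rightarrow>\<^sub>0 complex"
  by (simp add: poly_mapping_sum_monomials)

lemma fscale_mult_left: "fscale c a * b = fscale c (a * b)"
  for a b :: "'b::monoid_add \<Rightarrow>\<^sub>0 complex"
  by (simp add: fscale_def mult_map_scale_conv_mult mult.assoc)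

text \<open>Constants are multiples of the empty word, the unit of concatenation, hence central;
  this lets scalars leave the right factor of a product.\<close>

lemma single_0_commute: "Poly_Mapping.single 0 c * a = a * Poly_Mapping.single 0 c"
  for a :: "'b::monoid_add \<Rightarrow>\<^sub>0 complex"
proof -
  have "Poly_Mapping.single 0 c * (\<Sum>w\<in>Poly_Mapping.keys a. Poly_Mapping.single w (Poly_Mapping.lookup a w)) =
      (\<Sum>w\<in>Poly_Mapping.keys a. Poly_Mapping.single w (Poly_Mapping.lookup a w)) * Poly_Mapping.single 0 c"
    by (simp add: sum_distrib_left sum_distrib_right mult_single mult.commute)
  then show ?thesis by (simp add: poly_mapping_sum_monomials)
qed

lemma fscale_mult_right: "a * fscale c b = fscale c (a * b)"
  for a b :: "'b::monoid_add \<Rightarrow>\<^sub>0 complex"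
  by (simp add: fscale_def mult_map_scale_conv_mult flip: mult.assoc)
     (simp add: single_0_commute)

lemma basis_vec_mult: "basis_vec u * basis_vec w = basis_vec (u @ w)"
  by (simp add: mult_single plus_list_def)

lemma gen_mult_basis_vec: "gen x * basis_vec w = basis_vec (x # w)"
  by (simp add: gen_def basis_vec_mult)

lemma basis_vec_Nil: "basis_vec [] = (1 :: 'g free_alg)"
  by (simp add: zero_list_def[symmetric] one_poly_mapping.abs_eq single.abs_eq)

lemma basis_vec_Cons: "basis_vec (x # w) = gen x * basis_vec w"
  by (simp add: gen_def basis_vec_mult)

lemma free_on_subspace: "fs.subspace (free_on S)"
proof -
  have "Poly_Mapping.keys (fscale c a) \<subseteq> Poly_Mapping.keys a" for c and a :: "'a free_alg"
    by (auto simp: in_keys_iff)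
  then show ?thesis
    using Poly_Mapping.keys_add unfolding fs.subspace_def free_on_def by fastforce
qed

lemma basis_vec_in_free_on [simp]: "basis_vec w \<in> free_on S \<longleftrightarrow> set w \<subseteq> S"
  by (simp add: free_on_def)

lemma gen_in_free_on [simp]: "gen x \<in> free_on S \<longleftrightarrow> x \<in> S"
  by (simp add: gen_def)

lemma one_in_free_on [simp]: "1 \<in> free_on S"
  by (simp flip: basis_vec_Nil)

lemma free_on_span: "free_on S = fs.span {basis_vec w | w. set w \<subseteq> S}"
proof
  show "free_on S \<subseteq> fs.span {basis_vec w | w. set w \<subseteq> S}"
  proof
    fix a assume "a \<in> free_on S"
    then show "a \<in> fs.span {basis_vec w | w. set w \<subseteq> S}"
      by (subst poly_mapping_expand, intro fs.span_sum fs.span_scale fs.span_base)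
        (auto simp: free_on_def)
  qed
  show "fs.span {basis_vec w | w. set w \<subseteq> S} \<subseteq> free_on S"
    by (rule fs.span_minimal) (auto simp: free_on_subspace)
qed

lemma free_on_induct [consumes 1, case_names word add scale]:
  assumes "a \<in> free_on S"
    and "\<And>w. set w \<subseteq> S \<Longrightarrow> Q (basis_vec w)"
    and "\<And>a b. Q a \<Longrightarrow> Q b \<Longrightarrow> Q (a + b)"
    and "\<And>c a. Q a \<Longrightarrow> Q (fscale c a)"
  shows "Q a"
proof -
  \<comment> \<open>Zero needs no case of its own in the induction: it is a multiple of the empty
    word.\<close>
  have "Q (fscale 0 (basis_vec []))" by (intro assms(2,4)) simp
  then have "Q 0" by simp
  then have "fs.subspace {a. Q a}" using assms(3,4) by (auto simp: fs.subspace_def)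
  moreover have "{basis_vec w | w. set w \<subseteq> S} \<subseteq> {a. Q a}" using assms(2) by auto
  ultimately have "fs.span {basis_vec w | w. set w \<subseteq> S} \<subseteq> {a. Q a}" by (rule fs.span_minimal[rotated])
  with assms(1) show ?thesis by (auto simp: free_on_span)
qed

lemma free_on_mult: "a \<in> free_on S \<Longrightarrow> b \<in> free_on S \<Longrightarrow> a * b \<in> free_on S"
proof (induction rule: free_on_induct)
  case (word w)
  from word(2) show ?case
  proof (induction rule: free_on_induct)
    case (word u)
    with \<open>set w \<subseteq> S\<close> show ?case by (simp add: basis_vec_mult)
  qed (simp_all add: distrib_left fscale_mult_right fs.subspace_add fs.subspace_scale free_on_subspace)
qed (simp_all add: distrib_right fscale_mult_left fs.subspace_add fs.subspace_scale free_on_subspace)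

section \<open>Linear functionals and separation from subspaces\<close>

lemma vector_space_complex_mult: "vector_space ((*) :: complex \<Rightarrow> _)"
  by standard (simp_all add: algebra_simps)

text \<open>Functionals on free spaces are given by values on the basis; \<open>vev\<close> and the
  functional that separates the highest weight class from the image arise this way.\<close>

definition lext :: "('b \<Rightarrow> complex) \<Rightarrow> ('b \<Rightarrow>\<^sub>0 complex) \<Rightarrow> complex" where
  "lext g p = (\<Sum>k\<in>Poly_Mapping.keys p. Poly_Mapping.lookup p k * g k)"

lemma lext_superset:
  "finite A \<Longrightarrow> Poly_Mapping.keys p \<subseteq> A \<Longrightarrow> lext g p = (\<Sum>k\<in>A. Poly_Mapping.lookup p k * g k)"
  unfolding lext_def by (rule sum.mono_neutral_left) (auto simp: in_keys_iff)

lemma linear_lext: "Vector_Spaces.linear fscale (*) (lext g)"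
proof -
  have "lext g (a + b) = lext g a + lext g b" for a b
  proof -
    let ?A = "Poly_Mapping.keys a \<union> Poly_Mapping.keys b"
    have "Poly_Mapping.keys (a + b) \<subseteq> ?A" by (rule Poly_Mapping.keys_add)
    then show ?thesis
      by (simp add: lext_superset[where A = ?A] lookup_add distrib_right sum.distrib)
  qed
  moreover have "lext g (fscale c a) = c * lext g a" for c a
  proof -
    have "Poly_Mapping.keys (fscale c a) \<subseteq> Poly_Mapping.keys a" by (auto simp: in_keys_iff)
    then show ?thesis
      by (simp add: lext_superset[where A = "Poly_Mapping.keys a"] sum_distrib_left mult.assoc)
  qed
  ultimately show ?thesis
    by (intro Vector_Spaces.linear_iff[THEN iffD2]) (simp add: fs.vector_space_axioms vector_space_complex_mult)
qed

lemma lext_add: "lext g (p + q) = lext g p + lext g q"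
  and lext_scale: "lext g (fscale c p) = c * lext g p"
  using linear_lext[of g] by (simp_all add: Vector_Spaces.linear_iff)

lemma lext_basis_vec [simp]: "lext g (basis_vec k) = g k"
  by (simp add: lext_def)

text \<open>A basis of \<open>K\<close> together with \<open>a\<close> is independent, so values on
  it can be prescribed and extended. No dimension is assumed, as supermodules may be
  infinite-dimensional.\<close>

lemma separating_functional:
  assumes "vector_space sc" and "module.subspace sc K" and "a \<notin> K"
  obtains \<psi> :: "'a::ab_group_add \<Rightarrow> complex"
  where "Vector_Spaces.linear sc (*) \<psi>" "\<And>x. x \<in> K \<Longrightarrow> \<psi> x = 0" "\<psi> a = 1"
proof -
  interpret vector_space_pair sc "(*) :: complex \<Rightarrow> _"
    using assms(1) vector_space_complex_mult by (simp add: vector_space_pair_def)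
  obtain K0 where K0: "K0 \<subseteq> K" "\<not> vs1.dependent K0" "K \<subseteq> vs1.span K0"
    using vs1.maximal_independent_subset by blast
  have "a \<notin> vs1.span K0"
    using K0(1) assms(2,3) vs1.span_minimal by blast
  then have "\<not> vs1.dependent (insert a K0)"
    using K0(2) by (simp add: vs1.independent_insertI)
  then obtain \<psi> where \<psi>: "Vector_Spaces.linear sc (*) \<psi>"
    "\<forall>x\<in>insert a K0. \<psi> x = (if x = a then 1 else 0)"
    using linear_independent_extend[of "insert a K0" "\<lambda>x. if x = a then 1 else 0"] by blast
  have "\<psi> x = 0" if "x \<in> K0" for x
    using \<psi>(2) that \<open>a \<notin> vs1.span K0\<close> vs1.span_base by auto
  then have "\<psi> x = 0" if "x \<in> K" for x
    using K0(3) that linear_eq_0_on_span[OF \<psi>(1)] by blast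
  with \<psi> show thesis by (intro that[of \<psi>]) auto
qed

text \<open>Separation in contrapositive form. It turns an identity in a quotient into identities of
  complex numbers, so that only scalar-valued multilinear maps have to be compared.\<close>

lemma subspace_mem_by_functionals:
  fixes a :: "'a::ab_group_add"
  assumes "vector_space sc" and "module.subspace sc K"
    and "\<And>\<psi>. Vector_Spaces.linear sc (*) \<psi> \<Longrightarrow> (\<And>x. x \<in> K \<Longrightarrow> \<psi> x = 0) \<Longrightarrow> \<psi> a = (0::complex)"
  shows "a \<in> K"
  using separating_functional[OF assms(1,2)] assms(3) by (metis zero_neq_one)

section \<open>Sums of subspaces and joint eigenvectors\<close>

lemma (in module) span_UN_subspaces:
  assumes "x \<in> span (\<Union>i\<in>I. E i)" and "\<And>i. i \<in> I \<Longrightarrow> subspace (E i)"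
  obtains C y where "finite C" "C \<subseteq> I" "\<And>i. i \<in> C \<Longrightarrow> y i \<in> E i" "x = (\<Sum>i\<in>C. y i)"
proof -
  from assms(1) have "\<exists>C y. finite C \<and> C \<subseteq> I \<and> (\<forall>i\<in>C. y i \<in> E i) \<and> x = (\<Sum>i\<in>C. y i)"
  proof (induction rule: span_induct_alt)
    case base
    show ?case by (rule exI[of _ "{}"]) simp
  next
    case (step c x z)
    then obtain C y i where *: "finite C" "C \<subseteq> I" "\<forall>i\<in>C. y i \<in> E i" "z = (\<Sum>i\<in>C. y i)"
      and i: "i \<in> I" "x \<in> E i" by auto
    \<comment> \<open>The new vector joins the component of index \<open>i\<close>, which may or may
      not occur in \<open>C\<close> already.\<close>
    define y' where "y' = (\<lambda>j. (if j = i then c *s x else 0) + (if j \<in> C then y j else 0))"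
    have "(\<Sum>j\<in>insert i C. y' j) = c *s x + (\<Sum>j\<in>insert i C. if j \<in> C then y j else 0)"
      unfolding y'_def using *(1) by (subst sum.distrib) simp
    also have "(\<Sum>j\<in>insert i C. if j \<in> C then y j else 0) = z"
      unfolding *(4) using *(1) by (intro sum.mono_neutral_cong_right) auto
    finally have "c *s x + z = (\<Sum>j\<in>insert i C. y' j)" by simp
    moreover have "\<forall>j\<in>insert i C. y' j \<in> E j"
      using i * assms(2) by (auto simp: y'_def intro!: subspace_add subspace_scale subspace_0)
    ultimately show ?case using * i by (intro exI[of _ "insert i C"] exI[of _ y']) auto
  qed
  with that show thesis by metis
qed

text \<open>Applying \<open>T H - ew b H\<close> to the relation removes the term of
  \<open>b\<close> and rescales the others, so the induction hypothesis applies. Linearity is asked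
  on \<open>V\<close> only, because the bracket is controlled only on the carrier.\<close>

lemma joint_eigenvectors_independent:
  assumes "vector_space sc" and "module.subspace sc V" and "finite C"
    and add: "\<And>H x y. H \<in> A \<Longrightarrow> x \<in> V \<Longrightarrow> y \<in> V \<Longrightarrow> T H (x + y) = T H x + T H y"
    and scale: "\<And>H c x. H \<in> A \<Longrightarrow> x \<in> V \<Longrightarrow> T H (sc c x) = sc c (T H x)"
    and mem: "\<And>w. w \<in> C \<Longrightarrow> y w \<in> V"
    and eig: "\<And>w H. w \<in> C \<Longrightarrow> H \<in> A \<Longrightarrow> T H (y w) = sc (ew w H) (y w)"
    and dist: "\<And>w w'. w \<in> C \<Longrightarrow> w' \<in> C \<Longrightarrow> w \<noteq> w' \<Longrightarrow> \<exists>H\<in>A. ew w H \<noteq> ew w' H"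
    and sum0: "(\<Sum>w\<in>C. y w) = 0"
  shows "\<forall>w\<in>C. y w = (0::'v::ab_group_add)"
proof -
  interpret vector_space sc by (rule assms(1))
  note V = \<open>subspace V\<close>
  from \<open>finite C\<close> mem eig dist sum0 show ?thesis
  proof (induction C arbitrary: y rule: finite_induct)
    case empty
    then show ?case by simp
  next
    case (insert b C)
    have yb: "y b = - (\<Sum>w\<in>C. y w)"
      using insert.hyps insert.prems(4) by (simp add: add_eq_0_iff)
    have "y a = 0" if a: "a \<in> C" for a
    proof -
      \<comment> \<open>\<open>H\<close> is chosen for this \<open>a\<close>. It may give other
        terms the factor zero; only the factor of \<open>y a\<close> has to be nonzero.\<close>
      obtain H where H: "H \<in> A" "ew a H \<noteq> ew b H"
        using insert.prems(3)[of a b] insert.hyps a by auto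
      have T0: "T H 0 = 0"
        using scale[OF H(1) subspace_0[OF V], of 0] by simp
      have Tsum: "T H (\<Sum>w\<in>D. y w) = (\<Sum>w\<in>D. sc (ew w H) (y w))" if "D \<subseteq> insert b C" "finite D" for D
        using that(2,1)
      proof (induction D rule: finite_induct)
        case (insert d D)
        have "y d \<in> V" "(\<Sum>w\<in>D. y w) \<in> V"
          using insert.prems \<open>\<And>w. w \<in> insert b C \<Longrightarrow> y w \<in> V\<close>
          by (auto intro!: subspace_sum[OF V])
        then show ?case
          using insert add[OF H(1)] \<open>\<And>w H. w \<in> insert b C \<Longrightarrow> H \<in> A \<Longrightarrow> T H (y w) = sc (ew w H) (y w)\<close> H(1)
          by auto
      qed (simp add: T0)
      have "(\<Sum>w\<in>insert b C. sc (ew w H) (y w)) = 0"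
        using Tsum[of "insert b C"] insert.hyps insert.prems(4) T0 by simp
      moreover have "(\<Sum>w\<in>insert b C. sc (ew b H) (y w)) = 0"
        using insert.prems(4) by (simp add: scale_sum_right[symmetric])
      ultimately have "(\<Sum>w\<in>insert b C. sc (ew w H - ew b H) (y w)) = 0"
        by (simp add: scale_left_diff_distrib sum_subtractf)
      then have s0: "(\<Sum>w\<in>C. sc (ew w H - ew b H) (y w)) = 0"
        using insert.hyps by simp
      have "\<forall>w\<in>C. sc (ew w H - ew b H) (y w) = 0"
      proof (rule insert.IH[OF _ _ _ s0])
        show "sc (ew w H - ew b H) (y w) \<in> V" if "w \<in> C" for w
          using that insert.prems(1) by (simp add: subspace_scale V)
        show "T H' (sc (ew w H - ew b H) (y w)) = sc (ew w H') (sc (ew w H - ew b H) (y w))"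
          if "w \<in> C" "H' \<in> A" for w H'
          using that insert.prems(1,2) scale by (simp add: mult.commute)
        show "\<exists>H\<in>A. ew w H \<noteq> ew w' H" if "w \<in> C" "w' \<in> C" "w \<noteq> w'" for w w'
          using that insert.prems(3) by auto
      qed
      with a H(2) show ?thesis by (auto simp: scale_eq_0_iff)
    qed
    then show ?case using yb by simp
  qed
qed

section \<open>Clifford operators on a Fock space\<close>

text \<open>A function on words over the index set stands for the formal combination of words with these
  coefficients. \<open>create i\<close> multiplies by the letter \<open>i\<close> on the left and \<open>contr i\<close> is the superderivation
  with \<open>contr i j = e i j\<close>. As in Chevalley's construction of Clifford algebras, \<open>create i + contr i\<close>
  satisfies Clifford relations modulo the ideal of the exterior superalgebra.\<close>

locale wick =
  fixes n :: nat and p :: "nat \<Rightarrow> nat" and e :: "nat \<Rightarrow> nat \<Rightarrow> complex"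
  assumes e_parity: "e i j \<noteq> 0 \<Longrightarrow> p i = p j"
    and e_range: "e i j \<noteq> 0 \<Longrightarrow> j \<in> {1..n}"
begin

text \<open>Minus the Koszul sign: the sign of interchanging two letters in the exterior
  superalgebra.\<close>

definition sg :: "nat \<Rightarrow> nat \<Rightarrow> complex" where
  "sg i j = - ((-1) ^ (p i * p j))"

lemma sg_sq [simp]: "sg i j * sg i j = 1" "sg i j * (sg i j * z) = z"
proof -
  show "sg i j * sg i j = 1"
    unfolding sg_def by (simp add: power_mult_distrib[symmetric])
  then show "sg i j * (sg i j * z) = z"
    by (metis mult.assoc mult_1)
qed

lemma sg_sym: "sg i j = sg j i"
  by (simp add: sg_def mult.commute)

definition create :: "nat \<Rightarrow> (nat list \<Rightarrow> complex) \<Rightarrow> nat list \<Rightarrow> complex" where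
  "create i c w = (case w of [] \<Rightarrow> 0 | j # u \<Rightarrow> if i = j then c u else 0)"

text \<open>The superderivation read off at one output word \<open>w\<close>. The words contributing
  to it arise by inserting a letter \<open>k\<close> somewhere in \<open>w\<close>, weighted by
  \<open>e i k\<close> and by the signs of moving \<open>i\<close> past the letters in front of
  it.\<close>

primrec contr_at :: "nat \<Rightarrow> nat list \<Rightarrow> (nat list \<Rightarrow> complex) \<Rightarrow> complex" where
  "contr_at i [] c = (\<Sum>k=1..n. e i k * c [k])"
| "contr_at i (j # w) c =
     (\<Sum>k=1..n. e i k * c (k # j # w)) + sg i j * contr_at i w (\<lambda>u. c (j # u))"

definition contr :: "nat \<Rightarrow> (nat list \<Rightarrow> complex) \<Rightarrow> nat list \<Rightarrow> complex" where
  "contr i c w = contr_at i w c"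

definition sm :: "complex \<Rightarrow> (nat list \<Rightarrow> complex) \<Rightarrow> nat list \<Rightarrow> complex" where
  "sm a c = (\<lambda>w. a * c w)"

definition vac :: "nat list \<Rightarrow> complex" where
  "vac w = (if w = [] then 1 else 0)"

lemma sm_apply [simp]: "sm a c w = a * c w"
  by (simp add: sm_def)

lemma create_add [simp]: "create i (c + d) = create i c + create i d"
  by (auto simp: create_def fun_eq_iff split: list.split)

lemma create_sm [simp]: "create i (sm a c) = sm a (create i c)"
  by (auto simp: create_def fun_eq_iff split: list.split)

lemma contr_at_add: "contr_at i w (\<lambda>u. c u + d u) = contr_at i w c + contr_at i w d"
  by (induction w arbitrary: c d) (simp_all add: algebra_simps sum.distrib)

lemma contr_at_sm: "contr_at i w (\<lambda>u. a * c u) = a * contr_at i w c"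
  by (induction w arbitrary: c) (simp_all add: algebra_simps sum_distrib_left)

lemma contr_add [simp]: "contr i (c + d) = contr i c + contr i d"
  using contr_at_add by (simp add: contr_def fun_eq_iff plus_fun_def)

lemma contr_sm [simp]: "contr i (sm a c) = sm a (contr i c)"
  using contr_at_sm by (simp add: contr_def fun_eq_iff sm_def)

lemma contr_at_zero [simp]: "contr_at i w (\<lambda>u. 0) = 0"
  using contr_at_sm[of i w 0 "\<lambda>u. 0"] by simp

lemma contr_vac: "contr i vac = (\<lambda>w. 0)"
proof
  fix w show "contr i vac w = 0"
    unfolding contr_def vac_def by (cases w) simp_all
qed

text \<open>The rule of a superderivation. With \<open>contr_vac\<close> and linearity it determines
  \<open>contr\<close> on finite combinations of words, so the commutation rules below follow by
  induction.\<close>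

lemma contr_create: "contr i (create j c) = sm (e i j) c + sm (sg i j) (create j (contr i c))"
proof
  fix w
  \<comment> \<open>The sum picks out \<open>k = j\<close>. A letter outside the range is never met,
    in accordance with \<open>e i j = 0\<close> there.\<close>
  have s: "(\<Sum>k=1..n. e i k * (if j = k then z else 0)) = e i j * z" for z
  proof (cases "j \<in> {1..n}")
    case True
    then have "(\<Sum>k=1..n. e i k * (if j = k then z else 0)) = (\<Sum>k\<in>{j}. e i k * z)"
      by (intro sum.mono_neutral_cong_right) auto
    then show ?thesis by simp
  next
    case False
    then have "e i j = 0" using e_range by blast
    moreover have "(\<Sum>k=1..n. e i k * (if j = k then z else 0)) = 0"
      using False by (intro sum.neutral) auto
    ultimately show ?thesis by simp
  qed
  show "contr i (create j c) w = (sm (e i j) c + sm (sg i j) (create j (contr i c))) w"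
  proof (cases w)
    case Nil
    then show ?thesis using s by (simp add: contr_def create_def)
  next
    case (Cons l u)
    have "contr_at i u (\<lambda>u. create j c (l # u)) = (if j = l then contr_at i u c else 0)"
      by (simp add: create_def)
    with Cons show ?thesis using s by (simp add: contr_def create_def)
  qed
qed

text \<open>The finite combinations of words. Arbitrary functions on words could not be treated by
  induction over creation, which is how anticommutation of contractions is proved.\<close>

inductive fock :: "(nat list \<Rightarrow> complex) \<Rightarrow> bool" where
  vac: "fock vac"
| add: "fock c \<Longrightarrow> fock d \<Longrightarrow> fock (c + d)"
| sm: "fock c \<Longrightarrow> fock (sm a c)"
| create: "fock c \<Longrightarrow> fock (create i c)"

lemma zero_fock: "fock (\<lambda>w. 0)"
  using fock.sm[OF fock.vac, of 0] by (simp add: sm_def)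

lemma contr_fock: "fock c \<Longrightarrow> fock (contr i c)"
  by (induction rule: fock.induct)
    (simp_all only: contr_vac zero_fock contr_create contr_add contr_sm fock.intros)

lemma sm_add: "sm a (c + d) = sm a c + sm a d"
  by (simp add: fun_eq_iff algebra_simps)

lemma sm_sm [simp]: "sm a (sm b c) = sm (a * b) c"
  by (simp add: fun_eq_iff algebra_simps)

lemma sg_cong: "p i = p j \<Longrightarrow> sg k i = sg k j" "p i = p j \<Longrightarrow> sg i k = sg j k"
  by (simp_all add: sg_def)

lemma e_sg: "e j k * (sg i j * sg i k) = e j k" "e j k * (sg j i * sg i k) = e j k"
  "e j k * (sg i j * sg k i) = e j k" "e j k * (sg j i * sg k i) = e j k"
  using e_parity[of j k] sg_cong[of j k i] by (cases "e j k = 0"; simp add: sg_sym)+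

text \<open>Moving two contractions past a letter gives terms with one contraction left, and these
  cancel because \<open>e\<close> only pairs letters of equal parity; what remains is the claim for
  the shorter words.\<close>

lemma contr_anticommute:
  "fock c \<Longrightarrow> contr i (contr j c) = sm (sg i j) (contr j (contr i c))"
proof (induction rule: fock.induct)
  case vac
  have "contr i (\<lambda>w. 0) = (\<lambda>w. 0)" for i by (simp add: contr_def fun_eq_iff)
  then show ?case by (simp add: contr_vac sm_def)
next
  case (create c k)
  define x y z where "x = contr i c" and "y = contr j c" and "z = create k (contr j (contr i c))"
  \<comment> \<open>If \<open>e i k\<close> is nonzero, \<open>i\<close> and \<open>k\<close> have
    the same parity, so their signs against \<open>j\<close> agree.\<close>
  have 1: "sg j k * e i k = sg i j * e i k"
    using e_parity[of i k] sg_cong(1)[of k i j] sg_sym[of i j] by (cases "e i k = 0") simp_all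
  have 2: "sg i j * sg i k * e j k = e j k"
    using e_sg(1)[of j k i] by (simp add: mult.commute)
  have "contr i (contr j (create k c))
      = sm (e j k) x + sm (sg j k * e i k) y + sm (sg j k * sg i k * sg i j) z"
    unfolding contr_create contr_add contr_sm create.IH create_sm x_def y_def z_def
    by (simp add: fun_eq_iff algebra_simps)
  also have "\<dots> = sm (sg i j * sg i k * e j k) x + sm (sg i j * e i k) y
      + sm (sg j k * sg i k * sg i j) z"
    by (simp only: 1 2)
  also have "\<dots> = sm (sg i j) (contr j (contr i (create k c)))"
    unfolding contr_create contr_add contr_sm x_def y_def z_def
    by (simp add: fun_eq_iff algebra_simps)
  finally show ?case .
qed (simp_all only: contr_add contr_sm sm_add sm_sm mult.commute)

text \<open>The two-sided ideal of the exterior superalgebra in the algebra of words: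
  \<open>c\<close> is what stands to the right of a relation, \<open>create\<close> supplies what
  stands to its left. All its elements live on words of length at least two, so none has an
  empty-word coefficient.\<close>

inductive ext_ideal :: "(nat list \<Rightarrow> complex) \<Rightarrow> bool" where
  rel: "fock c \<Longrightarrow> ext_ideal (create i (create j c) + sm (- sg i j) (create j (create i c)))"
| add: "ext_ideal c \<Longrightarrow> ext_ideal d \<Longrightarrow> ext_ideal (c + d)"
| sm: "ext_ideal c \<Longrightarrow> ext_ideal (sm a c)"
| create: "ext_ideal c \<Longrightarrow> ext_ideal (create i c)"

lemma ext_ideal_at_Nil: "ext_ideal c \<Longrightarrow> c [] = 0"
  by (induction rule: ext_ideal.induct) (simp_all add: create_def)

text \<open>Contracting a relation yields two terms with a single letter, whose coefficients vanish
  by the parity condition on \<open>e\<close>, and a multiple of the same relation applied to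
  \<open>contr k c\<close>.\<close>

lemma contr_ext_ideal: "ext_ideal c \<Longrightarrow> ext_ideal (contr k c)"
proof (induction rule: ext_ideal.induct)
  case (rel c i j)
  have 1: "e k i + - (sg i j * sg k j * e k i) = 0"
    using e_sg(4)[of k i j] by (simp add: mult.commute sg_sym)
  have 2: "sg k i * e k j + - (sg i j * e k j) = 0"
    using e_parity[of k j] sg_cong(1)[of k j i] sg_sym[of k i] by (cases "e k j = 0") simp_all
  have "contr k (create i (create j c) + sm (- sg i j) (create j (create i c)))
      = sm (e k i + - (sg i j * sg k j * e k i)) (create j c)
        + sm (sg k i * e k j + - (sg i j * e k j)) (create i c)
        + sm (sg k i * sg k j) (create i (create j (contr k c))
             + sm (- sg i j) (create j (create i (contr k c))))"
    by (simp add: contr_create fun_eq_iff algebra_simps)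
  also have "\<dots> = sm (sg k i * sg k j) (create i (create j (contr k c))
             + sm (- sg i j) (create j (create i (contr k c))))"
    unfolding 1 2 by (simp add: fun_eq_iff)
  finally show ?case
    using rel by (simp only: ext_ideal.intros contr_fock)
qed (simp_all only: contr_add contr_sm contr_create ext_ideal.intros)

definition clif :: "nat \<Rightarrow> (nat list \<Rightarrow> complex) \<Rightarrow> nat list \<Rightarrow> complex" where
  "clif i c = create i c + contr i c"

lemma clif_fock: "fock c \<Longrightarrow> fock (clif i c)"
  by (simp add: clif_def contr_fock fock.intros)

lemma clif_ext_ideal: "ext_ideal c \<Longrightarrow> ext_ideal (clif i c)"
  by (simp add: clif_def contr_ext_ideal ext_ideal.intros)

text \<open>The mixed terms leave the scalar \<open>e i j - sg i j * e j i\<close>, the double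
  contractions cancel by anticommutation, and the double creations form a generator of the
  ideal.\<close>

lemma clif_relation:
  assumes "fock c"
  shows "ext_ideal (clif i (clif j c) + sm (- sg i j) (clif j (clif i c))
           + sm (- (e i j - sg i j * e j i)) c)"
proof -
  have "clif i (clif j c) + sm (- sg i j) (clif j (clif i c)) + sm (- (e i j - sg i j * e j i)) c
      = create i (create j c) + sm (- sg i j) (create j (create i c))"
    using contr_anticommute[OF assms, of i j]
    by (simp add: clif_def contr_create fun_eq_iff algebra_simps sg_sym[of j i])
  then show ?thesis using ext_ideal.rel[OF assms] by simp
qed

lemma clif_add: "clif i (c + d) = clif i c + clif i d"
  by (simp add: clif_def fun_eq_iff)

lemma clif_sm: "clif i (sm a c) = sm a (clif i c)"
  by (simp add: clif_def fun_eq_iff algebra_simps)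

end

section \<open>Lie superalgebras and root spaces\<close>

locale lie_super =
  fixes L :: "'g::ab_group_add lsa"
  assumes lsa: "lie_superalgebra L"
begin

sublocale vs: vector_space "scal L"
  using lsa by (simp add: lie_superalgebra_def)

lemmas lie_conjs = lsa[unfolded lie_superalgebra_def, THEN conjunct2]
lemmas subspace_ev = lie_conjs[THEN conjunct1, rule_format]
lemmas lie_conjs1 = lie_conjs[THEN conjunct2]
lemmas subspace_od = lie_conjs1[THEN conjunct1, rule_format]
lemmas lie_conjs2 = lie_conjs1[THEN conjunct2]
lemmas ev_od = lie_conjs2[THEN conjunct1, rule_format]
lemmas lie_conjs3 = lie_conjs2[THEN conjunct2]
lemmas br_add_left = lie_conjs3[THEN conjunct1, rule_format]
lemmas lie_conjs4 = lie_conjs3[THEN conjunct2]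
lemmas br_add_right = lie_conjs4[THEN conjunct1, rule_format]
lemmas lie_conjs5 = lie_conjs4[THEN conjunct2]
lemmas br_scale_left = lie_conjs5[THEN conjunct1, rule_format]
lemmas lie_conjs6 = lie_conjs5[THEN conjunct2]
lemmas br_scale_right = lie_conjs6[THEN conjunct1, rule_format]
lemmas lie_conjs7 = lie_conjs6[THEN conjunct2]
lemmas br_even_even = lie_conjs7[THEN conjunct1, rule_format]
lemmas lie_conjs8 = lie_conjs7[THEN conjunct2]
lemmas br_even_odd = lie_conjs8[THEN conjunct1, rule_format]
lemmas lie_conjs9 = lie_conjs8[THEN conjunct2]
lemmas br_odd_even = lie_conjs9[THEN conjunct1, rule_format]
lemmas lie_conjs10 = lie_conjs9[THEN conjunct2]
lemmas br_odd_odd = lie_conjs10[THEN conjunct1, rule_format]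
lemmas lie_conjs11 = lie_conjs10[THEN conjunct2]
lemmas br_skew = lie_conjs11[THEN conjunct1, rule_format]
lemmas lie_conjs12 = lie_conjs11[THEN conjunct2]
lemmas jacobi = lie_conjs12[rule_format]

lemma subspace_car: "vs.subspace (car L)"
  using vs.subspace_sums[OF subspace_ev subspace_od] by (simp add: car_def)

lemma ev_car: "x \<in> ev L \<Longrightarrow> x \<in> car L" and od_car: "x \<in> od L \<Longrightarrow> x \<in> car L"
  using vs.subspace_0[OF subspace_ev] vs.subspace_0[OF subspace_od] unfolding car_def
  by (force, force)

lemma homog_car: "x \<in> homog L \<Longrightarrow> x \<in> car L"
  by (auto simp: homog_def ev_car od_car)

lemma ev_homog: "x \<in> ev L \<Longrightarrow> x \<in> homog L" and od_homog: "x \<in> od L \<Longrightarrow> x \<in> homog L"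
  by (auto simp: homog_def)

lemma car_cases:
  assumes "x \<in> car L"
  obtains x0 x1 where "x0 \<in> ev L" "x1 \<in> od L" "x = x0 + x1"
  using assms by (auto simp: car_def)

lemma par_ev [simp]: "x \<in> ev L \<Longrightarrow> par L x = 0"
  by (simp add: par_def)

lemma par_od: "x \<in> od L \<Longrightarrow> x \<noteq> 0 \<Longrightarrow> par L x = 1"
  using ev_od by (auto simp: par_def)

lemma br_car: "x \<in> car L \<Longrightarrow> y \<in> car L \<Longrightarrow> br L x y \<in> car L"
  using br_even_even br_even_odd br_odd_even br_odd_odd
  by (elim car_cases)
    (simp add: br_add_left br_add_right ev_car od_car vs.subspace_add[OF subspace_car])

lemma br_even_skew: "H \<in> ev L \<Longrightarrow> x \<in> car L \<Longrightarrow> br L x H = - br L H x"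
proof (elim car_cases)
  fix x0 x1 assume *: "H \<in> ev L" "x0 \<in> ev L" "x1 \<in> od L" "x = x0 + x1"
  then show "br L x H = - br L H x"
    using br_skew[of x0 H] br_skew[of x1 H]
    by (simp add: br_add_left br_add_right ev_car od_car ev_homog od_homog)
qed

lemma even_jacobi:
  assumes "H \<in> ev L" "K \<in> ev L" "x \<in> car L"
  shows "br L H (br L K x) = br L (br L H K) x + br L K (br L H x)"
proof -
  from assms(3) obtain x0 x1 where *: "x0 \<in> ev L" "x1 \<in> od L" "x = x0 + x1" by (rule car_cases)
  then show ?thesis
    using assms jacobi[of H K x0] jacobi[of H K x1]
    by (simp add: br_add_right ev_car od_car ev_homog od_homog br_even_even br_even_odd)
qed

lemma ev_od_unique:
  assumes "x0 \<in> ev L" "y0 \<in> ev L" "x1 \<in> od L" "y1 \<in> od L" "x0 + x1 = y0 + y1"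
  shows "x0 = y0" "x1 = y1"
proof -
  have "x0 - y0 = y1 - x1" using assms(5) by (simp add: algebra_simps)
  moreover have "x0 - y0 \<in> ev L" "y1 - x1 \<in> od L"
    using assms by (simp_all add: vs.subspace_diff subspace_ev subspace_od)
  ultimately have "x0 - y0 \<in> ev L \<inter> od L" by auto
  then have "x0 - y0 = 0" using ev_od by auto
  then show "x0 = y0" "x1 = y1" using assms(5) by auto
qed

end

text \<open>Restricted to \<open>S\<close>, since form and bracket are constrained only on the
  carrier, and Clifford generators depend linearly only on vectors of the chosen subspace.\<close>

definition bilin_on :: "(complex \<Rightarrow> 'v \<Rightarrow> 'v) \<Rightarrow> 'v set \<Rightarrow> ('v::ab_group_add \<Rightarrow> 'v \<Rightarrow> complex) \<Rightarrow> bool" where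
  "bilin_on sc S b \<longleftrightarrow>
     (\<forall>x\<in>S. \<forall>y\<in>S. \<forall>z\<in>S. b (x + y) z = b x z + b y z \<and> b x (y + z) = b x y + b x z) \<and>
     (\<forall>c. \<forall>x\<in>S. \<forall>y\<in>S. b (sc c x) y = c * b x y \<and> b x (sc c y) = c * b x y)"

lemma bilin_on_sum:
  assumes b: "bilin_on sc S b" and S: "module.subspace sc S" and vs: "vector_space sc"
    and "finite A" and x: "\<And>i. i \<in> A \<Longrightarrow> x i \<in> S" and y: "y \<in> S"
  shows "b (\<Sum>i\<in>A. sc (c i) (x i)) y = (\<Sum>i\<in>A. c i * b (x i) y)"
    and "b y (\<Sum>i\<in>A. sc (c i) (x i)) = (\<Sum>i\<in>A. c i * b y (x i))"
proof -
  interpret vector_space sc by (rule vs)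
  have [simp]: "b 0 y = 0" "b y 0 = 0"
    using b y subspace_0[OF S] unfolding bilin_on_def by (metis mult_zero_left scale_zero_left)+
  from \<open>finite A\<close> x have "b (\<Sum>i\<in>A. sc (c i) (x i)) y = (\<Sum>i\<in>A. c i * b (x i) y) \<and>
      b y (\<Sum>i\<in>A. sc (c i) (x i)) = (\<Sum>i\<in>A. c i * b y (x i))"
  proof (induction A rule: finite_induct)
    case (insert i A)
    have "sc (c i) (x i) \<in> S" "(\<Sum>i\<in>A. sc (c i) (x i)) \<in> S"
      using insert.prems by (auto intro!: subspace_sum[OF S] subspace_scale[OF S])
    then show ?case using insert b y by (simp add: bilin_on_def)
  qed simp
  then show "b (\<Sum>i\<in>A. sc (c i) (x i)) y = (\<Sum>i\<in>A. c i * b (x i) y)"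
    "b y (\<Sum>i\<in>A. sc (c i) (x i)) = (\<Sum>i\<in>A. c i * b y (x i))" by auto
qed

section \<open>Weight decomposition under the Cartan subalgebra\<close>

locale root_setting = lie_super L for L :: "'g::ab_group_add lsa" +
  fixes B :: "'g \<Rightarrow> 'g \<Rightarrow> complex" and h :: "'g set" and f :: "('g \<Rightarrow> complex) \<Rightarrow> int"
  assumes fin: "finite_dimensional L"
    and form: "invariant_form L B"
    and cartan: "cartan_subalgebra L h"
    and f_add: "\<And>a b. a \<in> group_closure (roots L h) \<Longrightarrow> b \<in> group_closure (roots L h) \<Longrightarrow>
                  f (a + b) = f a + f b"
begin

lemmas form_conjs = form[unfolded invariant_form_def]

lemma bilin_form: "bilin_on (scal L) (car L) B"
  unfolding bilin_on_def
  using form_conjs[THEN conjunct1] form_conjs[THEN conjunct2, THEN conjunct1]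
    form_conjs[THEN conjunct2, THEN conjunct2, THEN conjunct1] by simp

lemmas form_sym = form_conjs[THEN conjunct2, THEN conjunct2, THEN conjunct2, THEN conjunct1, rule_format]
  and form_inv = form_conjs[THEN conjunct2, THEN conjunct2, THEN conjunct2, THEN conjunct2,
    THEN conjunct1, rule_format]
  and form_ev_od = form_conjs[THEN conjunct2, THEN conjunct2, THEN conjunct2, THEN conjunct2,
    THEN conjunct2, THEN conjunct1, rule_format]
  and form_nondeg = form_conjs[THEN conjunct2, THEN conjunct2, THEN conjunct2, THEN conjunct2,
    THEN conjunct2, THEN conjunct2, rule_format]

lemma form_od_ev: "x \<in> od L \<Longrightarrow> y \<in> ev L \<Longrightarrow> B x y = 0"
  using form_sym[of x y] form_ev_od[of y x] by (simp add: ev_homog od_homog)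

lemma form_add_left: "x \<in> car L \<Longrightarrow> y \<in> car L \<Longrightarrow> z \<in> car L \<Longrightarrow> B (x + y) z = B x z + B y z"
  and form_add_right: "x \<in> car L \<Longrightarrow> y \<in> car L \<Longrightarrow> z \<in> car L \<Longrightarrow> B x (y + z) = B x y + B x z"
  and form_scale_left: "x \<in> car L \<Longrightarrow> y \<in> car L \<Longrightarrow> B (scal L c x) y = c * B x y"
  and form_scale_right: "x \<in> car L \<Longrightarrow> y \<in> car L \<Longrightarrow> B x (scal L c y) = c * B x y"
  using bilin_form by (auto simp: bilin_on_def)

lemma form_minus_left: "x \<in> car L \<Longrightarrow> y \<in> car L \<Longrightarrow> B (- x) y = - B x y"
  using form_scale_left[of x y "-1"] by simp

lemma form_zero [simp]: "x \<in> car L \<Longrightarrow> B x 0 = 0" "x \<in> car L \<Longrightarrow> B 0 x = 0"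
  using form_scale_right[of x x 0] form_scale_left[of x x 0] by simp_all

lemma h_subspace: "vs.subspace h" and h_ev: "H \<in> h \<Longrightarrow> H \<in> ev L"
  and h_comm: "H \<in> h \<Longrightarrow> K \<in> h \<Longrightarrow> br L H K = 0"
  and h_diag: "H \<in> h \<Longrightarrow> vs.span {x \<in> car L. \<exists>c. br L H x = scal L c x} = car L"
  using cartan unfolding cartan_subalgebra_def by blast+

lemma h_car: "H \<in> h \<Longrightarrow> H \<in> car L"
  by (simp add: h_ev ev_car)

lemma root_space_car: "x \<in> root_space L h a \<Longrightarrow> x \<in> car L"
  by (simp add: root_space_def)

lemma root_space_components:
  assumes "x0 + x1 \<in> root_space L h a" "x0 \<in> ev L" "x1 \<in> od L"
  shows "x0 \<in> root_space L h a" "x1 \<in> root_space L h a"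
proof -
  have "br L H x0 = scal L (a H) x0 \<and> br L H x1 = scal L (a H) x1" if H: "H \<in> h" for H
  proof -
    have "br L H x0 + br L H x1 = scal L (a H) x0 + scal L (a H) x1"
      using assms H by (simp add: root_space_def br_add_right h_car ev_car od_car vs.scale_right_distrib)
    then show ?thesis
      using ev_od_unique[of "br L H x0" "scal L (a H) x0" "br L H x1" "scal L (a H) x1"] assms H
      by (simp add: br_even_even br_even_odd h_ev vs.subspace_scale subspace_ev subspace_od)
  qed
  then show "x0 \<in> root_space L h a" "x1 \<in> root_space L h a"
    using assms by (auto simp: root_space_def ev_car od_car)
qed

text \<open>A joint eigenvector \<open>x\<close> of \<open>F\<close> is split into eigencomponents
  of one more element \<open>H\<close>. Since \<open>H\<close> commutes with \<open>F\<close>, each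
  component remains a joint eigenvector of \<open>F\<close>.\<close>

lemma commuting_diagonalization:
  assumes "finite F" "F \<subseteq> h"
  shows "vs.span {x \<in> car L. \<forall>H\<in>F. \<exists>c. br L H x = scal L c x} = car L"
  using assms
proof (induction F rule: finite_induct)
  case empty
  show ?case using vs.span_eq_iff[of "car L"] subspace_car by simp
next
  case (insert H F)
  define E where "E = {x \<in> car L. \<forall>H\<in>insert H F. \<exists>c. br L H x = scal L c x}"
  have H: "H \<in> h" and F: "F \<subseteq> h" using insert.prems by auto
  have "{x \<in> car L. \<forall>H\<in>F. \<exists>c. br L H x = scal L c x} \<subseteq> vs.span E"
  proof
    fix x assume "x \<in> {x \<in> car L. \<forall>H\<in>F. \<exists>c. br L H x = scal L c x}"
    then obtain c where x: "x \<in> car L" and c: "\<And>K. K \<in> F \<Longrightarrow> br L K x = scal L (c K) x"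
      by simp metis
    define W where "W d = {x \<in> car L. br L H x = scal L d x}" for d
    have W: "vs.subspace (W d)" for d
      using br_scale_right[of H H 0] H subspace_car
      by (auto simp: W_def vs.subspace_def br_add_right h_car br_scale_right
          vs.scale_right_distrib mult.commute)
    have "(\<Union>d\<in>UNIV. W d) = {x \<in> car L. \<exists>c. br L H x = scal L c x}"
      by (auto simp: W_def)
    then have "x \<in> vs.span (\<Union>d\<in>UNIV. W d)"
      using h_diag[OF H] x by simp
    then obtain C y where C: "finite C" and y: "\<And>d. d \<in> C \<Longrightarrow> y d \<in> W d"
      and xy: "x = (\<Sum>d\<in>C. y d)"
      using W by (rule vs.span_UN_subspaces) auto
    have "y d \<in> E" if d: "d \<in> C" for d
    proof -
      have "br L K (y d) = scal L (c K) (y d)" if K: "K \<in> F" for K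
      proof -
        have Kh: "K \<in> h" using K F by auto
        \<comment> \<open>The operator \<open>K - c K\<close> applied to a component. These vectors
          sum to zero and stay in the eigenspaces of \<open>H\<close>, hence all vanish.\<close>
        define z where "z d = br L K (y d) + scal L (- c K) (y d)" for d
        have br_sum: "br L K (\<Sum>d\<in>D. y d) = (\<Sum>d\<in>D. br L K (y d))" if "D \<subseteq> C" for D
          using finite_subset[OF that C] that
        proof (induction D rule: finite_induct)
          case empty
          then show ?case using br_scale_right[of K K 0] h_car[OF Kh] by simp
        next
          case (insert d D)
          have "y d \<in> car L" "(\<Sum>d\<in>D. y d) \<in> car L"
            using insert.prems y by (auto simp: W_def intro!: vs.subspace_sum[OF subspace_car])
          then show ?case using insert by (simp add: br_add_right h_car[OF Kh])
        qed
        have z0: "(\<Sum>d\<in>C. z d) = 0"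
          using c[OF K] unfolding xy z_def br_sum[OF order_refl]
          by (simp add: sum.distrib sum_subtractf sum_negf vs.scale_sum_right)
        have yW: "y d \<in> car L" "br L H (y d) = scal L d (y d)" if "d \<in> C" for d
          using y[OF that] by (auto simp: W_def)
        have zW: "z d \<in> W d" if "d \<in> C" for d
        proof -
          have "br L H (br L K (y d)) = br L K (br L H (y d))"
            using even_jacobi[of H K "y d"] h_comm[OF H Kh] br_scale_left[of 0 "y d" 0]
              yW[OF that] H Kh h_ev vs.subspace_0[OF subspace_car] by simp
          then have "br L K (y d) \<in> W d"
            using yW[OF that] by (simp add: W_def br_car h_car Kh br_scale_right)
          then show ?thesis
            unfolding z_def using y[OF that] W by (simp add: vs.subspace_add vs.subspace_scale del: vs.scale_minus_left)
        qed
        have "\<forall>d\<in>C. z d = 0"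
        proof (rule joint_eigenvectors_independent[where sc = "scal L" and V = "car L" and A = "{H}"
              and T = "br L" and ew = "\<lambda>d H. d"])
          show "vector_space (scal L)" ..
          show "vs.subspace (car L)" by (rule subspace_car)
          show "finite C" "(\<Sum>d\<in>C. z d) = 0" by (fact C, fact z0)
          show "br L K (x + y) = br L K x + br L K y" if "K \<in> {H}" "x \<in> car L" "y \<in> car L" for K x y
            using that H by (simp add: br_add_right h_car)
          show "br L K (scal L c x) = scal L c (br L K x)" if "K \<in> {H}" "x \<in> car L" for K c x
            using that H by (simp add: br_scale_right h_car)
          show "z d \<in> car L" if "d \<in> C" for d
            using zW[OF that] by (simp add: W_def)
          show "br L K (z d) = scal L d (z d)" if "d \<in> C" "K \<in> {H}" for d K
            using zW[OF that(1)] that(2) by (simp add: W_def)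
          show "\<exists>H\<in>{H}. d \<noteq> d'" if "d \<noteq> d'" for d d' :: complex
            using that by simp
        qed
        then have "br L K (y d) + scal L (- c K) (y d) = 0" using d unfolding z_def by blast
        then show ?thesis by simp
      qed
      moreover have "y d \<in> car L" "br L H (y d) = scal L d (y d)"
        using y[OF d] by (simp_all add: W_def)
      ultimately show ?thesis
        unfolding E_def by blast
    qed
    then show "x \<in> vs.span E"
      unfolding xy by (intro vs.span_sum vs.span_base)
  qed
  then have "vs.span {x \<in> car L. \<forall>H\<in>F. \<exists>c. br L H x = scal L c x} \<subseteq> vs.span E"
    by (rule vs.span_minimal) (rule vs.subspace_span)
  then have "car L \<subseteq> vs.span E"
    using insert.IH F by simp
  moreover have "vs.span E \<subseteq> car L"
    by (rule vs.span_minimal[OF _ subspace_car]) (auto simp: E_def)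
  ultimately show ?case by (simp add: E_def)
qed

text \<open>Joint diagonalization is available for finite families. A finite spanning set is enough,
  because the elements that act on a given vector by a scalar form a subspace.\<close>

lemma h_finitely_spanned: "\<exists>F. finite F \<and> F \<subseteq> h \<and> h \<subseteq> vs.span F"
proof -
  obtain S0 where S0: "finite S0" "vs.span S0 = car L"
    using fin unfolding finite_dimensional_def by blast
  obtain F where F: "F \<subseteq> h" "vs.independent F" "h \<subseteq> vs.span F"
    using vs.maximal_independent_subset by blast
  have "F \<subseteq> vs.span S0" using F(1) S0(2) h_car by blast
  then have "finite F" using vs.independent_span_bound[OF S0(1) F(2)] by simp
  with F show ?thesis by blast
qed

lemma joint_eigenvector_in_root_space:
  assumes x: "x \<in> car L" and "x \<noteq> 0" and ex: "\<And>H. H \<in> h \<Longrightarrow> \<exists>c. br L H x = scal L c x"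
  shows "\<exists>a\<in>insert 0 (roots L h). x \<in> root_space L h a"
proof -
  \<comment> \<open>The value 0 outside \<open>h\<close> is the convention of
    \<open>dual_space\<close>. Linearity on \<open>h\<close> follows since a nonzero vector
    determines its eigenvalues.\<close>
  define a where "a H = (if H \<in> h then SOME c. br L H x = scal L c x else 0)" for H
  have a: "br L H x = scal L (a H) x" if "H \<in> h" for H
    using someI_ex[OF ex[OF that]] that by (simp add: a_def)
  have eq: "c = d" if "scal L c x = scal L d x" for c d
    using that \<open>x \<noteq> 0\<close> by (simp add: vs.scale_cancel_right)
  have "a (H + K) = a H + a K" if "H \<in> h" "K \<in> h" for H K
    using a[OF that(1)] a[OF that(2)] a[of "H + K"] that h_subspace x
    by (intro eq) (simp add: vs.subspace_add br_add_left h_car vs.scale_left_distrib)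
  moreover have "a (scal L c H) = c * a H" if "H \<in> h" for c H
    using a[OF that] a[of "scal L c H"] that h_subspace x
    by (intro eq) (auto simp: vs.subspace_scale br_scale_left h_car)
  ultimately have "a \<in> dual_space L h" by (simp add: dual_space_def a_def)
  moreover have xa: "x \<in> root_space L h a" using a x by (simp add: root_space_def)
  ultimately show ?thesis using \<open>x \<noteq> 0\<close> unfolding roots_def by (cases "a = 0") auto
qed

lemma root_space_decomposition: "vs.span (\<Union>a\<in>insert 0 (roots L h). root_space L h a) = car L"
proof
  show "vs.span (\<Union>a\<in>insert 0 (roots L h). root_space L h a) \<subseteq> car L"
    by (rule vs.span_minimal[OF _ subspace_car]) (auto simp: root_space_car)
  obtain F where F: "finite F" "F \<subseteq> h" "h \<subseteq> vs.span F" using h_finitely_spanned by blast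
  have "{x \<in> car L. \<forall>H\<in>F. \<exists>c. br L H x = scal L c x}
      \<subseteq> vs.span (\<Union>a\<in>insert 0 (roots L h). root_space L h a)"
  proof
    fix x assume "x \<in> {x \<in> car L. \<forall>H\<in>F. \<exists>c. br L H x = scal L c x}"
    then have x: "x \<in> car L" and eF: "\<And>H. H \<in> F \<Longrightarrow> \<exists>c. br L H x = scal L c x" by auto
    let ?E = "{H \<in> car L. \<exists>c. br L H x = scal L c x}"
    have 0: "br L 0 x = 0" using br_scale_left[OF x x, of 0] by simp
    have "vs.subspace ?E"
      unfolding vs.subspace_def
    proof (intro conjI ballI allI)
      show "0 \<in> ?E" using 0 vs.subspace_0[OF subspace_car] by (auto intro: exI[of _ 0])
      show "H + K \<in> ?E" if "H \<in> ?E" "K \<in> ?E" for H K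
        using that x subspace_car
        by (auto simp: vs.subspace_add br_add_left vs.scale_left_distrib[symmetric])
      show "scal L c H \<in> ?E" if "H \<in> ?E" for c H
        using that x subspace_car by (auto simp: vs.subspace_scale br_scale_left)
    qed
    then have "vs.span F \<subseteq> ?E"
      using eF F(2) h_car by (intro vs.span_minimal) auto
    then have "\<exists>c. br L H x = scal L c x" if "H \<in> h" for H using that F(3) by auto
    then show "x \<in> vs.span (\<Union>a\<in>insert 0 (roots L h). root_space L h a)"
      using joint_eigenvector_in_root_space[OF x] by (cases "x = 0") (auto intro: vs.span_base vs.span_zero)
  qed
  then have "vs.span {x \<in> car L. \<forall>H\<in>F. \<exists>c. br L H x = scal L c x}
      \<subseteq> vs.span (\<Union>a\<in>insert 0 (roots L h). root_space L h a)"
    by (rule vs.span_minimal[OF _ vs.subspace_span])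
  then show "car L \<subseteq> vs.span (\<Union>a\<in>insert 0 (roots L h). root_space L h a)"
    using commuting_diagonalization[OF F(1,2)] by simp
qed

text \<open>Root spaces are graded because \<open>h\<close> is even. Homogeneous root vectors are
  preferred, as all signs refer to parities.\<close>

lemma span_homog_root_spaces:
  "vs.span (\<Union>a\<in>A. root_space L h a) = vs.span (\<Union>a\<in>A. root_space L h a \<inter> homog L)"
proof
  show "vs.span (\<Union>a\<in>A. root_space L h a) \<subseteq> vs.span (\<Union>a\<in>A. root_space L h a \<inter> homog L)"
  proof (rule vs.span_minimal[OF _ vs.subspace_span], rule subsetI)
    fix x assume "x \<in> (\<Union>a\<in>A. root_space L h a)"
    then obtain a where a: "a \<in> A" "x \<in> root_space L h a" by auto
    obtain x0 x1 where x: "x0 \<in> ev L" "x1 \<in> od L" "x = x0 + x1"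
      using root_space_car[OF a(2)] by (rule car_cases)
    have "x0 \<in> root_space L h a" "x1 \<in> root_space L h a"
      using root_space_components[of x0 x1 a] a x by auto
    then show "x \<in> vs.span (\<Union>a\<in>A. root_space L h a \<inter> homog L)"
      unfolding x(3) using a(1) x(1,2) ev_homog od_homog
      by (intro vs.span_add vs.span_base) auto
  qed
qed (intro vs.span_mono, auto)

lemma root_dual: "a \<in> insert 0 (roots L h) \<Longrightarrow> a \<in> dual_space L h"
  by (auto simp: roots_def dual_space_def)

lemma root_closure: "a \<in> insert 0 (roots L h) \<Longrightarrow> a \<in> group_closure (roots L h)"
  by (rule group_closure.base)

lemma f_zero [simp]: "f 0 = 0"
  using f_add[of 0 0] by simp

section \<open>The form, the bracket and the degree given by \<open>f\<close>\<close>

lemma form_weights: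
  assumes a: "a \<in> dual_space L h" and b: "b \<in> dual_space L h"
    and x: "x \<in> root_space L h a" and y: "y \<in> root_space L h b" and nz: "B x y \<noteq> 0"
  shows "a + b = 0"
proof -
  have "a H + b H = 0" for H
  proof (cases "H \<in> h")
    case True
    have xc: "x \<in> car L" and yc: "y \<in> car L" and Hc: "H \<in> car L"
      using x y True by (auto simp: root_space_car h_car)
    have "a H * B x y = B (br L H x) y"
      using x True xc yc by (simp add: root_space_def form_scale_left)
    also have "\<dots> = - B (br L x H) y"
      using br_even_skew[OF h_ev[OF True] xc] xc yc Hc
      by (simp add: form_minus_left br_car)
    also have "\<dots> = - (b H * B x y)"
      using form_inv[OF xc Hc yc] y True xc yc by (simp add: root_space_def form_scale_right)
    finally have "(a H + b H) * B x y = 0" by (simp add: distrib_right)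
    then show ?thesis using nz by simp
  next
    case False
    then show ?thesis using a b by (simp add: dual_space_def)
  qed
  then show "a + b = 0" by (simp add: fun_eq_iff)
qed

lemma form_root_spaces:
  assumes a: "a \<in> insert 0 (roots L h)" and b: "b \<in> insert 0 (roots L h)"
    and "x \<in> root_space L h a" "y \<in> root_space L h b" "B x y \<noteq> 0"
  shows "f a + f b = 0"
  using form_weights[OF root_dual[OF a] root_dual[OF b] assms(3-5)]
    f_add[OF root_closure[OF a] root_closure[OF b]] by simp

lemma br_root_spaces:
  assumes "x \<in> root_space L h a" "x \<in> homog L" "y \<in> root_space L h b" "y \<in> homog L"
  shows "br L x y \<in> root_space L h (a + b)"
proof -
  have xc: "x \<in> car L" and yc: "y \<in> car L" using assms by (simp_all add: homog_car)
  have "br L H (br L x y) = scal L ((a + b) H) (br L x y)" if H: "H \<in> h" for H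
    using jacobi[of H x y] assms H xc yc
    by (simp add: ev_homog h_ev root_space_def br_scale_left br_scale_right vs.scale_left_distrib)
  then show ?thesis using br_car[OF xc yc] by (simp add: root_space_def)
qed

text \<open>The degree is an argument and not a function of the vector, because the zero vector lies
  in every root space. Degree 0 is excluded, so these vectors span exactly the subspace carrying the
  Clifford superalgebra.\<close>

definition root_letter :: "'g \<Rightarrow> int \<Rightarrow> bool" where
  "root_letter x d \<longleftrightarrow> x \<in> homog L \<and> d \<noteq> 0 \<and> (\<exists>a\<in>roots L h. x \<in> root_space L h a \<and> f a = d)"

lemma root_letter_homog: "root_letter x d \<Longrightarrow> x \<in> homog L"
  by (simp add: root_letter_def)

lemma root_letter_car: "root_letter x d \<Longrightarrow> x \<in> car L"
  by (simp add: root_letter_def homog_car)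

lemma root_letter_form: "root_letter x d \<Longrightarrow> root_letter y d' \<Longrightarrow> B x y \<noteq> 0 \<Longrightarrow> d + d' = 0"
  unfolding root_letter_def using form_root_spaces by blast

lemma par_u_span: "par_u L h f = vs.span {x. \<exists>d>0. root_letter x d}"
  unfolding par_u_def span_homog_root_spaces
  by (rule arg_cong[where f = vs.span]) (force simp: root_letter_def)

lemma par_ubar_span: "par_ubar L h f = vs.span {x. \<exists>d<0. root_letter x d}"
  unfolding par_ubar_def span_homog_root_spaces
  by (rule arg_cong[where f = vs.span]) (force simp: root_letter_def)

lemma par_s_span: "par_s L h f = vs.span {x. \<exists>d. root_letter x d}"
proof -
  have "{x. \<exists>d. root_letter x d} = {x. \<exists>d>0. root_letter x d} \<union> {x. \<exists>d<0. root_letter x d}"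
    by (auto simp: root_letter_def) (metis linorder_neqE)
  then show ?thesis
    unfolding par_s_def par_u_span par_ubar_span by (simp add: vs.span_Un)
qed

abbreviation "S \<equiv> par_s L h f"
abbreviation "U \<equiv> par_u L h f"

lemma S_subspace: "vs.subspace S"
  by (simp add: par_s_span)

lemma S_car: "x \<in> S \<Longrightarrow> x \<in> car L"
proof -
  have "S \<subseteq> car L"
    unfolding par_s_span by (rule vs.span_minimal[OF _ subspace_car]) (auto simp: root_letter_car)
  then show "x \<in> S \<Longrightarrow> x \<in> car L" by auto
qed

lemma root_letter_S: "root_letter x d \<Longrightarrow> x \<in> S"
  unfolding par_s_span by (intro vs.span_base) auto

lemma root_letter_U: "root_letter x d \<Longrightarrow> d > 0 \<Longrightarrow> x \<in> U"
  unfolding par_u_span by (intro vs.span_base) auto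

text \<open>Weight spaces of degree 0 are orthogonal to \<open>S\<close>, and those of nonzero
  degree lie in \<open>S\<close>; so a vector of \<open>S\<close> orthogonal to \<open>S\<close> is
  orthogonal to everything.\<close>

lemma form_nondeg_S:
  assumes y: "y \<in> S" and 0: "\<And>x. x \<in> S \<Longrightarrow> B y x = 0"
  shows "y = 0"
proof (rule form_nondeg)
  show yc: "y \<in> car L" using y by (rule S_car)
  fix z assume "z \<in> car L"
  then have "z \<in> vs.span (\<Union>a\<in>insert 0 (roots L h). root_space L h a)"
    using root_space_decomposition by simp
  moreover have "vs.subspace {z \<in> car L. B y z = 0}"
    using subspace_car yc by (auto simp: vs.subspace_def form_add_right form_scale_right)
  moreover have "B y z = 0" if b: "b \<in> insert 0 (roots L h)" and z: "z \<in> root_space L h b" for b z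
  proof (cases "f b = 0")
    case False
    then have b: "b \<in> roots L h" using b by auto
    obtain z0 z1 where z01: "z0 \<in> ev L" "z1 \<in> od L" "z = z0 + z1"
      using root_space_car[OF z] by (rule car_cases)
    then have "root_letter z0 (f b)" "root_letter z1 (f b)"
      using root_space_components[of z0 z1 b] z b False ev_homog od_homog
      unfolding root_letter_def by blast+
    then have "z \<in> S"
      unfolding z01(3) using root_letter_S S_subspace by (simp add: vs.subspace_add)
    then show ?thesis by (rule 0)
  next
    case True
    have zc: "z \<in> car L" using z by (rule root_space_car)
    have "vs.subspace {y \<in> car L. B y z = 0}"
      using subspace_car zc by (auto simp: vs.subspace_def form_add_left form_scale_left)
    moreover have "B x z = 0" if "root_letter x d" for x d
      using that form_root_spaces[of _ b x z] b z True unfolding root_letter_def by fastforce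
    ultimately have "S \<subseteq> {y \<in> car L. B y z = 0}"
      unfolding par_s_span by (intro vs.span_minimal) (auto simp: root_letter_car)
    then show ?thesis using y by auto
  qed
  then have "(\<Union>a\<in>insert 0 (roots L h). root_space L h a) \<subseteq> {z \<in> car L. B y z = 0}"
    using root_space_car by blast
  ultimately have "z \<in> {z \<in> car L. B y z = 0}"
    by (meson subsetD vs.span_minimal)
  then show "B y z = 0" by simp
qed

lemma S_graded:
  assumes "x0 + x1 \<in> S" "x0 \<in> ev L" "x1 \<in> od L"
  shows "x0 \<in> S" "x1 \<in> S"
proof -
  let ?G = "{x. \<exists>y0\<in>S \<inter> ev L. \<exists>y1\<in>S \<inter> od L. x = y0 + y1}"
  have "?G = {x + y | x y. x \<in> S \<inter> ev L \<and> y \<in> S \<inter> od L}" by auto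
  then have "vs.subspace ?G"
    using vs.subspace_sums[of "S \<inter> ev L" "S \<inter> od L"]
    by (simp add: vs.subspace_inter S_subspace subspace_ev subspace_od)
  moreover have "x \<in> ?G" if "root_letter x d" for x d
    using that root_letter_S[OF that] root_letter_homog[OF that]
      vs.subspace_0[OF subspace_ev] vs.subspace_0[OF subspace_od] vs.subspace_0[OF S_subspace]
    unfolding homog_def by force
  ultimately have "S \<subseteq> ?G"
    unfolding par_s_span by (intro vs.span_minimal) (auto simp: par_s_span)
  then obtain y0 y1 where "y0 \<in> S \<inter> ev L" "y1 \<in> S \<inter> od L" "x0 + x1 = y0 + y1"
    using assms(1) by auto
  then show "x0 \<in> S" "x1 \<in> S"
    using ev_od_unique[of x0 y0 x1 y1] assms by auto
qed

text \<open>A nonzero pairing forces the three roots to sum to zero. The partial sum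
  \<open>a + b\<close> need not be a root, hence the computation takes place in the group closure,
  where \<open>f\<close> is additive.\<close>

lemma root_letter_triple:
  assumes x: "root_letter x d" and y: "root_letter y d'" and z: "root_letter z d''"
    and nz: "B (br L x y) z \<noteq> 0"
  shows "d + d' + d'' = 0"
proof -
  obtain a b c where a: "a \<in> roots L h" "x \<in> root_space L h a" "f a = d"
    and b: "b \<in> roots L h" "y \<in> root_space L h b" "f b = d'"
    and c: "c \<in> roots L h" "z \<in> root_space L h c" "f c = d''"
    using x y z by (auto simp: root_letter_def)
  have cl: "a \<in> group_closure (roots L h)" "b \<in> group_closure (roots L h)"
    "c \<in> group_closure (roots L h)" using a b c root_closure by auto
  have "br L x y \<in> root_space L h (a + b)"
    using br_root_spaces a(2) b(2) x y root_letter_homog by blast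
  moreover have "a + b \<in> dual_space L h"
    using root_dual[of a] root_dual[of b] a(1) b(1) by (simp add: dual_space_def algebra_simps)
  ultimately have "a + b + c = 0"
    using form_weights[OF _ _ _ c(2) nz] root_dual[of c] c(1) by blast
  then show ?thesis
    using f_add[of "a + b" c] f_add[of a b] cl a(3) b(3) c(3) by (simp add: group_closure_add)
qed

end

section \<open>Dual bases\<close>

context root_setting
begin

lemma form_sum_left:
  "finite A \<Longrightarrow> (\<And>i. i \<in> A \<Longrightarrow> x i \<in> car L) \<Longrightarrow> y \<in> car L \<Longrightarrow>
    B (\<Sum>i\<in>A. scal L (c i) (x i)) y = (\<Sum>i\<in>A. c i * B (x i) y)"
  and form_sum_right:
  "finite A \<Longrightarrow> (\<And>i. i \<in> A \<Longrightarrow> x i \<in> car L) \<Longrightarrow> y \<in> car L \<Longrightarrow>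
    B y (\<Sum>i\<in>A. scal L (c i) (x i)) = (\<Sum>i\<in>A. c i * B y (x i))"
  using bilin_on_sum[OF bilin_form subspace_car vs.vector_space_axioms] by blast+

context
  fixes N X Xd assumes hdb: "homogeneous_dual_bases L B S N X Xd"
begin

lemma hdb_homog: "i \<in> {1..N} \<Longrightarrow> X i \<in> homog L"
  and hdb_dual_S: "i \<in> {1..N} \<Longrightarrow> Xd i \<in> S"
  and hdb_span: "vs.span (X ` {1..N}) = S"
  and hdb_indep: "vs.independent (X ` {1..N})"
  and hdb_delta: "i \<in> {1..N} \<Longrightarrow> j \<in> {1..N} \<Longrightarrow> B (Xd i) (X j) = (if i = j then 1 else 0)"
  using hdb unfolding homogeneous_dual_bases_def by blast+

lemma hdb_S: "i \<in> {1..N} \<Longrightarrow> X i \<in> S"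
  using hdb_span vs.span_base by blast

lemma hdb_car: "i \<in> {1..N} \<Longrightarrow> X i \<in> car L" "i \<in> {1..N} \<Longrightarrow> Xd i \<in> car L"
  by (simp_all add: S_car hdb_S hdb_dual_S)

lemma hdb_expand:
  assumes "x \<in> S" shows "x = (\<Sum>i=1..N. scal L (B (Xd i) x) (X i))"
proof -
  let ?E = "{x \<in> S. x = (\<Sum>i=1..N. scal L (B (Xd i) x) (X i))}"
  have "vs.subspace ?E"
    unfolding vs.subspace_def
  proof (intro conjI ballI allI)
    show "0 \<in> ?E" using S_subspace by (simp add: vs.subspace_0 hdb_car)
    show "x + y \<in> ?E" if "x \<in> ?E" "y \<in> ?E" for x y
    proof -
      have "(\<Sum>i=1..N. scal L (B (Xd i) (x + y)) (X i)) =
        (\<Sum>i=1..N. scal L (B (Xd i) x) (X i)) + (\<Sum>i=1..N. scal L (B (Xd i) y) (X i))"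
        using that by (simp add: form_add_right hdb_car S_car vs.scale_left_distrib sum.distrib)
      then show ?thesis using that S_subspace by (simp add: vs.subspace_add)
    qed
    show "scal L c x \<in> ?E" if "x \<in> ?E" for c x
    proof -
      have "(\<Sum>i=1..N. scal L (B (Xd i) (scal L c x)) (X i)) =
        scal L c (\<Sum>i=1..N. scal L (B (Xd i) x) (X i))"
      proof -
        have "x \<in> car L" using that S_car by simp
        then show ?thesis by (simp add: form_scale_right hdb_car vs.scale_sum_right)
      qed
      then show ?thesis using that S_subspace by (simp add: vs.subspace_scale)
    qed
  qed
  moreover have "X j \<in> ?E" if j: "j \<in> {1..N}" for j
  proof -
    have "(\<Sum>i=1..N. scal L (B (Xd i) (X j)) (X i)) = (\<Sum>i=1..N. if i = j then X i else 0)"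
      using j by (intro sum.cong refl) (simp add: hdb_delta)
    also have "\<dots> = X j" using j by simp
    finally show ?thesis using j hdb_S by simp
  qed
  ultimately have "S \<subseteq> ?E"
    using hdb_span vs.span_minimal[of "X ` {1..N}" ?E] by blast
  then show ?thesis using assms by blast
qed

lemma hdb_eq_zero:
  assumes "y \<in> S" and "\<And>i. i \<in> {1..N} \<Longrightarrow> B y (X i) = 0" shows "y = 0"
proof (rule form_nondeg_S[OF assms(1)])
  fix x assume "x \<in> S"
  have "B y (\<Sum>i=1..N. scal L (B (Xd i) x) (X i)) = 0"
    using assms by (subst form_sum_right) (simp_all add: S_car hdb_S)
  then show "B y x = 0"
    by (simp only: hdb_expand[OF \<open>x \<in> S\<close>, symmetric])
qed

text \<open>The difference of both sides pairs to zero with the whole basis; in particular the dual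
  family spans \<open>S\<close> too.\<close>

lemma hdb_expand_dual:
  assumes "y \<in> S" shows "y = (\<Sum>i=1..N. scal L (B y (X i)) (Xd i))"
proof -
  let ?z = "\<Sum>i=1..N. scal L (B y (X i)) (Xd i)"
  have zS: "?z \<in> S"
    by (intro vs.subspace_sum[OF S_subspace] vs.subspace_scale[OF S_subspace] hdb_dual_S)
  have "y - ?z = 0"
  proof (rule hdb_eq_zero)
    show "y - ?z \<in> S" using assms zS by (rule vs.subspace_diff[OF S_subspace])
    fix j assume j: "j \<in> {1..N}"
    have "B ?z (X j) = (\<Sum>i=1..N. B y (X i) * B (Xd i) (X j))"
      using j by (intro form_sum_left) (auto simp: hdb_car)
    also have "\<dots> = (\<Sum>i=1..N. if i = j then B y (X i) else 0)"
      using j by (intro sum.cong refl) (simp add: hdb_delta)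
    also have "\<dots> = B y (X j)" using j by simp
    finally show "B (y - ?z) (X j) = 0"
      using form_add_left[of y "- ?z" "X j"] form_minus_left[of ?z "X j"] assms zS j
      by (simp add: S_car hdb_car vs.subspace_neg subspace_car)
  qed
  then show ?thesis by simp
qed

lemma hdb_nonzero: "i \<in> {1..N} \<Longrightarrow> X i \<noteq> 0" "i \<in> {1..N} \<Longrightarrow> Xd i \<noteq> 0"
proof -
  assume i: "i \<in> {1..N}"
  show "X i \<noteq> 0" using i hdb_indep vs.dependent_zero by (metis imageI)
  show "Xd i \<noteq> 0" using hdb_delta[OF i i] form_zero(2)[OF hdb_car(1)[OF i]] by auto
qed

text \<open>The component of the wrong parity is orthogonal to each \<open>X j\<close>: to those of
  the other parity because the form is even, to those of its own parity because then
  \<open>j\<close> differs from \<open>i\<close>.\<close>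

lemma hdb_dual_parity:
  assumes i: "i \<in> {1..N}"
  shows "Xd i \<in> homog L" "par L (Xd i) = par L (X i)"
proof -
  obtain a b where ab: "a \<in> ev L" "b \<in> od L" "Xd i = a + b"
    using hdb_car(2)[OF i] by (rule car_cases)
  have abS: "a \<in> S" "b \<in> S" using S_graded[of a b] ab hdb_dual_S[OF i] by auto
  have B: "B (Xd i) (X j) = B a (X j) + B b (X j)" if "j \<in> {1..N}" for j
    unfolding ab(3) using that abS by (simp add: form_add_left S_car hdb_S)
  have "Xd i \<in> homog L \<and> par L (Xd i) = par L (X i)"
  proof (cases "X i \<in> ev L")
    case True
    have "b = 0"
    proof (rule hdb_eq_zero[OF abS(2)])
      fix j assume j: "j \<in> {1..N}"
      show "B b (X j) = 0"
      proof (cases "X j \<in> ev L")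
        case False
        then have "X j \<in> od L" "i \<noteq> j" using hdb_homog[OF j] True by (auto simp: homog_def)
        then show ?thesis using B[OF j] hdb_delta[OF i j] form_ev_od[OF ab(1)] by simp
      qed (simp add: form_od_ev ab)
    qed
    then show ?thesis using True ab ev_homog by simp
  next
    case False
    have "a = 0"
    proof (rule hdb_eq_zero[OF abS(1)])
      fix j assume j: "j \<in> {1..N}"
      show "B a (X j) = 0"
      proof (cases "X j \<in> ev L")
        case True
        then have "i \<noteq> j" using False by auto
        then show ?thesis using B[OF j] hdb_delta[OF i j] form_od_ev[OF ab(2) True] by simp
      next
        case False
        then show ?thesis using hdb_homog[OF j] form_ev_od[OF ab(1)] by (auto simp: homog_def)
      qed
    qed
    moreover have "X i \<in> od L" using False hdb_homog[OF i] by (auto simp: homog_def)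
    ultimately show ?thesis using ab par_od hdb_nonzero[OF i] od_homog by simp
  qed
  then show "Xd i \<in> homog L" "par L (Xd i) = par L (X i)" by auto
qed

end

lemma form_parity:
  assumes "x \<in> homog L" "y \<in> homog L" "B x y \<noteq> 0" shows "par L x = par L y"
proof (rule ccontr)
  assume *: "par L x \<noteq> par L y"
  show False
  proof (cases "x \<in> ev L")
    case True
    then have "y \<in> od L" using * assms(2) by (auto simp: homog_def)
    then show False using form_ev_od[OF True] assms(3) by simp
  next
    case False
    then have "x \<in> od L" "y \<in> ev L" using * assms by (auto simp: homog_def par_def split: if_splits)
    then show False using form_od_ev assms(3) by blast
  qed
qed

text \<open>Basis independence of the canonical element of a pairing. One matrix \<open>t\<close>
  expresses both \<open>X\<close> through \<open>Y\<close> and \<open>Yd\<close> through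
  \<open>Xd\<close>. The parity argument of \<open>b\<close> carries signs along: a nonzero entry of
  \<open>t\<close> links vectors of equal parity.\<close>

lemma hdb_change_basis:
  assumes X: "homogeneous_dual_bases L B S N X Xd" and Y: "homogeneous_dual_bases L B S n Y Yd"
    and b: "\<And>p. bilin_on (scal L) S (b p)"
  shows "(\<Sum>i=1..N. b (par L (X i)) (X i) (Xd i)) = (\<Sum>i=1..n. b (par L (Y i)) (Y i) (Yd i))"
proof -
  define t where "t i j = B (Yd i) (X j)" for i j
  have par: "par L (X j) = par L (Y i)" if "t i j \<noteq> 0" "i \<in> {1..n}" "j \<in> {1..N}" for i j
    using form_parity[of "Yd i" "X j"] that hdb_dual_parity[OF Y that(2)] hdb_homog[OF X that(3)]
    by (simp add: t_def)
  note bsum = bilin_on_sum[OF b S_subspace vs.vector_space_axioms]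
  have "(\<Sum>j=1..N. b (par L (X j)) (X j) (Xd j)) =
      (\<Sum>j=1..N. \<Sum>i=1..n. t i j * b (par L (X j)) (Y i) (Xd j))"
  proof (intro sum.cong refl)
    fix j assume j: "j \<in> {1..N}"
    have "b (par L (X j)) (X j) (Xd j) =
        b (par L (X j)) (\<Sum>i=1..n. scal L (t i j) (Y i)) (Xd j)"
      unfolding t_def using hdb_expand[OF Y hdb_S[OF X j]] by simp
    also have "\<dots> = (\<Sum>i=1..n. t i j * b (par L (X j)) (Y i) (Xd j))"
      by (rule bsum) (use j hdb_S[OF Y] hdb_dual_S[OF X] in auto)
    finally show "b (par L (X j)) (X j) (Xd j) = (\<Sum>i=1..n. t i j * b (par L (X j)) (Y i) (Xd j))" .
  qed
  also have "\<dots> = (\<Sum>j=1..N. \<Sum>i=1..n. t i j * b (par L (Y i)) (Y i) (Xd j))"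
  proof (intro sum.cong refl)
    fix i j assume "j \<in> {1..N}" "i \<in> {1..n}"
    then show "t i j * b (par L (X j)) (Y i) (Xd j) = t i j * b (par L (Y i)) (Y i) (Xd j)"
      using par[of i j] by (cases "t i j = 0") auto
  qed
  also have "\<dots> = (\<Sum>i=1..n. \<Sum>j=1..N. t i j * b (par L (Y i)) (Y i) (Xd j))"
    by (rule sum.swap)
  also have "\<dots> = (\<Sum>i=1..n. b (par L (Y i)) (Y i) (Yd i))"
  proof (intro sum.cong refl)
    fix i assume i: "i \<in> {1..n}"
    have "b (par L (Y i)) (Y i) (Yd i) =
        b (par L (Y i)) (Y i) (\<Sum>j=1..N. scal L (t i j) (Xd j))"
      unfolding t_def using hdb_expand_dual[OF X hdb_dual_S[OF Y i]] by simp
    also have "\<dots> = (\<Sum>j=1..N. t i j * b (par L (Y i)) (Y i) (Xd j))"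
      by (rule bsum) (use i hdb_S[OF Y] hdb_dual_S[OF X] in auto)
    finally show "(\<Sum>j=1..N. t i j * b (par L (Y i)) (Y i) (Xd j)) = b (par L (Y i)) (Y i) (Yd i)" ..
  qed
  finally show ?thesis .
qed

text \<open>A maximal independent set of root letters is a basis of \<open>S\<close>; the given dual
  bases serve to represent its coordinate functionals, and invariance of the form gives the dual
  vectors opposite weights.\<close>

lemma exists_root_basis:
  assumes X: "homogeneous_dual_bases L B S N X Xd"
  obtains n Y Yd deg where "homogeneous_dual_bases L B S n Y Yd"
    and "\<And>i. i \<in> {1..n} \<Longrightarrow> root_letter (Y i) (deg i)"
    and "\<And>i. i \<in> {1..n} \<Longrightarrow> root_letter (Yd i) (- deg i)"
proof -
  let ?G = "{x. \<exists>d. root_letter x d}"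
  obtain Y0 where Y0: "Y0 \<subseteq> ?G" "vs.independent Y0" "?G \<subseteq> vs.span Y0"
    using vs.maximal_independent_subset by blast
  have spanY: "vs.span Y0 = S"
    unfolding par_s_span
    using Y0(1,3) by (metis vs.span_minimal vs.subspace_span vs.span_mono subset_antisym)
  have "Y0 \<subseteq> vs.span (X ` {1..N})" using hdb_span[OF X] spanY vs.span_superset by blast
  then have finY: "finite Y0"
    using vs.independent_span_bound[of "X ` {1..N}" Y0] Y0(2) by simp
  obtain Y where Y: "bij_betw Y {1..card Y0} Y0"
    using ex_bij_betw_nat_finite_1[OF finY] by blast
  define n where "n = card Y0"
  have Yim: "Y ` {1..n} = Y0" and Yinj: "inj_on Y {1..n}"
    using Y by (auto simp: bij_betw_def n_def)
  have Yin: "Y i \<in> Y0" if "i \<in> {1..n}" for i using that Yim by blast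
  define rp where "rp x i = vs.representation Y0 x (Y i)" for x i
  \<comment> \<open>The vector representing the \<open>i\<close>-th coordinate functional of
    \<open>Y0\<close> under the form, expanded in the given dual basis.\<close>
  define Yd where "Yd i = (\<Sum>j=1..N. scal L (rp (X j) i) (Xd j))" for i
  have YdS: "Yd i \<in> S" for i
    unfolding Yd_def
    by (intro vs.subspace_sum[OF S_subspace] vs.subspace_scale[OF S_subspace] hdb_dual_S[OF X])
  have B_Yd: "B (Yd i) x = rp x i" if "x \<in> S" for i x
  proof -
    have "rp x i = rp (\<Sum>j=1..N. scal L (B (Xd j) x) (X j)) i"
      using hdb_expand[OF X that] by simp
    also have "\<dots> = (\<Sum>j=1..N. B (Xd j) x * rp (X j) i)"
      unfolding rp_def
      by (subst vs.representation_sum[OF Y0(2)], 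
          simp add: spanY vs.subspace_scale S_subspace hdb_S[OF X])
        (intro sum.cong refl, subst vs.representation_scale[OF Y0(2)], simp_all add: spanY hdb_S[OF X])
    also have "\<dots> = B (Yd i) x"
      unfolding Yd_def using that
      by (subst form_sum_left) (auto simp: hdb_car[OF X] S_car mult.commute)
    finally show ?thesis ..
  qed
  have delta: "B (Yd i) (Y j) = (if i = j then 1 else 0)" if "i \<in> {1..n}" "j \<in> {1..n}" for i j
  proof -
    have "Y j \<in> S" using spanY Yin[OF that(2)] vs.span_base by blast
    then have "B (Yd i) (Y j) = (if Y i = Y j then 1 else 0)"
      using B_Yd vs.representation_basis[OF Y0(2) Yin[OF that(2)]] by (simp add: rp_def)
    then show ?thesis using inj_on_eq_iff[OF Yinj that] by simp
  qed
  have Yhomog: "Y i \<in> homog L" if "i \<in> {1..n}" for i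
    using Y0(1) Yin[OF that] root_letter_homog by blast
  have hdbY: "homogeneous_dual_bases L B S n Y Yd"
    unfolding homogeneous_dual_bases_def Yim
  proof (intro conjI ballI)
    show "Y0 \<subseteq> homog L" using Yhomog Yim by blast
    show "Yd ` {1..n} \<subseteq> S" using YdS by blast
    show "inj_on Y {1..n}" by (rule Yinj)
  qed (simp_all add: Y0(2) spanY delta)
  have "\<forall>i. \<exists>d. i \<in> {1..n} \<longrightarrow> root_letter (Y i) d"
    using Y0(1) Yin by blast
  then obtain deg where deg: "\<And>i. i \<in> {1..n} \<Longrightarrow> root_letter (Y i) (deg i)"
    by metis
  have "root_letter (Yd i) (- deg i)" if i: "i \<in> {1..n}" for i
  proof -
    obtain a where a: "a \<in> roots L h" "Y i \<in> root_space L h a" "f a = deg i"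
      using deg[OF i] by (auto simp: root_letter_def)
    have Ydc: "Yd i \<in> car L" using YdS by (rule S_car)
    have "br L H (Yd i) = scal L (- a H) (Yd i)" if H: "H \<in> h" for H
    proof -
      have Hc: "H \<in> car L" using H by (rule h_car)
      have ad_S: "br L H x \<in> S" if "x \<in> S" for x
      proof -
        have "vs.subspace {x \<in> S. br L H x \<in> S}"
          using S_subspace Hc br_scale_right[OF Hc Hc, of 0]
          by (auto simp: vs.subspace_def br_add_right br_scale_right S_car)
        moreover have "br L H x \<in> S" if "root_letter x d" for x d
          using that H root_letter_S[OF that] S_subspace
          by (auto simp: root_letter_def root_space_def vs.subspace_scale)
        ultimately have "S \<subseteq> {x \<in> S. br L H x \<in> S}"
          unfolding par_s_span by (intro vs.span_minimal) (auto simp: root_letter_S par_s_span[symmetric])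
        then show ?thesis using that by blast
      qed
      \<comment> \<open>Its pairing with \<open>Y j\<close> is \<open>a H - b H\<close> times a
        Kronecker delta; on the diagonal both weights belong to the same nonzero vector and
        agree.\<close>
      have "br L H (Yd i) + scal L (a H) (Yd i) = 0"
      proof (rule hdb_eq_zero[OF hdbY])
        show "br L H (Yd i) + scal L (a H) (Yd i) \<in> S"
          using ad_S YdS S_subspace by (simp add: vs.subspace_add vs.subspace_scale)
        fix j assume j: "j \<in> {1..n}"
        obtain b where b: "Y j \<in> root_space L h b"
          using deg[OF j] by (auto simp: root_letter_def)
        have Yc: "Y j \<in> car L" using b by (rule root_space_car)
        have "B (br L H (Yd i)) (Y j) = - B (br L (Yd i) H) (Y j)"
          using br_even_skew[OF h_ev[OF H] Ydc] Ydc Yc Hc by (simp add: form_minus_left br_car)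
        also have "\<dots> = - (b H * B (Yd i) (Y j))"
          using form_inv[OF Ydc Hc Yc] b H Ydc Yc by (simp add: root_space_def form_scale_right)
        finally have "B (br L H (Yd i) + scal L (a H) (Yd i)) (Y j)
            = (a H - b H) * B (Yd i) (Y j)"
          using Ydc Yc Hc br_car[OF Hc Ydc] vs.subspace_scale[OF subspace_car Ydc]
          by (simp add: form_add_left form_scale_left left_diff_distrib)
        moreover have "a H = b H" if "i = j"
        proof -
          have "br L H (Y i) = scal L (a H) (Y i)" "br L H (Y j) = scal L (b H) (Y j)"
            using a(2) b H by (auto simp: root_space_def)
          then have "scal L (a H) (Y i) = scal L (b H) (Y i)" using that by metis
          then show ?thesis using hdb_nonzero(1)[OF hdbY i] vs.scale_cancel_right by blast
        qed
        ultimately show "B (br L H (Yd i) + scal L (a H) (Yd i)) (Y j) = 0"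
          using delta[OF i j] by (cases "i = j") auto
      qed
      then show ?thesis by (simp add: eq_neg_iff_add_eq_0)
    qed
    then have sp: "Yd i \<in> root_space L h (- a)" using Ydc by (simp add: root_space_def)
    have "- a \<in> dual_space L h" "a \<noteq> 0"
      using a(1) by (auto simp: roots_def dual_space_def)
    then have "- a \<in> roots L h"
      using sp hdb_nonzero(2)[OF hdbY i] by (auto simp: roots_def)
    moreover have "f (- a) = - deg i"
      using f_add[of a "- a"] root_closure[of a] a(1,3) by simp
    ultimately show ?thesis
      using sp hdb_dual_parity(1)[OF hdbY i] deg[OF i] by (auto simp: root_letter_def)
  qed
  with hdbY deg that show thesis by blast
qed

end

section \<open>The Clifford ideal and the vacuum functional\<close>

context root_setting
begin

abbreviation "FS \<equiv> free_on S"
abbreviation "CI \<equiv> cliff_ideal L B S"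

definition LI :: "'g free_alg set" where
  "LI = fs.span {a * gen x | a x. a \<in> FS \<and> x \<in> U}"

text \<open>Two elements of the free algebra have the same class in the oscillator supermodule iff their
  difference lies in \<open>K\<close>.\<close>

definition K :: "'g free_alg set" where
  "K = {a + b | a b. a \<in> CI \<and> b \<in> LI}"

lemma CI_subspace: "fs.subspace CI"
  by (simp add: cliff_ideal_def)

lemma LI_subspace: "fs.subspace LI"
  by (simp add: LI_def)

lemma K_subspace: "fs.subspace K"
  unfolding K_def by (rule fs.subspace_sums[OF CI_subspace LI_subspace])

lemma CI_K: "a \<in> CI \<Longrightarrow> a \<in> K" and LI_K: "a \<in> LI \<Longrightarrow> a \<in> K"
  using fs.subspace_0[OF CI_subspace] fs.subspace_0[OF LI_subspace] unfolding K_def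
  by (force, force)

lemma mult_span_closed:
  assumes "a \<in> fs.span G" and "\<And>g. g \<in> G \<Longrightarrow> c * g \<in> fs.span G" 
  shows "c * a \<in> fs.span (G :: 'g free_alg set)"
  using assms(1)
proof (induction rule: fs.span_induct_alt)
  case base
  show ?case by (simp add: fs.span_zero)
next
  case (step k x y)
  then show ?case
    using assms(2) by (simp add: distrib_left fscale_mult_right fs.span_add fs.span_scale)
qed

lemma CI_left:
  assumes "a \<in> CI" "c \<in> FS" shows "c * a \<in> CI"
  using assms(1) unfolding cliff_ideal_def
proof (rule mult_span_closed)
  fix g assume "g \<in> {a * r * b | a r b. a \<in> FS \<and> b \<in> FS \<and>
     r \<in> {gen (x + y) - gen x - gen y | x y. x \<in> S \<and> y \<in> S} \<union>
         {gen (scal L c x) - fscale c (gen x) | c x. x \<in> S} \<union>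
         {gen x * gen y + fscale ((-1) ^ (par L x * par L y)) (gen y * gen x)
            - fscale (2 * B x y) 1 | x y. x \<in> S \<inter> homog L \<and> y \<in> S \<inter> homog L}}" (is "g \<in> ?G")
  then obtain a r b where g: "g = a * r * b" "a \<in> FS" "b \<in> FS" and
    "r \<in> {gen (x + y) - gen x - gen y | x y. x \<in> S \<and> y \<in> S} \<union>
         {gen (scal L c x) - fscale c (gen x) | c x. x \<in> S} \<union>
         {gen x * gen y + fscale ((-1) ^ (par L x * par L y)) (gen y * gen x)
            - fscale (2 * B x y) 1 | x y. x \<in> S \<inter> homog L \<and> y \<in> S \<inter> homog L}" (is "r \<in> ?R")
    by blast
  moreover have "c * g = (c * a) * r * b" using g(1) by (simp add: mult.assoc)
  moreover have "c * a \<in> FS" using assms(2) g(2) by (rule free_on_mult)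
  ultimately have "c * g \<in> ?G" by blast
  then show "c * g \<in> fs.span ?G" by (rule fs.span_base)
qed

lemma CI_rel:
  assumes "b \<in> FS"
    and "r \<in> {gen (x + y) - gen x - gen y | x y. x \<in> S \<and> y \<in> S} \<union>
         {gen (scal L c x) - fscale c (gen x) | c x. x \<in> S} \<union>
         {gen x * gen y + fscale ((-1) ^ (par L x * par L y)) (gen y * gen x)
            - fscale (2 * B x y) 1 | x y. x \<in> S \<inter> homog L \<and> y \<in> S \<inter> homog L}"
  shows "r * b \<in> CI"
  unfolding cliff_ideal_def
  by (rule fs.span_base, rule CollectI, rule exI[of _ 1], rule exI[of _ r], rule exI[of _ b])
    (use assms in simp)

lemma CI_add:
  assumes "x \<in> S" "y \<in> S" "b \<in> FS"
  shows "gen (x + y) * b - (gen x * b + gen y * b) \<in> CI"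
proof -
  have "(gen (x + y) - gen x - gen y) * b \<in> CI"
    by (rule CI_rel[OF assms(3)]) (use assms in blast)
  then show ?thesis by (simp add: left_diff_distrib algebra_simps)
qed

lemma CI_scale:
  assumes "x \<in> S" "b \<in> FS"
  shows "gen (scal L c x) * b - fscale c (gen x * b) \<in> CI"
proof -
  have "(gen (scal L c x) - fscale c (gen x)) * b \<in> CI"
    by (rule CI_rel[OF assms(2)]) (use assms in blast)
  then show ?thesis by (simp add: left_diff_distrib fscale_mult_left)
qed

lemma CI_clifford:
  assumes "x \<in> S" "x \<in> homog L" "y \<in> S" "y \<in> homog L" "b \<in> FS"
  shows "gen x * (gen y * b) - (fscale (- ((-1) ^ (par L x * par L y))) (gen y * (gen x * b))
           + fscale (2 * B x y) b) \<in> CI"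
proof -
  have "(gen x * gen y + fscale ((-1) ^ (par L x * par L y)) (gen y * gen x) - fscale (2 * B x y) 1) * b \<in> CI"
    by (rule CI_rel[OF assms(5)]) (use assms in blast)
  then show ?thesis
    by (simp add: distrib_right left_diff_distrib fscale_mult_left mult.assoc algebra_simps)
qed

lemma LI_left:
  assumes "a \<in> LI" "c \<in> FS" shows "c * a \<in> LI"
  using assms(1) unfolding LI_def
proof (rule mult_span_closed)
  fix g assume "g \<in> {a * gen x | a x. a \<in> FS \<and> x \<in> U}"
  then obtain a x where "c * g = (c * a) * gen x" "c * a \<in> FS" "x \<in> U"
    using free_on_mult[OF assms(2)] by (auto simp: mult.assoc)
  then show "c * g \<in> fs.span {a * gen x | a x. a \<in> FS \<and> x \<in> U}"
    by (intro fs.span_base) blast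
qed

lemma K_left: "a \<in> K \<Longrightarrow> c \<in> FS \<Longrightarrow> c * a \<in> K"
proof -
  assume "a \<in> K" and c: "c \<in> FS"
  then obtain u v where "a = u + v" "u \<in> CI" "v \<in> LI" by (auto simp: K_def)
  then show "c * a \<in> K"
    using CI_left[OF _ c] LI_left[OF _ c] by (auto simp: K_def distrib_left)
qed

lemma LI_gen: "x \<in> U \<Longrightarrow> a \<in> FS \<Longrightarrow> a * gen x \<in> LI"
  unfolding LI_def by (intro fs.span_base) blast

end

section \<open>The Fock representation for a basis of root vectors\<close>

locale root_basis = root_setting +
  fixes n :: nat and Y Yd :: "nat \<Rightarrow> 'a" and deg :: "nat \<Rightarrow> int"
  assumes hdb: "homogeneous_dual_bases L B S n Y Yd"
    and letter: "\<And>i. i \<in> {1..n} \<Longrightarrow> root_letter (Y i) (deg i)"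
    and dual_letter: "\<And>i. i \<in> {1..n} \<Longrightarrow> root_letter (Yd i) (- deg i)"
begin

text \<open>Only letters of positive degree contract, so those of negative degree act by pure creation and
  those of positive degree kill the vacuum. The polarization \<open>cf_polarize\<close> gives back the form.\<close>

definition cf :: "nat \<Rightarrow> nat \<Rightarrow> complex" where
  "cf i j = (if i \<in> {1..n} \<and> j \<in> {1..n} \<and> deg i > 0 then 2 * B (Y i) (Y j) else 0)"

sublocale wick n "\<lambda>i. par L (Y i)" cf
proof
  show "par L (Y i) = par L (Y j)" if "cf i j \<noteq> 0" for i j
    using that form_parity[of "Y i" "Y j"] letter root_letter_homog
    by (auto simp: cf_def split: if_splits)
  show "j \<in> {1..n}" if "cf i j \<noteq> 0" for i j
    using that by (auto simp: cf_def split: if_splits)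
qed

text \<open>A nonzero pairing joins letters of opposite nonzero degrees, so exactly one of
  \<open>cf i j\<close> and \<open>cf j i\<close> carries the whole form. The factor 2 is that of
  the Clifford relation.\<close>

lemma cf_polarize:
  assumes "i \<in> {1..n}" "j \<in> {1..n}"
  shows "cf i j - sg i j * cf j i = 2 * B (Y i) (Y j)"
proof -
  have sym: "B (Y i) (Y j) = - sg i j * B (Y j) (Y i)"
    using form_sym[OF root_letter_homog[OF letter[OF assms(1)]] root_letter_homog[OF letter[OF assms(2)]]]
    by (simp add: sg_def)
  have "deg i + deg j = 0" if "B (Y i) (Y j) \<noteq> 0"
    using root_letter_form[OF letter[OF assms(1)] letter[OF assms(2)] that] .
  moreover have "deg i \<noteq> 0" using letter[OF assms(1)] by (simp add: root_letter_def)
  moreover have "B (Y j) (Y i) = 0" if "B (Y i) (Y j) = 0"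
    using sym that by (metis mult_eq_0_iff neg_equal_0_iff_equal sg_sq(1) zero_neq_one)
  ultimately show ?thesis
    using assms sym by (cases "B (Y i) (Y j) = 0"; cases "deg i > 0") (auto simp: cf_def)
qed

text \<open>\<open>B (Yd i) x\<close> is the \<open>i\<close>-th coordinate of a vector
  \<open>x\<close> of \<open>S\<close>, so the operator is linear in \<open>x\<close> on the nose
  and the linearity relations act by zero.\<close>

definition fock_op :: "'a \<Rightarrow> (nat list \<Rightarrow> complex) \<Rightarrow> nat list \<Rightarrow> complex" where
  "fock_op x c = (\<Sum>i=1..n. sm (B (Yd i) x) (clif i c))"

lemma sum_apply_fun: "(\<Sum>i\<in>D. g i) w = (\<Sum>i\<in>D. g i w)" for g :: "'i \<Rightarrow> 'j \<Rightarrow> complex"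
  by (induction D rule: infinite_finite_induct) auto

lemma fock_op_apply: "fock_op x c w = (\<Sum>i=1..n. B (Yd i) x * clif i c w)"
  by (simp add: fock_op_def sum_apply_fun)

lemma fock_op_add: "fock_op x (c + d) = fock_op x c + fock_op x d"
  by (simp add: fun_eq_iff fock_op_apply clif_add distrib_left sum.distrib)

lemma fock_op_sm: "fock_op x (sm a c) = sm a (fock_op x c)"
  by (simp add: fun_eq_iff fock_op_apply clif_sm sum_distrib_left mult.left_commute)

lemma fock_op_add_gen: "x \<in> S \<Longrightarrow> y \<in> S \<Longrightarrow> fock_op (x + y) c = fock_op x c + fock_op y c"
  by (simp add: fun_eq_iff fock_op_apply form_add_right hdb_car[OF hdb] S_car distrib_right sum.distrib)

lemma fock_op_scale_gen: "x \<in> S \<Longrightarrow> fock_op (scal L a x) c = sm a (fock_op x c)"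
  by (simp add: fun_eq_iff fock_op_apply form_scale_right hdb_car[OF hdb] S_car sum_distrib_left mult.assoc)

text \<open>The inductive predicates have no rule for zero; they reach it as a multiple by
  0.\<close>

lemma zero_eq_sm: "(0 :: nat list \<Rightarrow> complex) = sm 0 c"
  by (simp add: fun_eq_iff)

lemma fock_sum: "(\<And>i. i \<in> D \<Longrightarrow> fock (g i)) \<Longrightarrow> fock (\<Sum>i\<in>D. g i)"
  by (induction D rule: infinite_finite_induct)
    (simp_all only: sum.infinite sum.empty sum.insert zero_eq_sm[of vac] fock.intros insert_iff simp_thms)

lemma fock_fock_op: "fock c \<Longrightarrow> fock (fock_op x c)"
  unfolding fock_op_def by (intro fock_sum fock.sm clif_fock)

lemma ext_ideal_zero: "ext_ideal 0"
  using ext_ideal.sm[OF ext_ideal.rel[OF fock.vac], of 0] zero_eq_sm by metis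

lemma ext_ideal_sum: "(\<And>i. i \<in> D \<Longrightarrow> ext_ideal (g i)) \<Longrightarrow> ext_ideal (\<Sum>i\<in>D. g i)"
  by (induction D rule: infinite_finite_induct)
    (simp_all only: sum.infinite sum.empty sum.insert ext_ideal_zero ext_ideal.intros insert_iff simp_thms)

lemma ext_ideal_fock_op: "ext_ideal c \<Longrightarrow> ext_ideal (fock_op x c)"
  unfolding fock_op_def by (intro ext_ideal_sum ext_ideal.sm clif_ext_ideal)

lemma clif_zero: "clif i 0 = 0"
  by (metis clif_sm zero_eq_sm)

lemma clif_sum: "clif i (\<Sum>j\<in>D. g j) = (\<Sum>j\<in>D. clif i (g j))"
  by (induction D rule: infinite_finite_induct)
    (simp_all only: sum.infinite sum.empty sum.insert clif_add clif_zero simp_thms)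

lemma fock_op_A: "fock_op x (fock_op y c) w = (\<Sum>i=1..n. \<Sum>j=1..n. B (Yd i) x * B (Yd j) y * clif i (clif j c) w)"
  unfolding fock_op_apply[of x] fock_op_def[of y] clif_sum clif_sm sum_apply_fun
  by (simp add: sum_distrib_left mult.assoc)

lemma form_expand:
  assumes "x \<in> S" "y \<in> S"
  shows "B x y = (\<Sum>i=1..n. \<Sum>j=1..n. B (Yd i) x * B (Yd j) y * B (Y i) (Y j))"
proof -
  have "B x y = B (\<Sum>i=1..n. scal L (B (Yd i) x) (Y i)) (\<Sum>j=1..n. scal L (B (Yd j) y) (Y j))"
    using hdb_expand[OF hdb assms(1)] hdb_expand[OF hdb assms(2)] by metis
  also have "\<dots> = (\<Sum>i=1..n. B (Yd i) x * B (Y i) (\<Sum>j=1..n. scal L (B (Yd j) y) (Y j)))"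
    using assms hdb_expand[OF hdb assms(2)] by (intro form_sum_left) (auto simp: hdb_car[OF hdb] S_car)
  also have "\<dots> = (\<Sum>i=1..n. B (Yd i) x * (\<Sum>j=1..n. B (Yd j) y * B (Y i) (Y j)))"
    by (intro sum.cong refl arg_cong2[where f = times] form_sum_right) (auto simp: hdb_car[OF hdb])
  finally show ?thesis by (simp add: sum_distrib_left mult.assoc)
qed

text \<open>Bilinear expansion of \<open>clif_relation\<close>. A coordinate of a homogeneous vector
  is nonzero only at indices of its own parity, so the sign may be replaced term by term, and
  \<open>cf_polarize\<close> assembles the scalars to the form.\<close>

lemma fock_op_clifford:
  assumes x: "x \<in> S" "x \<in> homog L" and y: "y \<in> S" "y \<in> homog L" and c: "fock c"
  shows "ext_ideal (fock_op x (fock_op y c) + sm ((-1) ^ (par L x * par L y)) (fock_op y (fock_op x c)) + sm (- (2 * B x y)) c)"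
proof -
  define z where "z i j = clif i (clif j c) + sm (- sg i j) (clif j (clif i c)) + sm (- (cf i j - sg i j * cf j i)) c" for i j
  have sgn: "B (Yd i) x * B (Yd j) y * (-1) ^ (par L x * par L y) = B (Yd i) x * B (Yd j) y * - sg i j"
    if "i \<in> {1..n}" "j \<in> {1..n}" for i j
  proof (cases "B (Yd i) x = 0 \<or> B (Yd j) y = 0")
    case False
    then have "par L x = par L (Y i)" "par L y = par L (Y j)"
      using form_parity[of "Yd i" x] form_parity[of "Yd j" y] x y hdb_dual_parity[OF hdb] that by auto
    then show ?thesis by (simp add: sg_def)
  qed auto
  have "fock_op x (fock_op y c) + sm ((-1) ^ (par L x * par L y)) (fock_op y (fock_op x c)) + sm (- (2 * B x y)) c
      = (\<Sum>i=1..n. \<Sum>j=1..n. sm (B (Yd i) x * B (Yd j) y) (z i j))" (is "?l = ?r")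
  proof
    fix w
    have 1: "(-1) ^ (par L x * par L y) * fock_op y (fock_op x c) w =
        (\<Sum>i=1..n. \<Sum>j=1..n. B (Yd i) x * B (Yd j) y * (- sg i j * clif j (clif i c) w))"
    proof -
      have "(-1) ^ (par L x * par L y) * fock_op y (fock_op x c) w =
        (\<Sum>i=1..n. \<Sum>j=1..n. B (Yd i) x * B (Yd j) y * (-1) ^ (par L x * par L y) * clif j (clif i c) w)"
        unfolding fock_op_A by (subst sum.swap) (simp add: sum_distrib_left mult_ac)
      also have "\<dots> = (\<Sum>i=1..n. \<Sum>j=1..n. B (Yd i) x * B (Yd j) y * - sg i j * clif j (clif i c) w)"
        by (intro sum.cong refl) (simp add: sgn del: mult_minus_right)
      finally show ?thesis by (simp add: mult.assoc)
    qed
    have 2: "- (2 * B x y) * c w =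
        (\<Sum>i=1..n. \<Sum>j=1..n. B (Yd i) x * B (Yd j) y * (- (cf i j - sg i j * cf j i) * c w))"
      unfolding form_expand[OF x(1) y(1)] sum_distrib_left sum_distrib_right sum_negf[symmetric]
      by (intro sum.cong refl) (simp add: cf_polarize)
    have "?l w = fock_op x (fock_op y c) w + (-1) ^ (par L x * par L y) * fock_op y (fock_op x c) w + - (2 * B x y) * c w"
      by (simp only: plus_fun_apply sm_apply)
    also have "\<dots> = (\<Sum>i=1..n. \<Sum>j=1..n. B (Yd i) x * B (Yd j) y * clif i (clif j c) w
        + B (Yd i) x * B (Yd j) y * (- sg i j * clif j (clif i c) w)
        + B (Yd i) x * B (Yd j) y * (- (cf i j - sg i j * cf j i) * c w))"
      by (simp only: 1 2 fock_op_A[of x y c w] sum.distrib)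
    also have "\<dots> = ?r w"
      by (simp only: sum_apply_fun z_def plus_fun_apply sm_apply distrib_left mult.assoc)
    finally show "?l w = ?r w" .
  qed
  moreover have "ext_ideal ?r"
    unfolding z_def by (intro ext_ideal_sum ext_ideal.sm clif_relation c)
  ultimately show ?thesis by simp
qed

definition fock_rep :: "'a list \<Rightarrow> nat list \<Rightarrow> complex" where
  "fock_rep w = foldr fock_op w vac"

text \<open>The action of the free algebra on the vacuum. Values are unreduced combinations of
  words: letters of positive degree do create, and kill the vacuum only modulo
  \<open>rideal\<close>.\<close>

definition Fock :: "'a free_alg \<Rightarrow> nat list \<Rightarrow> complex" where
  "Fock p = (\<lambda>u. lext (\<lambda>w. fock_rep w u) p)"

definition vev :: "'a free_alg \<Rightarrow> complex" where
  "vev p = Fock p []"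

lemma Fock_add: "Fock (p + q) = Fock p + Fock q"
  by (simp add: Fock_def fun_eq_iff lext_add)

lemma Fock_scale: "Fock (fscale c p) = sm c (Fock p)"
  by (simp add: Fock_def fun_eq_iff lext_scale)

lemma Fock_diff: "Fock (p - q) = Fock p + sm (-1) (Fock q)"
proof -
  have "p - q = p + fscale (-1) q" by simp
  then show ?thesis by (simp only: Fock_add Fock_scale)
qed

lemma Fock_zero: "Fock 0 = 0"
  by (metis Fock_scale fs.scale_zero_left zero_eq_sm)

lemma Fock_word: "Fock (basis_vec w) = foldr fock_op w vac"
  by (simp add: Fock_def fock_rep_def)

lemma Fock_one: "Fock 1 = vac"
  by (simp add: Fock_word flip: basis_vec_Nil)

lemma UNIV_free_on: "free_on UNIV = UNIV"
  by (auto simp: free_on_def)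

lemma Fock_gen_mult: "Fock (gen x * b) = fock_op x (Fock b)"
proof -
  have "b \<in> free_on UNIV" by (simp add: UNIV_free_on)
  then show ?thesis
    by (induction rule: free_on_induct)
      (simp_all only: gen_mult_basis_vec Fock_word foldr.simps o_apply distrib_left Fock_add fock_op_add
        fscale_mult_right Fock_scale fock_op_sm)
qed

lemma Fock_word_mult: "Fock (basis_vec w * b) = foldr fock_op w (Fock b)"
proof (induction w)
  case Nil
  then show ?case by (simp add: basis_vec_Nil)
next
  case (Cons x w)
  then show ?case by (simp add: basis_vec_Cons mult.assoc Fock_gen_mult)
qed

lemma fock_Fock: "fock (Fock b)"
proof -
  have "b \<in> free_on UNIV" by (simp add: UNIV_free_on)
  then show ?thesis
  proof (induction rule: free_on_induct)
    case (word w)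
    show ?case unfolding Fock_word by (induction w) (simp_all add: fock.vac fock_fock_op)
  qed (simp_all only: Fock_add Fock_scale fock.intros)
qed

lemma vev_add: "vev (a + b) = vev a + vev b" and vev_scale: "vev (fscale c a) = c * vev a"
  by (simp_all add: vev_def Fock_add Fock_scale)

lemma vev_one: "vev 1 = 1"
  by (simp add: vev_def Fock_one vac_def)

lemma Fock_mult_closed:
  assumes "a \<in> FS" and "Q (Fock b)"
    and "\<And>c d. Q c \<Longrightarrow> Q d \<Longrightarrow> Q (c + d)" "\<And>k c. Q c \<Longrightarrow> Q (sm k c)" "\<And>x c. Q c \<Longrightarrow> Q (fock_op x c)"
  shows "Q (Fock (a * b))"
  using assms(1)
proof (induction rule: free_on_induct)
  case (word w)
  show ?case unfolding Fock_word_mult using assms(2) by (induction w) (simp_all add: assms(5))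
qed (simp_all only: distrib_right Fock_add fscale_mult_left Fock_scale assms(3,4))

text \<open>The right factor of a relation is absorbed into the vector acted upon, and left factors
  preserve the ideal. Only the Clifford relations make use of the ideal; the linearity relations
  give zero.\<close>

lemma Fock_CI:
  assumes "a \<in> CI" shows "ext_ideal (Fock a)"
  using assms unfolding cliff_ideal_def
proof (induction rule: fs.span_induct_alt)
  case base
  show ?case by (simp only: Fock_zero ext_ideal_zero)
next
  case (step c g y)
  from step.hyps obtain a r b where g': "g = a * r * b" "a \<in> FS"
    and r: "r \<in> {gen (x + y) - gen x - gen y | x y. x \<in> S \<and> y \<in> S} \<union>
         {gen (scal L c x) - fscale c (gen x) | c x. x \<in> S} \<union>
         {gen x * gen y + fscale ((-1) ^ (par L x * par L y)) (gen y * gen x)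
            - fscale (2 * B x y) 1 | x y. x \<in> S \<inter> homog L \<and> y \<in> S \<inter> homog L}"
    by blast
  have g: "g = a * (r * b)" "a \<in> FS" using g' by (simp_all add: mult.assoc)
  from r consider x y where "x \<in> S" "y \<in> S" "r = gen (x + y) - gen x - gen y"
    | k x where "x \<in> S" "r = gen (scal L k x) - fscale k (gen x)"
    | x y where "x \<in> S \<inter> homog L" "y \<in> S \<inter> homog L"
      "r = gen x * gen y + fscale ((-1) ^ (par L x * par L y)) (gen y * gen x) - fscale (2 * B x y) 1"
    by blast
  then have "ext_ideal (Fock (r * b))"
  proof cases
    case 1
    have "Fock (r * b) = 0"
      unfolding 1(3) left_diff_distrib Fock_diff Fock_gen_mult fock_op_add_gen[OF 1(1,2)]
      by (simp add: fun_eq_iff)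
    then show ?thesis using ext_ideal_zero by simp
  next
    case 2
    have "Fock (r * b) = 0"
      unfolding 2(2) left_diff_distrib Fock_diff Fock_gen_mult fock_op_scale_gen[OF 2(1)]
        fscale_mult_left Fock_scale
      by (simp add: fun_eq_iff)
    then show ?thesis using ext_ideal_zero by simp
  next
    case 3
    have "Fock (r * b) = fock_op x (fock_op y (Fock b)) + sm ((-1) ^ (par L x * par L y)) (fock_op y (fock_op x (Fock b)))
        + sm (- (2 * B x y)) (Fock b)"
      unfolding 3(3) left_diff_distrib distrib_right Fock_diff Fock_add fscale_mult_left Fock_scale
        mult.assoc Fock_gen_mult
      by (simp add: fun_eq_iff)
    then show ?thesis using fock_op_clifford[of x y "Fock b"] 3(1,2) fock_Fock by simp
  qed
  then have "ext_ideal (Fock g)"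
    unfolding g(1) by (rule Fock_mult_closed[where Q = ext_ideal, OF g(2)]) (fact | rule ext_ideal.intros ext_ideal_fock_op; assumption)+
  then show ?case
    using step by (simp only: Fock_add Fock_scale ext_ideal.intros)
qed

text \<open>The image of the left ideal generated by \<open>\<uu>\<close>. Stability under contraction comes from the
  isotropy of \<open>\<uu>\<close>.\<close>

inductive rideal :: "(nat list \<Rightarrow> complex) \<Rightarrow> bool" where
  gen: "x \<in> U \<Longrightarrow> rideal (\<Sum>j=1..n. sm (B (Yd j) x) (create j vac))"
| add: "rideal c \<Longrightarrow> rideal d \<Longrightarrow> rideal (c + d)"
| sm: "rideal c \<Longrightarrow> rideal (sm a c)"
| create: "rideal c \<Longrightarrow> rideal (create i c)"

lemma rideal_at_Nil: "rideal c \<Longrightarrow> c [] = 0"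
  by (induction rule: rideal.induct) (simp_all add: create_def sum_apply_fun)

lemma U_S: "x \<in> U \<Longrightarrow> x \<in> S"
proof -
  have "U \<subseteq> S" unfolding par_u_span par_s_span by (rule vs.span_mono) auto
  then show "x \<in> U \<Longrightarrow> x \<in> S" by auto
qed

lemma form_letter_U:
  assumes "root_letter y d" "d > 0" "x \<in> U" shows "B y x = 0"
proof -
  have yc: "y \<in> car L" using assms(1) by (rule root_letter_car)
  have "vs.subspace {x \<in> car L. B y x = 0}"
    using subspace_car yc by (auto simp: vs.subspace_def form_add_right form_scale_right)
  moreover have "B y x = 0" if "root_letter x d'" "d' > 0" for x d'
    using root_letter_form[OF assms(1) that(1)] assms(2) that(2) by fastforce
  ultimately have "U \<subseteq> {x \<in> car L. B y x = 0}"
    unfolding par_u_span by (intro vs.span_minimal) (auto simp: root_letter_car)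
  then show ?thesis using assms(3) by auto
qed

lemma contr_zero: "contr i 0 = 0"
  by (metis contr_sm zero_eq_sm)

lemma contr_sum: "contr i (\<Sum>j\<in>D. g j) = (\<Sum>j\<in>D. contr i (g j))"
  by (induction D rule: infinite_finite_induct)
    (simp_all only: sum.infinite sum.empty sum.insert contr_add contr_zero simp_thms)

lemma rideal_zero: "rideal 0"
proof -
  have "rideal (sm 0 (\<Sum>j=1..n. sm (B (Yd j) 0) (create j vac)))"
    by (intro rideal.sm rideal.gen) (simp add: par_u_def vs.span_zero)
  then show ?thesis by (simp flip: zero_eq_sm)
qed

lemma contr_rideal: "rideal c \<Longrightarrow> rideal (contr i c)"
proof (induction rule: rideal.induct)
  case (gen x)
  \<comment> \<open>The contraction of \<open>x\<close> by the letter \<open>i\<close>: it equals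
    \<open>2 * B (Y i) x\<close> for a letter of positive degree and is zero by the choice of
    \<open>cf\<close> otherwise.\<close>
  have "(\<Sum>j=1..n. B (Yd j) x * cf i j) = 0"
  proof (cases "i \<in> {1..n} \<and> deg i > 0")
    case True
    have "(\<Sum>j=1..n. B (Yd j) x * cf i j) = 2 * (\<Sum>j=1..n. B (Yd j) x * B (Y i) (Y j))"
      unfolding sum_distrib_left using True by (intro sum.cong refl) (simp add: cf_def)
    also have "(\<Sum>j=1..n. B (Yd j) x * B (Y i) (Y j)) = B (Y i) (\<Sum>j=1..n. scal L (B (Yd j) x) (Y j))"
      using True by (intro form_sum_right[symmetric]) (auto simp: hdb_car[OF hdb])
    also have "\<dots> = B (Y i) x"
      by (simp only: hdb_expand[OF hdb U_S[OF gen], symmetric])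
    also have "\<dots> = 0" using form_letter_U[OF letter _ gen] True by simp
    finally show ?thesis by simp
  qed (auto simp: cf_def)
  have "contr i (\<Sum>j=1..n. sm (B (Yd j) x) (create j vac)) = sm (\<Sum>j=1..n. B (Yd j) x * cf i j) vac"
  proof
    have "create j (\<lambda>w. 0) w = 0" for j w by (simp add: create_def split: list.split)
    then show "contr i (\<Sum>j=1..n. sm (B (Yd j) x) (create j vac)) w
        = sm (\<Sum>j=1..n. B (Yd j) x * cf i j) vac w" for w
      unfolding contr_sum contr_sm contr_create contr_vac
      by (simp add: sum_apply_fun sum_distrib_right mult.assoc)
  qed
  also have "\<dots> = 0" unfolding \<open>_ = 0\<close> by (simp flip: zero_eq_sm)
  finally show ?case by (simp only: rideal_zero)
qed (simp_all only: contr_add contr_sm contr_create rideal.intros)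

lemma rideal_fock_op: "rideal c \<Longrightarrow> rideal (fock_op x c)"
proof -
  have sum: "rideal (\<Sum>i\<in>D. g i)" if "\<And>i. rideal (g i)" for D and g :: "nat \<Rightarrow> _"
    by (induction D rule: infinite_finite_induct)
      (simp_all only: sum.infinite sum.empty sum.insert rideal_zero rideal.intros that simp_thms)
  show "rideal c \<Longrightarrow> rideal (fock_op x c)"
    unfolding fock_op_def clif_def by (intro sum rideal.sm rideal.add rideal.create contr_rideal)
qed

text \<open>Contractions vanish on the vacuum, so a vector of \<open>U\<close> at the right end
  produces exactly a generator of \<open>rideal\<close>.\<close>

lemma Fock_LI:
  assumes "a \<in> LI" shows "rideal (Fock a)"
  using assms unfolding LI_def
proof (induction rule: fs.span_induct_alt)
  case base
  show ?case by (simp only: Fock_zero rideal_zero)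
next
  case (step c g y)
  then obtain a x where g: "g = a * gen x" "a \<in> FS" "x \<in> U" by auto
  have "Fock (gen x) = fock_op x vac" using Fock_gen_mult[of x 1] by (simp add: Fock_one)
  also have "\<dots> = (\<Sum>j=1..n. sm (B (Yd j) x) (create j vac))"
    unfolding fock_op_def clif_def contr_vac by (simp add: fun_eq_iff sum_apply_fun)
  finally have "rideal (Fock (gen x))" using rideal.gen[OF g(3)] by simp
  then have "rideal (Fock g)"
    unfolding g(1) by (rule Fock_mult_closed[where Q = rideal, OF g(2)]) (fact | rule rideal.intros rideal_fock_op; assumption)+
  then show ?case
    using step by (simp only: Fock_add Fock_scale rideal.intros)
qed

lemma vev_K: "a \<in> K \<Longrightarrow> vev a = 0"
  unfolding K_def using rideal_at_Nil[OF Fock_LI] ext_ideal_at_Nil[OF Fock_CI]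
  by (auto simp: vev_add) (simp add: vev_def)

text \<open>Only indices of degree \<open>d\<close> contribute to \<open>x\<close>. For negative
  degree their operators are pure creation and leave nothing at the empty word.\<close>

lemma vev_negative_letter:
  assumes "root_letter x d" "d < 0" shows "vev (gen x * a) = 0"
proof -
  have "B (Yd i) x * clif i c [] = 0" if i: "i \<in> {1..n}" for i c
  proof (cases "B (Yd i) x = 0")
    case False
    then have "- deg i + d = 0" using root_letter_form[OF dual_letter[OF i] assms(1)] by blast
    then have "cf i k = 0" for k using assms(2) by (simp add: cf_def)
    then show ?thesis by (simp add: clif_def create_def contr_def)
  qed simp
  then show ?thesis unfolding vev_def Fock_gen_mult fock_op_apply by (intro sum.neutral) blast
qed

text \<open>Moving letters of \<open>\<uu>\<close> to the right, where they vanish, turns a word of root vectors into a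
  combination of words in the opposite nilradical with the same degree and length parity.\<close>

definition ubar_word :: "int \<Rightarrow> nat \<Rightarrow> 'a list \<Rightarrow> bool" where
  "ubar_word d p w \<longleftrightarrow> (\<exists>ds. list_all2 root_letter w ds \<and> (\<forall>e\<in>set ds. e < 0) \<and>
     sum_list ds = d \<and> length w mod 2 = p mod 2)"

text \<open>Representatives of the part of the oscillator supermodule of degree \<open>d\<close> and
  length parity \<open>p\<close>. Including \<open>K\<close> in each of them makes the grading
  usable before passing to the quotient.\<close>

definition Z :: "int \<Rightarrow> nat \<Rightarrow> 'a free_alg set" where
  "Z d p = {a + b | a b. a \<in> K \<and> b \<in> fs.span {basis_vec w | w. ubar_word d p w}}"

lemma Z_subspace: "fs.subspace (Z d p)"
  unfolding Z_def by (intro fs.subspace_sums K_subspace fs.subspace_span)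

lemma K_Z: "a \<in> K \<Longrightarrow> a \<in> Z d p"
  unfolding Z_def by (intro CollectI exI[of _ a] exI[of _ 0]) (simp add: fs.span_zero)

lemma word_Z: "ubar_word d p w \<Longrightarrow> basis_vec w \<in> Z d p"
  unfolding Z_def
  by (rule CollectI, rule exI[of _ 0], rule exI[of _ "basis_vec w"], intro conjI fs.span_base)
    (auto simp: fs.subspace_0[OF K_subspace])

lemma Z_induct [consumes 1, case_names K word add scale]:
  assumes "a \<in> Z d p" "\<And>a. a \<in> K \<Longrightarrow> Q a" "\<And>w. ubar_word d p w \<Longrightarrow> Q (basis_vec w)"
    "\<And>a b. Q a \<Longrightarrow> Q b \<Longrightarrow> Q (a + b)" "\<And>c a. Q a \<Longrightarrow> Q (fscale c a)"
  shows "Q a"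
proof -
  have "Q 0" using assms(2) fs.subspace_0[OF K_subspace] by blast
  have "Q b" if "b \<in> fs.span {basis_vec w | w. ubar_word d p w}" for b
    using that by (induction rule: fs.span_induct_alt) (use assms(3-5) \<open>Q 0\<close> in blast)+
  then show ?thesis using assms(1,2,4) unfolding Z_def by blast
qed

lemma ubar_word_FS: "ubar_word d p w \<Longrightarrow> basis_vec w \<in> FS"
  using root_letter_S by (fastforce simp: ubar_word_def list_all2_conv_all_nth in_set_conv_nth)

lemma ubar_word_Cons: "root_letter x e \<Longrightarrow> e < 0 \<Longrightarrow> ubar_word d p w \<Longrightarrow> ubar_word (e + d) (Suc p) (x # w)"
proof -
  assume x: "root_letter x e" "e < 0" and "ubar_word d p w"
  then obtain ds where ds: "list_all2 root_letter w ds" "\<forall>e\<in>set ds. e < 0" "sum_list ds = d"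
    "length w mod 2 = p mod 2" by (auto simp: ubar_word_def)
  have "length (x # w) mod 2 = Suc p mod 2"
    using ds(4) mod_Suc_eq[of "length w" 2] mod_Suc_eq[of p 2] by simp
  then show "ubar_word (e + d) (Suc p) (x # w)"
    unfolding ubar_word_def using x ds by (intro exI[of _ "e # ds"]) simp
qed

lemma Z_letter_neg:
  assumes "root_letter x e" "e < 0" "a \<in> Z d p"
  shows "gen x * a \<in> Z (e + d) (Suc p)"
  using assms(3)
proof (induction rule: Z_induct)
  case (K a)
  then show ?case using K_left root_letter_S[OF assms(1)] by (intro K_Z) simp
next
  case (word w)
  then show ?case using ubar_word_Cons[OF assms(1,2)] word_Z by (simp add: gen_mult_basis_vec)
qed (simp_all add: distrib_left fscale_mult_right fs.subspace_add fs.subspace_scale Z_subspace)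

lemma Z_parity: "p mod 2 = q mod 2 \<Longrightarrow> Z d p = Z d q"
  by (simp add: Z_def ubar_word_def)

text \<open>The letter \<open>x\<close> is exchanged with the first letter \<open>y\<close>. The
  exchanged term is covered by induction, the scalar term loses both letters, and at the right end
  \<open>x\<close> falls into the left ideal.\<close>

lemma Z_letter_pos_word:
  assumes x: "root_letter x e" "e > 0" and w: "ubar_word d p w"
  shows "gen x * basis_vec w \<in> Z (e + d) (Suc p)"
  using w
proof (induction w arbitrary: d p)
  case Nil
  have "gen x * basis_vec [] \<in> K"
    using LI_K[OF LI_gen[OF root_letter_U[OF x], of 1]] by (simp add: basis_vec_Nil)
  then show ?case by (rule K_Z)
next
  case (Cons y w)
  then obtain e' ds where y: "root_letter y e'" "e' < 0" and ds: "list_all2 root_letter w ds"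
    "\<forall>e\<in>set ds. e < 0" "e' + sum_list ds = d" "length (y # w) mod 2 = p mod 2"
    by (auto simp: ubar_word_def list_all2_Cons1)
  have par: "length w mod 2 = Suc p mod 2" using ds(4) by (simp add: mod_Suc split: if_splits)
  have w: "ubar_word (d - e') (Suc p) w" using ds par by (auto simp: ubar_word_def)
  let ?b = "basis_vec w :: 'a free_alg"
  have bFS: "?b \<in> FS" using w by (rule ubar_word_FS)
  have 1: "gen y * (gen x * ?b) \<in> Z (e + d) (Suc p)"
    using Z_letter_neg[OF y Cons.IH[OF w]] Z_parity[of "Suc (Suc (Suc p))" "Suc p"]
    by (simp add: algebra_simps)
  have 2: "fscale (2 * B x y) ?b \<in> Z (e + d) (Suc p)"
  proof (cases "B x y = 0")
    case True
    then show ?thesis by (simp add: fs.subspace_0[OF Z_subspace])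
  next
    case False
    then have "e + e' = 0" using root_letter_form[OF x(1) y(1)] by blast
    \<comment> \<open>The two lost letters have opposite degrees, so the scalar term keeps the
      degree of the product; its length drops by two and keeps the parity.\<close>
    then have "d - e' = e + d" by simp
    then show ?thesis using w fs.subspace_scale[OF Z_subspace word_Z] by metis
  qed
  have "gen x * (gen y * ?b) - (fscale (- ((-1) ^ (par L x * par L y))) (gen y * (gen x * ?b))
           + fscale (2 * B x y) ?b) \<in> Z (e + d) (Suc p)"
    using CI_clifford[of x y ?b] x(1) y(1) bFS
    by (intro K_Z CI_K) (auto simp: root_letter_S root_letter_homog)
  moreover have "fscale (- ((-1) ^ (par L x * par L y))) (gen y * (gen x * ?b))
           + fscale (2 * B x y) ?b \<in> Z (e + d) (Suc p)"
    by (rule fs.subspace_add[OF Z_subspace fs.subspace_scale[OF Z_subspace 1] 2])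
  ultimately have "gen x * (gen y * ?b) \<in> Z (e + d) (Suc p)"
    using fs.subspace_add[OF Z_subspace] by (metis diff_add_cancel)
  then show ?case by (simp add: basis_vec_Cons)
qed

lemma Z_letter:
  assumes x: "root_letter x e" and "a \<in> Z d p"
  shows "gen x * a \<in> Z (e + d) (Suc p)"
proof (cases "e < 0")
  case False
  then have "e > 0" using x by (simp add: root_letter_def)
  from assms(2) show ?thesis
  proof (induction rule: Z_induct)
    case (K a)
    then show ?case using K_left root_letter_S[OF x] by (intro K_Z) simp
  next
    case (word w)
    then show ?case using Z_letter_pos_word[OF x \<open>e > 0\<close>] by simp
  qed (simp_all add: distrib_left fscale_mult_right fs.subspace_add fs.subspace_scale Z_subspace)
qed (use Z_letter_neg assms in blast)

lemma Z_word:
  assumes "list_all2 root_letter w ds" "a \<in> Z d p"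
  shows "basis_vec w * a \<in> Z (sum_list ds + d) (length w + p)"
  using assms(1)
proof (induction rule: list_all2_induct)
  case Nil
  then show ?case using assms(2) by (simp add: basis_vec_Nil)
next
  case (Cons x w e ds)
  then show ?case using Z_letter[of x e] by (simp add: basis_vec_Cons mult.assoc add.assoc)
qed

lemma one_Z: "1 \<in> Z 0 0"
  using word_Z[of 0 0 "[]"] by (simp add: ubar_word_def basis_vec_Nil)

lemma ubar_word_degree: "ubar_word d p w \<Longrightarrow> w \<noteq> [] \<Longrightarrow> d < 0"
proof -
  have "sum_list ds < 0" if "ds \<noteq> []" "\<forall>e\<in>set ds. e < 0" for ds :: "int list"
    using that by (induction ds rule: list_nonempty_induct) auto
  then show "ubar_word d p w \<Longrightarrow> w \<noteq> [] \<Longrightarrow> d < 0"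
    by (cases w) (auto simp: ubar_word_def list_all2_Cons1)
qed

lemma Z_0_1: "a \<in> Z 0 1 \<Longrightarrow> a \<in> K"
proof (induction rule: Z_induct)
  case (word w)
  then have "w = []" using ubar_word_degree[OF word] by blast
  then show ?case using word by (simp add: ubar_word_def)
qed (simp_all add: fs.subspace_add fs.subspace_scale K_subspace)

lemma vev_Z: "a \<in> Z d p \<Longrightarrow> d \<noteq> 0 \<Longrightarrow> vev a = 0"
proof (induction rule: Z_induct)
  case (word w)
  then obtain x w' where "w = x # w'" by (cases w) (auto simp: ubar_word_def)
  then show ?case using word vev_negative_letter[of x] by (auto simp: ubar_word_def list_all2_Cons1 basis_vec_Cons)
qed (simp_all add: vev_K vev_add vev_scale)

text \<open>Letters of a general word are arbitrary vectors of \<open>S\<close>. Each is expanded in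
  the root basis, which is legitimate modulo Clifford relations, and these lie in every
  \<open>Z d p\<close>.\<close>

lemma FS_span_Z: "a \<in> FS \<Longrightarrow> a \<in> fs.span (\<Union>d p. Z d p)"
proof (induction rule: free_on_induct)
  case (word w)
  then show ?case
  proof (induction w)
    case Nil
    show ?case using one_Z by (intro fs.span_base) (auto simp: basis_vec_Nil)
  next
    case (Cons x w)
    have "basis_vec w \<in> fs.span (\<Union>d p. Z d p)" using Cons by simp
    moreover have gY: "gen (Y i) * a \<in> fs.span (\<Union>d p. Z d p)"
      if "a \<in> fs.span (\<Union>d p. Z d p)" "i \<in> {1..n}" for a i
      using that(1)
    proof (induction rule: fs.span_induct_alt)
      case (step c x y)
      then obtain d p where "x \<in> Z d p" by auto
      then have "gen (Y i) * x \<in> fs.span (\<Union>d p. Z d p)"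
        using Z_letter[OF letter[OF that(2)]] by (intro fs.span_base) blast
      then show ?case using step
        by (simp add: distrib_left fscale_mult_right fs.span_add fs.span_scale)
    qed (simp add: fs.span_zero)
    ultimately have gYw: "gen (Y i) * basis_vec w \<in> fs.span (\<Union>d p. Z d p)" if "i \<in> {1..n}" for i
      using that by blast
    have K_span: "a \<in> fs.span (\<Union>d p. Z d p)" if "a \<in> CI" for a
      using that by (intro fs.span_base) (auto intro: K_Z CI_K)
    have "{x \<in> S. gen x * basis_vec w \<in> fs.span (\<Union>d p. Z d p)} \<supseteq> S"
    proof -
      let ?E = "{x \<in> S. gen x * basis_vec w \<in> fs.span (\<Union>d p. Z d p)}"
      have w: "basis_vec w \<in> FS" using Cons.prems by simp
      have "vs.subspace ?E"
        unfolding vs.subspace_def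
      proof (intro conjI ballI allI)
        show scale: "scal L c x \<in> ?E" if "x \<in> ?E" for c x
          using K_span[OF CI_scale[of x "basis_vec w" c]] that w S_subspace
            fs.span_add[OF _ fs.span_scale[of "gen x * basis_vec w" _ c], of "gen (scal L c x) * basis_vec w - fscale c (gen x * basis_vec w)"]
          by (auto simp: vs.subspace_scale)
        show "x + y \<in> ?E" if "x \<in> ?E" "y \<in> ?E" for x y
          using K_span[OF CI_add[of x y "basis_vec w"]] that w S_subspace
            fs.span_add[OF _ fs.span_add[of "gen x * basis_vec w" _ "gen y * basis_vec w"], of "gen (x + y) * basis_vec w - (gen x * basis_vec w + gen y * basis_vec w)"]
          by (auto simp: vs.subspace_add)
        have "(0::'a) \<in> S" by (simp add: vs.subspace_0 S_subspace)
        then show "0 \<in> ?E"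
          using K_span[OF CI_scale[of 0 "basis_vec w" 0]] w by simp
      qed
      moreover have "Y ` {1..n} \<subseteq> ?E" using gYw hdb_S[OF hdb] by auto
      ultimately have "vs.span (Y ` {1..n}) \<subseteq> ?E" by (intro vs.span_minimal)
      then show ?thesis unfolding hdb_span[OF hdb] .
    qed
    then show ?case using Cons.prems by (auto simp: basis_vec_Cons)
  qed
qed (simp_all add: fs.span_add fs.span_scale)

text \<open>Multiplication by an element of degree \<open>0\<close> and odd word length, up to Clifford relations.\<close>

definition neutral_odd :: "'a free_alg \<Rightarrow> bool" where
  "neutral_odd a \<longleftrightarrow> a \<in> FS \<and> (\<forall>d p. \<forall>z\<in>Z d p. a * z \<in> Z d (Suc p))"

lemma neutral_odd_K: "neutral_odd a \<Longrightarrow> a \<in> K"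
proof -
  assume "neutral_odd a"
  then have "a * 1 \<in> Z 0 (Suc 0)" using one_Z unfolding neutral_odd_def by blast
  then show "a \<in> K" using Z_0_1[of a] by simp
qed

text \<open>It is enough to treat \<open>b\<close> in some \<open>Z d p\<close>. For nonzero
  \<open>d\<close> the product has nonzero degree. For \<open>d = 0\<close> either the product or,
  when \<open>p\<close> is odd, \<open>b\<close> itself has degree 0 and odd parity and hence lies
  in \<open>K\<close>.\<close>

lemma neutral_odd_vev:
  assumes a: "neutral_odd a" and b: "b \<in> FS" shows "vev (a * b) = 0"
proof -
  have *: "vev (a * z) = 0" if z: "z \<in> Z d p" for z d p
  proof (cases "d = 0")
    case False
    have "a * z \<in> Z d (Suc p)" using a z by (simp add: neutral_odd_def)
    then show ?thesis using vev_Z False by blast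
  next
    case d: True
    show ?thesis
    proof (cases "even p")
      case True
      then have "Suc p mod 2 = 1 mod 2" by presburger
      moreover have "a * z \<in> Z d (Suc p)" using a z by (simp add: neutral_odd_def)
      ultimately have "a * z \<in> Z 0 1" using d Z_parity by blast
      then show ?thesis by (intro vev_K Z_0_1)
    next
      case False
      then have "z \<in> Z 0 1" using z d Z_parity[of p 1] by (auto simp: odd_iff_mod_2_eq_one)
      then have "a * z \<in> K" using a by (intro K_left Z_0_1) (auto simp: neutral_odd_def)
      then show ?thesis by (rule vev_K)
    qed
  qed
  from FS_span_Z[OF b] show ?thesis
  proof (induction rule: fs.span_induct_alt)
    case base
    show ?case using vev_scale[of 0 0] by simp
  next
    case (step c x y)
    then show ?case using * by (auto simp: distrib_left fscale_mult_right vev_add vev_scale)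
  qed
qed

end

section \<open>The cubic term\<close>

definition lin_on :: "(complex \<Rightarrow> 'v \<Rightarrow> 'v) \<Rightarrow> 'v set \<Rightarrow> ('v::ab_group_add \<Rightarrow> complex) \<Rightarrow> bool" where
  "lin_on sc S u \<longleftrightarrow> (\<forall>x\<in>S. \<forall>y\<in>S. u (x + y) = u x + u y) \<and> (\<forall>c. \<forall>x\<in>S. u (sc c x) = c * u x)"

lemma lin_on_scale: "lin_on sc S u \<Longrightarrow> lin_on sc S (\<lambda>x. c * u x)"
  by (simp add: lin_on_def algebra_simps)

lemma lin_on_sum: "(\<And>i. i \<in> I \<Longrightarrow> lin_on sc S (u i)) \<Longrightarrow> lin_on sc S (\<lambda>x. \<Sum>i\<in>I. u i x)"
  by (simp add: lin_on_def sum.distrib sum_distrib_left)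

lemma bilin_on_prod: "lin_on sc S u \<Longrightarrow> lin_on sc S v \<Longrightarrow> bilin_on sc S (\<lambda>x y. u x * v y)"
  by (simp add: lin_on_def bilin_on_def algebra_simps)

lemma bilin_on_sum_fun:
  "(\<And>i. i \<in> I \<Longrightarrow> bilin_on sc S (b i)) \<Longrightarrow> bilin_on sc S (\<lambda>x y. \<Sum>i\<in>I. b i x y)"
  by (simp add: bilin_on_def sum.distrib sum_distrib_left)

lemma distinct_below_3:
  fixes a b c :: nat
  assumes "a < 3" "b < 3" "c < 3" "a \<noteq> b" "a \<noteq> c" "b \<noteq> c"
  shows "a = 0 \<and> b = 1 \<and> c = 2 \<or>
      a = 0 \<and> b = 2 \<and> c = 1 \<or>
      a = 1 \<and> b = 0 \<and> c = 2 \<or>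
      a = 1 \<and> b = 2 \<and> c = 0 \<or>
      a = 2 \<and> b = 0 \<and> c = 1 \<or>
      a = 2 \<and> b = 1 \<and> c = 0"
  using assms by (auto simp: numeral_eq_Suc less_Suc_eq)

lemma permutes_3_cases:
  assumes "\<sigma> permutes {..<3::nat}"
  obtains "\<sigma> 0 = 0" "\<sigma> 1 = 1" "\<sigma> 2 = 2"
    | "\<sigma> 0 = 0" "\<sigma> 1 = 2" "\<sigma> 2 = 1"
    | "\<sigma> 0 = 1" "\<sigma> 1 = 0" "\<sigma> 2 = 2"
    | "\<sigma> 0 = 1" "\<sigma> 1 = 2" "\<sigma> 2 = 0"
    | "\<sigma> 0 = 2" "\<sigma> 1 = 0" "\<sigma> 2 = 1"
    | "\<sigma> 0 = 2" "\<sigma> 1 = 1" "\<sigma> 2 = 0"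
proof -
  have 1: "\<sigma> 0 < 3" "\<sigma> 1 < 3" "\<sigma> 2 < 3"
    using permutes_in_image[OF assms, of 0] permutes_in_image[OF assms, of 1]
      permutes_in_image[OF assms, of 2] by auto
  have 2: "\<sigma> 0 \<noteq> \<sigma> 1" "\<sigma> 0 \<noteq> \<sigma> 2" "\<sigma> 1 \<noteq> \<sigma> 2"
    using permutes_inj[OF assms] by (simp_all add: inj_eq)
  show thesis
    using distinct_below_3[OF 1 2] by (elim disjE conjE) (erule (2) that)+
qed

definition perm_word :: "(nat \<Rightarrow> nat) \<Rightarrow> 'g \<Rightarrow> 'g \<Rightarrow> 'g \<Rightarrow> 'g list" where
  "perm_word \<sigma> x y z = map (\<lambda>i. [x, y, z] ! \<sigma> i) [0..<3]"

lemma perm_word_eq: "perm_word \<sigma> x y z = [[x, y, z] ! \<sigma> 0, [x, y, z] ! \<sigma> 1, [x, y, z] ! \<sigma> 2]"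
  by (simp add: perm_word_def numeral_3_eq_3 numeral_2_eq_2 upt_rec)

text \<open>The sign of \<open>quantize\<close> as a function of the parities alone. With parities
  held fixed a quantized product is linear in each vector modulo Clifford relations, while
  \<open>par\<close> is not additive.\<close>

definition parity_sign :: "nat list \<Rightarrow> (nat \<Rightarrow> nat) \<Rightarrow> complex" where
  "parity_sign ps \<sigma> = (\<Prod>(i, j)\<in>{(i, j). i < j \<and> j < length ps \<and> \<sigma> j < \<sigma> i}.
     - ((-1) ^ (ps ! \<sigma> i * ps ! \<sigma> j)))"

lemma super_sign_parity:
  assumes "\<sigma> permutes {..<length vs}"
  shows "super_sign L vs \<sigma> = parity_sign (map (par L) vs) \<sigma>"
proof -
  have "\<sigma> i < length vs" if "i < length vs" for i
    using permutes_in_image[OF assms, of i] that by simp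
  then show ?thesis
    unfolding super_sign_def parity_sign_def by (intro prod.cong) auto
qed

lemma quantize_perm_word:
  "quantize L [x, y, w] = (\<Sum>\<sigma> | \<sigma> permutes {..<3}.
     fscale (parity_sign [par L x, par L y, par L w] \<sigma> / 6) (basis_vec (perm_word \<sigma> x y w)))"
proof -
  have l: "length [x, y, w] = 3" by simp
  have f: "fact 3 = (6 :: complex)" by (simp add: fact_numeral)
  show ?thesis
    unfolding quantize_def l f perm_word_def
    by (intro sum.cong refl) (simp add: super_sign_parity[where vs = "[x, y, w]", unfolded l])
qed

context root_setting
begin

context
  fixes \<psi> :: "'g free_alg \<Rightarrow> complex" and z :: "'g free_alg"
  assumes \<psi>: "Vector_Spaces.linear fscale (*) \<psi>" and \<psi>_CI: "\<And>a. a \<in> CI \<Longrightarrow> \<psi> a = 0"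
    and z: "z \<in> FS"
begin

lemma \<psi>_add: "\<psi> (a + b) = \<psi> a + \<psi> b" and \<psi>_scale: "\<psi> (fscale c a) = c * \<psi> a"
  using \<psi> by (simp_all add: Vector_Spaces.linear_iff)

lemma \<psi>_sum: "\<psi> (\<Sum>i\<in>I. g i) = (\<Sum>i\<in>I. \<psi> (g i))"
proof -
  have "\<psi> 0 = 0" using \<psi>_scale[of 0 0] by simp
  then show ?thesis by (induction I rule: infinite_finite_induct) (simp_all add: \<psi>_add)
qed

text \<open>In the free algebra the letters of a word do not depend linearly on vectors; they do
  modulo \<open>CI\<close>, which \<psi> kills.\<close>

lemma word_letter_linear:
  assumes "set l \<subseteq> S" "set r \<subseteq> S"
  shows "lin_on (scal L) S (\<lambda>a. \<psi> (basis_vec (l @ a # r) * z))"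
proof -
  let ?l = "basis_vec l :: 'g free_alg" and ?r = "basis_vec r * z"
  have l: "?l \<in> FS" and r: "?r \<in> FS" using assms z by (auto intro: free_on_mult)
  have e: "basis_vec (l @ a # r) * z = ?l * (gen a * ?r)" for a
    by (simp add: gen_def basis_vec_mult mult.assoc[symmetric])
  have "\<psi> (?l * (gen (x + y) * ?r)) = \<psi> (?l * (gen x * ?r)) + \<psi> (?l * (gen y * ?r))"
    if "x \<in> S" "y \<in> S" for x y
  proof -
    define d where "d = ?l * (gen (x + y) * ?r - (gen x * ?r + gen y * ?r))"
    have "d \<in> CI" unfolding d_def by (rule CI_left[OF CI_add[OF that r] l])
    moreover have "?l * (gen (x + y) * ?r) = d + (?l * (gen x * ?r) + ?l * (gen y * ?r))"
      unfolding d_def by (simp add: algebra_simps)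
    ultimately show ?thesis by (simp only: \<psi>_add \<psi>_CI add_0_left)
  qed
  moreover have "\<psi> (?l * (gen (scal L c x) * ?r)) = c * \<psi> (?l * (gen x * ?r))" if "x \<in> S" for c x
  proof -
    define d where "d = ?l * (gen (scal L c x) * ?r - fscale c (gen x * ?r))"
    have "d \<in> CI" unfolding d_def by (rule CI_left[OF CI_scale[OF that r] l])
    moreover have "?l * (gen (scal L c x) * ?r) = d + fscale c (?l * (gen x * ?r))"
      unfolding d_def by (simp add: algebra_simps fscale_mult_right)
    ultimately show ?thesis by (simp only: \<psi>_add \<psi>_scale \<psi>_CI add_0_left)
  qed
  ultimately show ?thesis unfolding lin_on_def e by blast
qed

definition quant3 :: "nat \<Rightarrow> nat \<Rightarrow> nat \<Rightarrow> 'g \<Rightarrow> 'g \<Rightarrow> 'g \<Rightarrow> complex" where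
  "quant3 p q r x y w =
    (\<Sum>\<sigma> | \<sigma> permutes {..<3}. parity_sign [p, q, r] \<sigma> / 6 * \<psi> (basis_vec (perm_word \<sigma> x y w) * z))"

lemma quantize_quant3: "\<psi> (quantize L [x, y, w] * z) = quant3 (par L x) (par L y) (par L w) x y w"
  unfolding quantize_perm_word quant3_def sum_distrib_right fscale_mult_left \<psi>_sum \<psi>_scale ..

lemma quant3_linear:
  assumes "x \<in> S" "y \<in> S"
  shows "lin_on (scal L) S (\<lambda>a. quant3 p q r a x y)" "lin_on (scal L) S (\<lambda>a. quant3 p q r x a y)"
    "lin_on (scal L) S (\<lambda>a. quant3 p q r x y a)"
proof -
  note w = word_letter_linear[of "[]" "[x, y]"] word_letter_linear[of "[x]" "[y]"] 
    word_letter_linear[of "[x, y]" "[]"] word_letter_linear[of "[]" "[y, x]"]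
    word_letter_linear[of "[y]" "[x]"] word_letter_linear[of "[y, x]" "[]"]
  note w = w[simplified]
  have "lin_on (scal L) S (\<lambda>a. \<psi> (basis_vec (perm_word \<sigma> a x y) * z)) \<and>
      lin_on (scal L) S (\<lambda>a. \<psi> (basis_vec (perm_word \<sigma> x a y) * z)) \<and>
      lin_on (scal L) S (\<lambda>a. \<psi> (basis_vec (perm_word \<sigma> x y a) * z))" if "\<sigma> permutes {..<3}" for \<sigma>
    using that by (cases rule: permutes_3_cases) (simp_all add: perm_word_eq w assms)
  then show "lin_on (scal L) S (\<lambda>a. quant3 p q r a x y)" "lin_on (scal L) S (\<lambda>a. quant3 p q r x a y)"
    "lin_on (scal L) S (\<lambda>a. quant3 p q r x y a)"
    unfolding quant3_def by (intro lin_on_sum lin_on_scale; auto)+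
qed

text \<open>Each of the three summation slots has its own pair of dual bases, so that they can be
  exchanged one at a time by \<open>hdb_change_basis\<close>.\<close>

definition cubic_sum where
  "cubic_sum N X Xd N' X' Xd' N'' X'' Xd'' =
    (\<Sum>i=1..N. \<Sum>j=1..N'. \<Sum>k=1..N''.
      ((-1) ^ (par L (X i) * par L (X' j) + par L (X'' k)) * B (br L (X i) (X' j)) (X'' k)) *
        quant3 (par L (X i)) (par L (X' j)) (par L (X'' k)) (Xd i) (Xd' j) (Xd'' k))"

lemma cubic_term_sum:
  assumes "homogeneous_dual_bases L B S N X Xd"
  shows "\<psi> (cubic_term L B N X Xd * z) = - 1 / 12 * cubic_sum N X Xd N X Xd N X Xd"
  unfolding cubic_term_def cubic_sum_def fscale_mult_left sum_distrib_right \<psi>_scale \<psi>_sum quantize_quant3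
  by (intro arg_cong2[where f = times] sum.cong refl) (simp only: hdb_dual_parity[OF assms])

lemma cubic_sum_change:
  assumes X: "homogeneous_dual_bases L B S N X Xd" and Y: "homogeneous_dual_bases L B S n Y Yd"
  shows "cubic_sum N X Xd N X Xd N X Xd = cubic_sum n Y Yd n Y Yd n Y Yd"
proof -
  have lin1: "lin_on (scal L) S (\<lambda>x. c * B (br L x y) w)" if "y \<in> car L" "w \<in> car L" for c y w
    using that by (simp add: lin_on_def S_car br_add_left br_scale_left form_add_left 
        form_scale_left br_car algebra_simps)
  have lin2: "lin_on (scal L) S (\<lambda>x. c * B (br L y x) w)" if "y \<in> car L" "w \<in> car L" for c y w
    using that by (simp add: lin_on_def S_car br_add_right br_scale_right form_add_left 
        form_scale_left br_car algebra_simps)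
  have lin3: "lin_on (scal L) S (\<lambda>x. c * B y x)" if "y \<in> car L" for c y
    using that by (simp add: lin_on_def S_car form_add_right form_scale_right algebra_simps)
  note [simp] = hdb_car[OF X] hdb_car[OF Y] hdb_dual_S[OF X] hdb_dual_S[OF Y] br_car
  have "cubic_sum N X Xd N X Xd N X Xd = cubic_sum n Y Yd N X Xd N X Xd"
    unfolding cubic_sum_def
    by (rule hdb_change_basis[OF X Y, where b = "\<lambda>p x y. \<Sum>j=1..N. \<Sum>k=1..N.
      ((-1) ^ (p * par L (X j) + par L (X k)) * B (br L x (X j)) (X k)) *
        quant3 p (par L (X j)) (par L (X k)) y (Xd j) (Xd k)"])
      (intro bilin_on_sum_fun bilin_on_prod lin1 quant3_linear; simp)
  also have "\<dots> = cubic_sum n Y Yd n Y Yd N X Xd"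
    unfolding cubic_sum_def
  proof (rule sum.cong[OF refl])
    fix i assume i: "i \<in> {1..n}"
    show "(\<Sum>j=1..N. \<Sum>k=1..N.
        ((-1) ^ (par L (Y i) * par L (X j) + par L (X k)) * B (br L (Y i) (X j)) (X k)) *
        quant3 (par L (Y i)) (par L (X j)) (par L (X k)) (Yd i) (Xd j) (Xd k)) =
      (\<Sum>j=1..n. \<Sum>k=1..N.
        ((-1) ^ (par L (Y i) * par L (Y j) + par L (X k)) * B (br L (Y i) (Y j)) (X k)) *
        quant3 (par L (Y i)) (par L (Y j)) (par L (X k)) (Yd i) (Yd j) (Xd k))"
      by (rule hdb_change_basis[OF X Y, where b = "\<lambda>p x y. \<Sum>k=1..N.
        ((-1) ^ (par L (Y i) * p + par L (X k)) * B (br L (Y i) x) (X k)) *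
        quant3 (par L (Y i)) p (par L (X k)) (Yd i) y (Xd k)"])
        (use i in \<open>intro bilin_on_sum_fun bilin_on_prod lin2 quant3_linear; simp\<close>)
  qed
  also have "\<dots> = cubic_sum n Y Yd n Y Yd n Y Yd"
    unfolding cubic_sum_def
  proof (rule sum.cong[OF refl], rule sum.cong[OF refl])
    fix i j assume i: "i \<in> {1..n}" and j: "j \<in> {1..n}"
    show "(\<Sum>k=1..N.
        ((-1) ^ (par L (Y i) * par L (Y j) + par L (X k)) * B (br L (Y i) (Y j)) (X k)) *
        quant3 (par L (Y i)) (par L (Y j)) (par L (X k)) (Yd i) (Yd j) (Xd k)) =
      (\<Sum>k=1..n.
        ((-1) ^ (par L (Y i) * par L (Y j) + par L (Y k)) * B (br L (Y i) (Y j)) (Y k)) *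
        quant3 (par L (Y i)) (par L (Y j)) (par L (Y k)) (Yd i) (Yd j) (Yd k))"
      by (rule hdb_change_basis[OF X Y, where b = "\<lambda>p x y.
        ((-1) ^ (par L (Y i) * par L (Y j) + p) * B (br L (Y i) (Y j)) x) *
        quant3 (par L (Y i)) (par L (Y j)) p (Yd i) (Yd j) y"])
        (use i j in \<open>intro bilin_on_prod lin3 quant3_linear; simp\<close>)
  qed
  finally show ?thesis .
qed

end

text \<open>The right factor \<open>z\<close> serves two purposes: \<open>z = 1\<close> compares the
  actions on the vacuum, and a general \<open>z\<close> compares vacuum expectation values of
  products.\<close>

lemma cubic_term_change:
  assumes "homogeneous_dual_bases L B S N X Xd" "homogeneous_dual_bases L B S n Y Yd" "z \<in> FS"
  shows "cubic_term L B N X Xd * z - cubic_term L B n Y Yd * z \<in> CI"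
proof (rule subspace_mem_by_functionals[OF fs.vector_space_axioms CI_subspace])
  fix \<psi> :: "'g free_alg \<Rightarrow> complex"
  assume \<psi>: "Vector_Spaces.linear fscale (*) \<psi>" "\<And>x. x \<in> CI \<Longrightarrow> \<psi> x = 0"
  have "cubic_term L B N X Xd * z - cubic_term L B n Y Yd * z =
      cubic_term L B N X Xd * z + fscale (-1) (cubic_term L B n Y Yd * z)" by simp
  then show "\<psi> (cubic_term L B N X Xd * z - cubic_term L B n Y Yd * z) = 0"
    using cubic_term_sum[OF \<psi> assms(3)] cubic_sum_change[OF \<psi> assms(3) assms(1,2)] assms(1,2)
    by (simp only: \<psi>_add[OF \<psi> assms(3)] \<psi>_scale[OF \<psi> assms(3)]) simp
qed

lemma quantize_FS:
  assumes "x \<in> S" "y \<in> S" "w \<in> S" shows "quantize L [x, y, w] \<in> FS"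
proof -
  have "fscale c (basis_vec (perm_word \<sigma> x y w)) \<in> FS" if "\<sigma> permutes {..<3}" for \<sigma> c
  proof -
    have "basis_vec (perm_word \<sigma> x y w) \<in> FS"
      using that assms by (cases rule: permutes_3_cases) (simp_all add: perm_word_eq)
    then show ?thesis by (rule fs.subspace_scale[OF free_on_subspace])
  qed
  then show ?thesis
    unfolding quantize_perm_word
    by (intro fs.subspace_sum[OF free_on_subspace]) blast
qed

lemma cubic_term_FS:
  assumes X: "homogeneous_dual_bases L B S N X Xd" shows "cubic_term L B N X Xd \<in> FS"
  unfolding cubic_term_def
  by (intro fs.subspace_scale[OF free_on_subspace] fs.subspace_sum[OF free_on_subspace] quantize_FS)
    (use hdb_dual_S[OF X] in auto)

end

context root_basis
begin

text \<open>A nonzero coefficient forces the degrees of the three letters, hence of their duals, to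
  sum to zero, and this is unaffected by the permutations of the quantization.\<close>

lemma cubic_term_neutral_odd: "neutral_odd (cubic_term L B n Y Yd)"
  unfolding neutral_odd_def
proof (intro conjI allI ballI)
  show "cubic_term L B n Y Yd \<in> FS" by (rule cubic_term_FS[OF hdb])
  fix d p z assume z: "z \<in> Z d p"
  have summand: "fscale (c * B (br L (Y i) (Y j)) (Y k)) (quantize L [Yd i, Yd j, Yd k] * z) \<in> Z d (Suc p)"
    if i: "i \<in> {1..n}" and j: "j \<in> {1..n}" and k: "k \<in> {1..n}" for i j k c
  proof (cases "B (br L (Y i) (Y j)) (Y k) = 0")
    case True
    then show ?thesis by (simp add: fs.subspace_0[OF Z_subspace])
  next
    case False
    have deg: "deg i + deg j + deg k = 0"
      using root_letter_triple[OF letter[OF i] letter[OF j] letter[OF k] False] .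
    have "basis_vec (perm_word \<sigma> (Yd i) (Yd j) (Yd k)) * z \<in> Z d (Suc p)" if \<sigma>: "\<sigma> permutes {..<3}" for \<sigma>
    proof -
      have "list_all2 root_letter (perm_word \<sigma> (Yd i) (Yd j) (Yd k))
          (perm_word \<sigma> (- deg i) (- deg j) (- deg k)) \<and>
        sum_list (perm_word \<sigma> (- deg i) (- deg j) (- deg k)) = 0"
        using \<sigma> deg dual_letter[OF i] dual_letter[OF j] dual_letter[OF k]
        by (cases rule: permutes_3_cases) (simp_all add: perm_word_eq)
      note * = conjunct1[OF this] conjunct2[OF this]
      \<comment> \<open>Multiplying by three letters or by one shifts the length parity
        alike.\<close>
      have "Z d (length (perm_word \<sigma> (Yd i) (Yd j) (Yd k)) + p) = Z d (Suc p)"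
        by (rule Z_parity) (simp add: perm_word_eq)
      then show ?thesis using Z_word[OF *(1) z] by (simp only: *(2) add_0)
    qed
    then have "quantize L [Yd i, Yd j, Yd k] * z \<in> Z d (Suc p)"
      unfolding quantize_perm_word sum_distrib_right fscale_mult_left
      by (intro fs.subspace_sum[OF Z_subspace] fs.subspace_scale[OF Z_subspace]) simp
    then show ?thesis by (rule fs.subspace_scale[OF Z_subspace])
  qed
  then show "cubic_term L B n Y Yd * z \<in> Z d (Suc p)"
    unfolding cubic_term_def fscale_mult_left sum_distrib_right
    by - (rule fs.subspace_scale[OF Z_subspace], intro fs.subspace_sum[OF Z_subspace] summand)
qed

lemma cubic_term_K:
  assumes "homogeneous_dual_bases L B S N X Xd" shows "cubic_term L B N X Xd \<in> K"
proof -
  have "cubic_term L B N X Xd - cubic_term L B n Y Yd \<in> K"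
    using cubic_term_change[OF assms hdb one_in_free_on] CI_K by simp
  from fs.subspace_add[OF K_subspace this neutral_odd_K[OF cubic_term_neutral_odd]]
  show ?thesis by simp
qed

lemma cubic_term_vev:
  assumes "homogeneous_dual_bases L B S N X Xd" "a \<in> FS"
  shows "vev (cubic_term L B N X Xd * a) = 0"
proof -
  have "vev (cubic_term L B N X Xd * a - cubic_term L B n Y Yd * a) = 0"
    using cubic_term_change[OF assms(1) hdb assms(2)] CI_K vev_K by blast
  then show ?thesis
    using neutral_odd_vev[OF cubic_term_neutral_odd assms(2)]
      vev_add[of "cubic_term L B N X Xd * a - cubic_term L B n Y Yd * a" "cubic_term L B n Y Yd * a"]
    by simp
qed

end

section \<open>Weights of a highest weight supermodule\<close>

locale module_setting = root_setting L B h f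
  for L :: "'g::ab_group_add lsa" and B h f +
  fixes M :: "('g, 'm::ab_group_add) supermod"
  assumes smod: "supermodule L M"
begin

sublocale ms: vector_space "m_scal M"
  using smod by (simp add: supermodule_def)

lemmas module_conjs = smod[unfolded supermodule_def, THEN conjunct2]
lemmas m_ev_subspace = module_conjs[THEN conjunct1, rule_format]
lemmas module_conjs1 = module_conjs[THEN conjunct2]
lemmas m_od_subspace = module_conjs1[THEN conjunct1, rule_format]
lemmas module_conjs2 = module_conjs1[THEN conjunct2]
lemmas m_ev_od = module_conjs2[THEN conjunct1, rule_format]
lemmas module_conjs3 = module_conjs2[THEN conjunct2]
lemmas m_decomp = module_conjs3[THEN conjunct1, rule_format]
lemmas module_conjs4 = module_conjs3[THEN conjunct2]
lemmas act_add_left = module_conjs4[THEN conjunct1, rule_format]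
lemmas module_conjs5 = module_conjs4[THEN conjunct2]
lemmas act_scale_left = module_conjs5[THEN conjunct1, rule_format]
lemmas module_conjs6 = module_conjs5[THEN conjunct2]
lemmas act_add_right = module_conjs6[THEN conjunct1, rule_format]
lemmas module_conjs7 = module_conjs6[THEN conjunct2]
lemmas act_scale_right = module_conjs7[THEN conjunct1, rule_format]
lemmas module_conjs8 = module_conjs7[THEN conjunct2]
lemmas act_even_even = module_conjs8[THEN conjunct1, rule_format]
lemmas module_conjs9 = module_conjs8[THEN conjunct2]
lemmas act_even_odd = module_conjs9[THEN conjunct1, rule_format]
lemmas module_conjs10 = module_conjs9[THEN conjunct2]
lemmas act_odd_even = module_conjs10[THEN conjunct1, rule_format]
lemmas module_conjs11 = module_conjs10[THEN conjunct2]
lemmas act_odd_odd = module_conjs11[THEN conjunct1, rule_format]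
lemmas module_conjs12 = module_conjs11[THEN conjunct2]
lemmas act_br = module_conjs12[rule_format]

lemma act_zero_right [simp]: "x \<in> car L \<Longrightarrow> act M x 0 = 0"
  using act_scale_right[of x 0 0] by simp

lemma act_zero_left [simp]: "act M 0 m = 0"
  using act_scale_left[of 0 0 m] vs.subspace_0[OF subspace_car] by simp

lemma act_diff_right: "x \<in> car L \<Longrightarrow> act M x (m - m') = act M x m - act M x m'"
  using act_add_right[of x "m - m'" m'] by simp

lemma m_unique:
  assumes "x \<in> m_ev M" "y \<in> m_od M" "x' \<in> m_ev M" "y' \<in> m_od M" "x + y = x' + y'"
  shows "x = x'" "y = y'"
proof -
  have "x - x' = y' - y" using assms(5) by (simp add: algebra_simps)
  moreover have "x - x' \<in> m_ev M" "y' - y \<in> m_od M"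
    using assms by (simp_all add: ms.subspace_diff m_ev_subspace m_od_subspace)
  ultimately have "x - x' \<in> m_ev M \<inter> m_od M" by auto
  then have "x - x' = 0" using m_ev_od by auto
  then show "x = x'" "y = y'" using assms(5) by auto
qed

lemma parity_op_sum: "x \<in> m_ev M \<Longrightarrow> y \<in> m_od M \<Longrightarrow> parity_op M (x + y) = x - y"
  unfolding parity_op_def by (rule the_equality) (use m_unique in blast)+

lemma parity_op_add: "parity_op M (m + m') = parity_op M m + parity_op M m'"
proof -
  obtain x y x' y' where *: "x \<in> m_ev M" "y \<in> m_od M" "m = x + y"
    "x' \<in> m_ev M" "y' \<in> m_od M" "m' = x' + y'" using m_decomp by meson
  have "parity_op M ((x + x') + (y + y')) = (x + x') - (y + y')"
    using * by (intro parity_op_sum ms.subspace_add m_ev_subspace m_od_subspace)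
  moreover have "m + m' = (x + x') + (y + y')" using * by simp
  moreover have "parity_op M m = x - y" "parity_op M m' = x' - y'" using * parity_op_sum by auto
  ultimately show ?thesis by (simp only:) (simp add: algebra_simps)
qed

lemma parity_op_scale: "parity_op M (m_scal M c m) = m_scal M c (parity_op M m)"
proof -
  obtain x y where *: "x \<in> m_ev M" "y \<in> m_od M" "m = x + y" using m_decomp by meson
  have "parity_op M (m_scal M c x + m_scal M c y) = m_scal M c x - m_scal M c y"
    using * by (intro parity_op_sum ms.subspace_scale m_ev_subspace m_od_subspace)
  then show ?thesis using * parity_op_sum by (simp add: ms.scale_right_distrib ms.scale_right_diff_distrib)
qed

lemma parity_pow_add: "(parity_op M ^^ k) (m + m') = (parity_op M ^^ k) m + (parity_op M ^^ k) m'"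
  by (induction k) (simp_all add: parity_op_add)

lemma parity_pow_scale: "(parity_op M ^^ k) (m_scal M c m) = m_scal M c ((parity_op M ^^ k) m)"
  by (induction k) (simp_all add: parity_op_scale)

text \<open>A homogeneous \<open>x\<close> sends even and odd components to different parities, so
  killing \<open>m\<close> means killing both. This covers inhomogeneous highest weight
  vectors.\<close>

lemma act_parity_pow_zero:
  assumes x: "x \<in> homog L" and "act M x m = 0"
  shows "act M x ((parity_op M ^^ k) m) = 0"
proof (induction k)
  case (Suc k)
  let ?m = "(parity_op M ^^ k) m"
  obtain a b where *: "a \<in> m_ev M" "b \<in> m_od M" "?m = a + b" using m_decomp by meson
  have 0: "0 \<in> m_ev M" "0 \<in> m_od M"
    by (simp_all add: ms.subspace_0 m_ev_subspace m_od_subspace)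
  have xc: "x \<in> car L" using x by (rule homog_car)
  have s: "act M x a + act M x b = 0" using Suc * xc by (simp add: act_add_right)
  have "act M x a = 0 \<and> act M x b = 0"
  proof (cases "x \<in> ev L")
    case True
    then show ?thesis using m_unique[of "act M x a" "act M x b" 0 0] s 0 * act_even_even act_even_odd by simp
  next
    case False
    then have "x \<in> od L" using x by (simp add: homog_def)
    then show ?thesis using m_unique[of "act M x b" "act M x a" 0 0] s 0 * act_odd_even act_odd_odd
      by (simp add: add.commute)
  qed
  then show ?case using parity_op_sum[OF *(1,2)] *(3) xc by (simp add: act_diff_right)
qed (use assms in simp)

section \<open>Weights below the highest weight, measured by \<open>f\<close>\<close>

definition weight_space :: "('g \<Rightarrow> complex) \<Rightarrow> 'm set" where
  "weight_space \<mu> = {m. \<forall>H\<in>h. act M H m = m_scal M (\<mu> H) m}"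

lemma weight_space_subspace: "ms.subspace (weight_space \<mu>)"
  by (auto simp: weight_space_def ms.subspace_def h_car act_add_right act_scale_right
      ms.scale_right_distrib mult.commute)

lemma act_weight_space:
  assumes x: "x \<in> root_space L h a" "x \<in> homog L" and m: "m \<in> weight_space \<mu>"
  shows "act M x m \<in> weight_space (a + \<mu>)"
proof -
  have "act M H (act M x m) = m_scal M ((a + \<mu>) H) (act M x m)" if H: "H \<in> h" for H
  proof -
    have "act M (br L H x) m = act M H (act M x m) - act M x (act M H m)"
      using act_br[of H x m] x(2) H by (simp add: h_ev ev_homog)
    moreover have "act M (br L H x) m = m_scal M (a H) (act M x m)"
      using x H by (simp add: root_space_def act_scale_left)
    moreover have "act M x (act M H m) = m_scal M (\<mu> H) (act M x m)"
      using m H x by (simp add: weight_space_def act_scale_right homog_car)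
    ultimately show ?thesis by (simp add: ms.scale_left_distrib algebra_simps)
  qed
  then show ?thesis by (simp add: weight_space_def)
qed

context
  fixes P :: "('g \<Rightarrow> complex) set" and \<Lambda> :: "'g \<Rightarrow> complex" and v :: 'm
  assumes pos: "{a \<in> roots L h. f a > 0} \<subseteq> P"
    and v_pos: "\<And>x. x \<in> nplus L h P \<Longrightarrow> act M x v = 0"
    and v_weight: "\<And>H. H \<in> h \<Longrightarrow> act M H v = m_scal M (\<Lambda> H) v"
    and v_gen: "cyclic_submodule L M v = UNIV" and v_nz: "v \<noteq> 0"
begin

lemma v_annihilated: "root_letter x d \<Longrightarrow> d > 0 \<Longrightarrow> act M x v = 0"
  using pos unfolding root_letter_def nplus_def[abs_def]
  by (intro v_pos) (auto simp: nplus_def intro!: vs.span_base)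

text \<open>The dividing line is \<open>f\<close> and not the positive system: all weight vectors of
  the Levi part are included, those of positive roots of degree 0 too.\<close>

definition lowering :: "'g set" where
  "lowering = {x \<in> homog L. \<exists>a\<in>insert 0 (roots L h). x \<in> root_space L h a \<and> f a \<le> 0}"

definition lowering_span :: "'m set" where
  "lowering_span = ms.span {foldr (act M) xs v | xs. set xs \<subseteq> lowering}"

lemma lowering_car: "x \<in> lowering \<Longrightarrow> x \<in> car L"
  by (simp add: lowering_def homog_car)

lemma lowering_span_act:
  assumes "x \<in> lowering" "m \<in> lowering_span" shows "act M x m \<in> lowering_span"
  using assms(2) unfolding lowering_span_def
proof (induction rule: ms.span_induct_alt)
  case base
  show ?case using assms(1) by (simp add: lowering_car ms.span_zero)
next
  case (step c g m)
  then obtain xs where "g = foldr (act M) xs v" "set xs \<subseteq> lowering" by auto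
  then have "act M x g \<in> {foldr (act M) xs v | xs. set xs \<subseteq> lowering}"
    using assms(1) by (intro CollectI exI[of _ "x # xs"]) simp
  then show ?case
    using step.IH assms(1)
    by (simp add: lowering_car act_add_right act_scale_right ms.span_add ms.span_scale ms.span_base)
qed

lemma car_homog_span: "car L = vs.span (\<Union>a\<in>insert 0 (roots L h). root_space L h a \<inter> homog L)"
  by (rule trans[OF root_space_decomposition[symmetric] span_homog_root_spaces])

lemma car_linear_induct:
  assumes "x \<in> car L" and "ms.subspace W"
    and "\<And>x a. a \<in> insert 0 (roots L h) \<Longrightarrow> x \<in> root_space L h a \<Longrightarrow> x \<in> homog L \<Longrightarrow> act M x m \<in> W"
  shows "act M x m \<in> W"
proof -
  have "vs.subspace {x \<in> car L. act M x m \<in> W}"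
    using assms(2) subspace_car
    by (auto simp: vs.subspace_def act_add_left act_scale_left ms.subspace_def)
  moreover have "(\<Union>a\<in>insert 0 (roots L h). root_space L h a \<inter> homog L) \<subseteq> {x \<in> car L. act M x m \<in> W}"
    using assms(3) homog_car by blast
  ultimately have "car L \<subseteq> {x \<in> car L. act M x m \<in> W}"
    by (subst car_homog_span) (rule vs.span_minimal)
  then show ?thesis using assms(1) by blast
qed

lemma lowering_span_subspace: "ms.subspace lowering_span"
  by (simp add: lowering_span_def)

lemma lowering_word: "set xs \<subseteq> lowering \<Longrightarrow> foldr (act M) xs v \<in> lowering_span"
  unfolding lowering_span_def by (rule ms.span_base) blast

text \<open>As in the easy half of a PBW argument, \<open>x\<close> is moved to the right until it
  meets \<open>v\<close>. The commutator with a letter can be any vector, so the induction speaks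
  about all of \<open>car L\<close>.\<close>

lemma act_lowering_word:
  "set xs \<subseteq> lowering \<Longrightarrow> x \<in> car L \<Longrightarrow> act M x (foldr (act M) xs v) \<in> lowering_span"
proof (induction xs arbitrary: x)
  case Nil
  show ?case
  proof (rule car_linear_induct[OF Nil.prems(2) lowering_span_subspace])
    fix x a assume a: "a \<in> insert 0 (roots L h)" "x \<in> root_space L h a" "x \<in> homog L"
    show "act M x (foldr (act M) [] v) \<in> lowering_span"
    proof (cases "f a \<le> 0")
      case True
      then have "x \<in> lowering" using a by (auto simp: lowering_def)
      then show ?thesis using lowering_word[of "[x]"] by simp
    next
      case False
      then have "root_letter x (f a)" "f a > 0" using a by (auto simp: root_letter_def)
      then show ?thesis using v_annihilated ms.subspace_0[OF lowering_span_subspace] by simp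
    qed
  qed
next
  case (Cons y ys)
  let ?m = "foldr (act M) ys v"
  have y: "y \<in> lowering" and ys: "set ys \<subseteq> lowering" using Cons.prems by auto
  show ?case
  proof (rule car_linear_induct[OF Cons.prems(2) lowering_span_subspace])
    fix x a assume a: "a \<in> insert 0 (roots L h)" "x \<in> root_space L h a" "x \<in> homog L"
    have xc: "x \<in> car L" using a(3) by (rule homog_car)
    have yh: "y \<in> homog L" using y by (simp add: lowering_def)
    have "act M (br L x y) ?m \<in> lowering_span"
      using Cons.IH[OF ys br_car[OF xc lowering_car[OF y]]] .
    moreover have "act M y (act M x ?m) \<in> lowering_span"
      using lowering_span_act[OF y Cons.IH[OF ys xc]] .
    moreover have "act M x (act M y ?m) = act M (br L x y) ?m
        + m_scal M ((-1) ^ (par L x * par L y)) (act M y (act M x ?m))"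
      using act_br[OF a(3) yh, of ?m] by simp
    ultimately show "act M x (foldr (act M) (y # ys) v) \<in> lowering_span"
      using lowering_span_subspace by (simp add: ms.subspace_add ms.subspace_scale)
  qed
qed

lemma act_lowering_span:
  assumes "x \<in> car L" "m \<in> lowering_span" shows "act M x m \<in> lowering_span"
  using assms(2) unfolding lowering_span_def
proof (induction rule: ms.span_induct_alt)
  case base
  show ?case using assms(1) by (simp add: ms.span_zero)
next
  case (step c g m)
  then have "act M x g \<in> lowering_span" using act_lowering_word[OF _ assms(1)] by auto
  then show ?case
    using step.IH assms(1)
    by (simp add: act_add_right act_scale_right ms.span_add ms.span_scale lowering_span_def)
qed

lemma lowering_span_UNIV: "lowering_span = UNIV"
proof -
  have "foldr (act M) xs v \<in> lowering_span" if "set xs \<subseteq> car L" for xs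
    using that lowering_word[of "[]"] by (induction xs) (auto simp: act_lowering_span)
  then have "cyclic_submodule L M v \<subseteq> lowering_span"
    unfolding cyclic_submodule_def by (intro ms.span_minimal lowering_span_subspace) auto
  then show ?thesis using v_gen by auto
qed

lemma dual_space_add: "a \<in> dual_space L h \<Longrightarrow> b \<in> dual_space L h \<Longrightarrow> a + b \<in> dual_space L h"
  by (simp add: dual_space_def algebra_simps)

text \<open>The group closure makes \<open>f\<close> additive, and \<open>dual_space\<close> ensures
  that distinct weights differ at some element of \<open>h\<close>.\<close>

definition lattice :: "('g \<Rightarrow> complex) set" where
  "lattice = group_closure (roots L h) \<inter> dual_space L h"

lemma lattice_add: "a \<in> lattice \<Longrightarrow> b \<in> lattice \<Longrightarrow> a + b \<in> lattice"
  by (simp add: lattice_def group_closure_add dual_space_add)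

lemma root_lattice: "a \<in> insert 0 (roots L h) \<Longrightarrow> a \<in> lattice"
  by (simp add: lattice_def root_closure root_dual)

lemma f_lattice: "a \<in> lattice \<Longrightarrow> b \<in> lattice \<Longrightarrow> f (a + b) = f a + f b"
  by (simp add: lattice_def f_add)

lemma lowering_word_weight:
  "set xs \<subseteq> lowering \<Longrightarrow> \<exists>b\<in>lattice. f b \<le> 0 \<and> foldr (act M) xs v \<in> weight_space (b + \<Lambda>)"
proof (induction xs)
  case Nil
  have "v \<in> weight_space (0 + \<Lambda>)" using v_weight by (simp add: weight_space_def)
  then show ?case
    by (intro bexI[of _ 0] conjI) (simp_all only: foldr.simps id_apply f_zero order_refl root_lattice insertI1)
next
  case (Cons x xs)
  then obtain b where b: "b \<in> lattice" "f b \<le> 0" "foldr (act M) xs v \<in> weight_space (b + \<Lambda>)"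
    by (metis insert_subset list.simps(15))
  have "x \<in> lowering" using Cons.prems by simp
  then have "x \<in> homog L \<and> (\<exists>a\<in>insert 0 (roots L h). x \<in> root_space L h a \<and> f a \<le> 0)"
    unfolding lowering_def by (rule CollectD)
  then obtain a where a: "a \<in> insert 0 (roots L h)" "x \<in> root_space L h a" "f a \<le> 0" "x \<in> homog L"
    by blast
  have "foldr (act M) (x # xs) v \<in> weight_space (a + (b + \<Lambda>))"
    using act_weight_space[OF a(2,4) b(3)] by simp
  moreover have "f (a + b) \<le> 0" using f_lattice[OF root_lattice[OF a(1)] b(1)] a(3) b(2) by simp
  moreover have "a + b \<in> lattice" by (rule lattice_add[OF root_lattice[OF a(1)] b(1)])
  ultimately show ?case unfolding add.assoc[symmetric] by blast
qed

text \<open>A subspace containing the image of the opposite nilradical and defined by weights alone,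
  so that independence of eigenvectors can exclude \<open>v\<close> from it.\<close>

definition lower_weights :: "'m set" where
  "lower_weights = ms.span (\<Union>b\<in>{b \<in> lattice. f b < 0}. weight_space (b + \<Lambda>))"

lemma negative_letter_lower_weights:
  assumes "root_letter y d" "d < 0" shows "act M y m \<in> lower_weights"
proof -
  have "m \<in> lowering_span" by (simp add: lowering_span_UNIV)
  then show ?thesis
    unfolding lowering_span_def
  proof (induction rule: ms.span_induct_alt)
    case base
    show ?case using root_letter_car[OF assms(1)] by (simp add: lower_weights_def ms.span_zero)
  next
    case (step c g m)
    then obtain b where b: "b \<in> lattice" "f b \<le> 0" "g \<in> weight_space (b + \<Lambda>)"
      using lowering_word_weight by blast
    obtain a where a: "a \<in> roots L h" "y \<in> root_space L h a" "f a = d" "y \<in> homog L"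
      using assms(1) by (auto simp: root_letter_def)
    have al: "a \<in> lattice" using a(1) by (simp add: root_lattice)
    have "act M y g \<in> weight_space ((a + b) + \<Lambda>)"
      using act_weight_space[OF a(2,4) b(3)] by (simp add: add.assoc)
    moreover have "f (a + b) < 0" using f_lattice[OF al b(1)] a(3) b(2) assms(2) by simp
    ultimately have "act M y g \<in> lower_weights"
      unfolding lower_weights_def using lattice_add[OF al b(1)] by (intro ms.span_base) blast
    then show ?case
      using step.IH root_letter_car[OF assms(1)]
      by (simp add: act_add_right act_scale_right lower_weights_def ms.span_add ms.span_scale)
  qed
qed

lemma highest_vector_not_lower: "v \<notin> lower_weights"
proof
  assume "v \<in> lower_weights"
  then obtain C y where C: "finite C" "C \<subseteq> {b \<in> lattice. f b < 0}"
    and y: "\<And>b. b \<in> C \<Longrightarrow> y b \<in> weight_space (b + \<Lambda>)" and v: "v = (\<Sum>b\<in>C. y b)"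
    unfolding lower_weights_def using weight_space_subspace by (rule ms.span_UN_subspaces) auto
  have 0: "0 \<notin> C" using C(2) by auto
  \<comment> \<open>The weights in \<open>C\<close> have negative degree and differ from 0, so
    \<open>- v\<close> enters as a further eigenvector whose weight is new, and the sum becomes
    zero.\<close>
  define y' where "y' b = (if b = 0 then - v else y b)" for b
  have "\<forall>b\<in>insert 0 C. y' b = 0"
  proof (rule joint_eigenvectors_independent[where sc = "m_scal M" and V = UNIV and A = h
        and T = "act M" and ew = "\<lambda>b H. (b + \<Lambda>) H"])
    show "vector_space (m_scal M)" ..
    show "finite (insert 0 C)" using C(1) by simp
    show "act M H (x + z) = act M H x + act M H z" if "H \<in> h" for H x z
      using that by (simp add: act_add_right h_car)
    show "act M H (m_scal M c x) = m_scal M c (act M H x)" if "H \<in> h" for H c x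
      using that by (simp add: act_scale_right h_car)
    show "act M H (y' b) = m_scal M ((b + \<Lambda>) H) (y' b)" if "b \<in> insert 0 C" "H \<in> h" for b H
    proof (cases "b = 0")
      case True
      then show ?thesis using v_weight[OF that(2)] act_diff_right[OF h_car[OF that(2)], of 0 v] that(2)
        by (simp add: y'_def h_car)
    next
      case False
      then show ?thesis using y[of b] that by (simp add: y'_def weight_space_def)
    qed
    show "\<exists>H\<in>h. (b + \<Lambda>) H \<noteq> (b' + \<Lambda>) H" if "b \<in> insert 0 C" "b' \<in> insert 0 C" "b \<noteq> b'" for b b'
    proof -
      have "b \<in> dual_space L h" "b' \<in> dual_space L h"
        using that C(2) root_lattice[of 0] by (auto simp: lattice_def)
      then have "b H = b' H" if "H \<notin> h" for H using that by (simp add: dual_space_def)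
      then show ?thesis using \<open>b \<noteq> b'\<close> by (auto simp: fun_eq_iff) 
    qed
    have "(\<Sum>b\<in>insert 0 C. y' b) = - v + (\<Sum>b\<in>C. y' b)" using C(1) 0 by (simp add: y'_def)
    also have "(\<Sum>b\<in>C. y' b) = v" unfolding v using 0 by (intro sum.cong) (auto simp: y'_def)
    finally show "(\<Sum>b\<in>insert 0 C. y' b) = 0" by (simp only: left_minus)
  qed (simp_all add: ms.subspace_UNIV)
  then show False using v_nz by (simp add: y'_def)
qed

lemma highest_weight_functional:
  obtains l where "Vector_Spaces.linear (m_scal M) (*) l" "l v = (1 :: complex)"
    "\<And>y d m. root_letter y d \<Longrightarrow> d < 0 \<Longrightarrow> l (act M y m) = 0"
proof -
  have "ms.subspace lower_weights" by (simp add: lower_weights_def)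
  then obtain l :: "'m \<Rightarrow> complex" where "Vector_Spaces.linear (m_scal M) (*) l"
    "\<And>x. x \<in> lower_weights \<Longrightarrow> l x = 0" "l v = 1"
    using separating_functional[OF ms.vector_space_axioms _ highest_vector_not_lower] by blast
  then show thesis using that negative_letter_lower_weights by blast
qed

end
end

section \<open>The oscillator supermodule and the Dirac operator\<close>

lemma coset_eq_iff:
  assumes "fs.subspace N"
  shows "a +o N = b +o N \<longleftrightarrow> a - b \<in> N"
proof
  assume "a +o N = b +o N"
  moreover have "a \<in> a +o N" using fs.subspace_0[OF assms] by (force simp: elt_set_plus_def)
  ultimately obtain c where "c \<in> N" "a = b + c" by (auto simp: elt_set_plus_def)
  then show "a - b \<in> N" by simp
next
  assume ab: "a - b \<in> N"
  have "x +o N \<subseteq> y +o N" if "x - y \<in> N" for x y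
  proof
    fix u assume "u \<in> x +o N"
    then obtain c where "c \<in> N" "u = x + c" by (auto simp: elt_set_plus_def)
    then have "u = y + ((x - y) + c)" "(x - y) + c \<in> N"
      using fs.subspace_add[OF assms that] by auto
    then show "u \<in> y +o N" unfolding elt_set_plus_def by blast
  qed
  moreover have "b - a \<in> N" using fs.subspace_neg[OF assms ab] by simp
  ultimately show "a +o N = b +o N" using ab by blast
qed

lemma coset_add:
  assumes "fs.subspace N"
  shows "(a +o N) + (b +o N) = (a + b) +o N"
proof -
  have "N + N = N"
  proof
    show "N + N \<subseteq> N" using fs.subspace_add[OF assms] by (auto simp: set_plus_def)
    show "N \<subseteq> N + N" using fs.subspace_0[OF assms] by (force simp: set_plus_def)
  qed
  then show ?thesis by (simp add: set_plus_rearrange)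
qed

lemma coset_zero: "fs.subspace N \<Longrightarrow> 0 +o N = N"
  by (simp add: elt_set_plus_def)

context root_setting
begin

abbreviation "cls \<equiv> osc_class L B S U"
abbreviation "Osc \<equiv> oscillator L B S U"

lemma cliff_left_ideal_LI: "cliff_left_ideal L B S U = (\<lambda>b. b +o CI) ` LI"
  by (simp add: cliff_left_ideal_def LI_def)

lemma osc_class_alt: "cls a = {(a + b) +o CI | b. b \<in> LI}"
  unfolding osc_class_def cliff_left_ideal_LI
  by (auto simp: elt_set_plus_def[of "a +o CI"] coset_add[OF CI_subspace])

text \<open>The oscillator supermodule is a quotient of a quotient, with sets of cosets as elements;
  both steps collapse to the single subspace \<open>K\<close>.\<close>

lemma osc_class_eq_iff: "cls a = cls b \<longleftrightarrow> a - b \<in> K"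
proof
  assume *: "cls a = cls b"
  have "a +o CI \<in> cls a"
    unfolding osc_class_alt using fs.subspace_0[OF LI_subspace] by force
  then have "a +o CI \<in> cls b" using * by simp
  then obtain l where "l \<in> LI" "a +o CI = (b + l) +o CI"
    unfolding osc_class_alt by blast
  then have "a - (b + l) \<in> CI" "a - b = (a - (b + l)) + l"
    using coset_eq_iff[OF CI_subspace] by auto
  with \<open>l \<in> LI\<close> show "a - b \<in> K" unfolding K_def by blast
next
  have "cls x \<subseteq> cls y" if xy: "x - y \<in> K" for x y
  proof
    fix X assume "X \<in> cls x"
    then obtain l where l: "l \<in> LI" "X = (x + l) +o CI" unfolding osc_class_alt by blast
    obtain c m where cm: "c \<in> CI" "m \<in> LI" "x - y = c + m" using xy unfolding K_def by blast
    have "(x + l) - (y + (m + l)) = c" using cm(3) by (simp add: algebra_simps)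
    then have "X = (y + (m + l)) +o CI" using l(2) cm(1) coset_eq_iff[OF CI_subspace] by simp
    moreover have "m + l \<in> LI" using cm(2) l(1) by (rule fs.subspace_add[OF LI_subspace])
    ultimately show "X \<in> cls y" unfolding osc_class_alt by blast
  qed
  moreover assume "a - b \<in> K"
  moreover then have "b - a \<in> K" using fs.subspace_neg[OF K_subspace, of "a - b"] by simp
  ultimately show "cls a = cls b" by blast
qed

lemma osc_class_add: "cls a + cls b = cls (a + b)"
proof
  show "cls a + cls b \<subseteq> cls (a + b)"
  proof
    fix X assume "X \<in> cls a + cls b"
    then obtain l m where "l \<in> LI" "m \<in> LI" "X = ((a + l) +o CI) + ((b + m) +o CI)"
      unfolding osc_class_alt set_plus_def by blast
    then have "X = ((a + b) + (l + m)) +o CI" "l + m \<in> LI"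
      using fs.subspace_add[OF LI_subspace] by (auto simp: coset_add[OF CI_subspace] algebra_simps)
    then show "X \<in> cls (a + b)" unfolding osc_class_alt by blast
  qed
  show "cls (a + b) \<subseteq> cls a + cls b"
  proof
    fix X assume "X \<in> cls (a + b)"
    then obtain l where l: "l \<in> LI" "X = ((a + b) + l) +o CI" unfolding osc_class_alt by blast
    have "X = ((a + 0) +o CI) + ((b + l) +o CI)"
      unfolding l(2) coset_add[OF CI_subspace] by (simp add: algebra_simps)
    moreover have "(a + 0) +o CI \<in> cls a" "(b + l) +o CI \<in> cls b"
      unfolding osc_class_alt using l(1) fs.subspace_0[OF LI_subspace] by blast+
    ultimately show "X \<in> cls a + cls b" by (metis set_plus_intro)
  qed
qed

lemma quot_scale_coset: "quot_scale fscale CI c (a +o CI) = fscale c a +o CI"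
proof
  show "quot_scale fscale CI c (a +o CI) \<subseteq> fscale c a +o CI"
  proof
    fix x assume "x \<in> quot_scale fscale CI c (a +o CI)"
    then obtain u w where "u \<in> CI" "w \<in> CI" "x = fscale c (a + u) + w"
      by (auto simp: quot_scale_def set_plus_def elt_set_plus_def)
    then have "x = fscale c a + (fscale c u + w)" "fscale c u + w \<in> CI"
      by (auto simp: fs.scale_right_distrib algebra_simps
          intro: fs.subspace_add[OF CI_subspace] fs.subspace_scale[OF CI_subspace])
    then show "x \<in> fscale c a +o CI" unfolding elt_set_plus_def by blast
  qed
  show "fscale c a +o CI \<subseteq> quot_scale fscale CI c (a +o CI)"
  proof
    fix x assume "x \<in> fscale c a +o CI"
    then obtain u where u: "u \<in> CI" "x = fscale c a + u" by (auto simp: elt_set_plus_def)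
    have "a \<in> a +o CI" using fs.subspace_0[OF CI_subspace] by (force simp: elt_set_plus_def)
    then show "x \<in> quot_scale fscale CI c (a +o CI)"
      unfolding quot_scale_def u(2) using u(1) by (intro set_plus_intro imageI)
  qed
qed

lemma osc_scale_class: "osc_scale L B S U c (cls a) = cls (fscale c a)"
proof
  show "osc_scale L B S U c (cls a) \<subseteq> cls (fscale c a)"
  proof
    fix X assume "X \<in> osc_scale L B S U c (cls a)"
    then obtain l m where lm: "l \<in> LI" "m \<in> LI"
      and "X = quot_scale fscale CI c ((a + l) +o CI) + (m +o CI)"
      unfolding osc_scale_def quot_scale_def[of "quot_scale fscale CI"] cliff_left_ideal_LI
        osc_class_alt set_plus_def by blast
    then have "X = (fscale c a + (fscale c l + m)) +o CI"
      by (simp add: quot_scale_coset coset_add[OF CI_subspace] fs.scale_right_distrib add.assoc)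
    moreover have "fscale c l + m \<in> LI"
      using lm by (simp add: fs.subspace_add[OF LI_subspace] fs.subspace_scale[OF LI_subspace])
    ultimately show "X \<in> cls (fscale c a)" unfolding osc_class_alt by blast
  qed
  show "cls (fscale c a) \<subseteq> osc_scale L B S U c (cls a)"
  proof
    fix X assume "X \<in> cls (fscale c a)"
    then obtain l where l: "l \<in> LI" "X = (fscale c a + l) +o CI" unfolding osc_class_alt by blast
    have "X = quot_scale fscale CI c ((a + 0) +o CI) + (l +o CI)"
      unfolding l(2) by (simp add: quot_scale_coset coset_add[OF CI_subspace])
    moreover have "(a + 0) +o CI \<in> cls a"
      unfolding osc_class_alt using fs.subspace_0[OF LI_subspace] by blast
    ultimately show "X \<in> osc_scale L B S U c (cls a)"
      unfolding osc_scale_def quot_scale_def[of "quot_scale fscale CI"] cliff_left_ideal_LI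
      using l(1) by (simp only:) (intro set_plus_intro imageI)
  qed
qed

lemma oscillator_classes: "Osc = cls ` FS"
  by (simp add: oscillator_def quot_def clifford_def osc_class_def image_image)

lemma osc_class_Osc: "a \<in> FS \<Longrightarrow> cls a \<in> Osc"
  by (simp add: oscillator_classes)

text \<open>The chosen representative differs from \<open>a\<close> by an element of
  \<open>K\<close>, and \<open>K\<close> is stable under left multiplication.\<close>

lemma osc_act_class:
  assumes "a \<in> FS" "c \<in> FS" shows "osc_act L B S U c (cls a) = cls (c * a)"
proof -
  let ?a = "inv_into FS cls (cls a)"
  have "cls ?a = cls a" using assms(1) by (intro f_inv_into_f) simp
  then have "?a - a \<in> K" by (simp add: osc_class_eq_iff)
  then have "c * ?a - c * a \<in> K" using K_left[OF _ assms(2)] by (simp add: right_diff_distrib[symmetric])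
  then show ?thesis by (simp add: osc_act_def osc_class_eq_iff)
qed

end

section \<open>The tensor product with \<open>M\<close> and functionals on it\<close>

context module_setting
begin

abbreviation "R \<equiv> osc_tensor_rels L B S U M"
abbreviation "TF \<equiv> tensor_free (UNIV :: 'm set) Osc"

lemma R_subspace: "fs.subspace R"
  by (simp add: osc_tensor_rels_def tensor_rels_def)

text \<open>The universal property of the tensor product in scalar form: a function that is bilinear
  on classes kills the relations.\<close>

lemma R_functional:
  assumes "\<And>m m' a. a \<in> FS \<Longrightarrow> g (m + m', cls a) = g (m, cls a) + g (m', cls a)"
    and "\<And>m a b. a \<in> FS \<Longrightarrow> b \<in> FS \<Longrightarrow> g (m, cls (a + b)) = g (m, cls a) + g (m, cls b)"
    and "\<And>c m a. a \<in> FS \<Longrightarrow> g (m_scal M c m, cls a) = c * g (m, cls a)"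
    and "\<And>c m a. a \<in> FS \<Longrightarrow> g (m, cls (fscale c a)) = c * g (m, cls a)"
    and "t \<in> R"
  shows "lext g t = 0"
proof -
  have sub: "lext g (p - q) = lext g p - lext g q" for p q
    using lext_add[of g "p - q" q] by simp
  have "lext g 0 = 0" using lext_scale[of g 0 0] by simp
  then have "fs.subspace {t. lext g t = 0}"
    by (auto simp: fs.subspace_def lext_add lext_scale)
  moreover have "{basis_vec (v + v', w) - basis_vec (v, w) - basis_vec (v', w) | v v' w.
         v \<in> UNIV \<and> v' \<in> UNIV \<and> w \<in> Osc} \<union>
      {basis_vec (v, w + w') - basis_vec (v, w) - basis_vec (v, w') | v w w'.
         v \<in> UNIV \<and> w \<in> Osc \<and> w' \<in> Osc} \<union>
      {basis_vec (m_scal M c v, w) - fscale c (basis_vec (v, w)) | c v w. v \<in> UNIV \<and> w \<in> Osc} \<union>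
      {basis_vec (v, osc_scale L B S U c w) - fscale c (basis_vec (v, w)) | c v w. v \<in> UNIV \<and> w \<in> Osc}
     \<subseteq> {t. lext g t = 0}"
    using assms(1-4)
    by (auto simp: oscillator_classes osc_class_add osc_scale_class sub lext_scale simp del: fscale_single)
  ultimately have "R \<subseteq> {t. lext g t = 0}"
    unfolding osc_tensor_rels_def tensor_rels_def by (intro fs.span_minimal)
  then show ?thesis using assms(5) by blast
qed

context
  fixes N X Xd and n :: nat and Y Yd :: "nat \<Rightarrow> 'g" and deg :: "nat \<Rightarrow> int"
  assumes X: "homogeneous_dual_bases L B S N X Xd" and rb: "root_basis L B h f n Y Yd deg"
begin

interpretation rb: root_basis L B h f n Y Yd deg by (rule rb)

abbreviation "cubic \<equiv> cubic_term L B N X Xd"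
abbreviation "DP \<equiv> dirac_pure L B S U M N X Xd"
abbreviation "DF \<equiv> dirac_free L B S U M N X Xd"

text \<open>The Dirac operator transposed to bilinear functions. The parity exponent refers to
  \<open>X i\<close>, not to its dual of equal parity, to fit
  \<open>hdb_change_basis\<close>.\<close>

definition dirac_form :: "('m \<Rightarrow> 'g free_alg \<Rightarrow> complex) \<Rightarrow> 'm \<Rightarrow> 'g free_alg \<Rightarrow> complex" where
  "dirac_form \<beta> m a = (\<Sum>i=1..N. \<beta> (act M (X i) ((parity_op M ^^ par L (X i)) m)) (gen (Xd i) * a))
     + \<beta> m (cubic * a)"

lemma dirac_pure_functional:
  assumes "Vector_Spaces.linear fscale (*) \<Psi>" and a: "a \<in> FS"
  shows "\<Psi> (DP m (cls a)) = dirac_form (\<lambda>m a. \<Psi> (basis_vec (m, cls a))) m a"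
proof -
  interpret \<Psi>: Vector_Spaces.linear fscale "(*)" \<Psi> by (rule assms(1))
  show ?thesis
    unfolding dirac_pure_def dirac_form_def \<Psi>.add \<Psi>.sum
    using hdb_dual_parity(2)[OF X] hdb_dual_S[OF X] a
    by (intro arg_cong2[where f = plus] sum.cong refl)
      (simp_all add: osc_act_class cubic_term_FS[OF X])
qed

lemma dirac_free_functional:
  assumes "Vector_Spaces.linear fscale (*) \<Psi>"
  shows "\<Psi> (DF t) = lext (\<lambda>(m, w). \<Psi> (DP m w)) t"
proof -
  interpret \<Psi>: Vector_Spaces.linear fscale "(*)" \<Psi> by (rule assms(1))
  show ?thesis
    unfolding dirac_free_def lext_def \<Psi>.sum
    by (intro sum.cong refl) (auto simp: \<Psi>.scale)
qed

context
  fixes \<beta> :: "'m \<Rightarrow> 'g free_alg \<Rightarrow> complex"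
  assumes add_left: "\<And>m m' a. a \<in> FS \<Longrightarrow> \<beta> (m + m') a = \<beta> m a + \<beta> m' a"
    and add_right: "\<And>m a b. a \<in> FS \<Longrightarrow> b \<in> FS \<Longrightarrow> \<beta> m (a + b) = \<beta> m a + \<beta> m b"
    and scale_left: "\<And>c m a. a \<in> FS \<Longrightarrow> \<beta> (m_scal M c m) a = c * \<beta> m a"
    and scale_right: "\<And>c m a. a \<in> FS \<Longrightarrow> \<beta> m (fscale c a) = c * \<beta> m a"
begin

lemma dirac_form_bilinear:
  assumes a: "a \<in> FS" and b: "b \<in> FS"
  shows "dirac_form \<beta> (m + m') a = dirac_form \<beta> m a + dirac_form \<beta> m' a"
    and "dirac_form \<beta> m (a + b) = dirac_form \<beta> m a + dirac_form \<beta> m b"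
    and "dirac_form \<beta> (m_scal M c m) a = c * dirac_form \<beta> m a"
    and "dirac_form \<beta> m (fscale c a) = c * dirac_form \<beta> m a"
proof -
  have g: "gen (Xd i) * a \<in> FS" "gen (Xd i) * b \<in> FS" if "i \<in> {1..N}" for i
    using hdb_dual_S[OF X that] a b by (auto intro: free_on_mult)
  have q: "cubic * a \<in> FS" "cubic * b \<in> FS"
    using cubic_term_FS[OF X] a b by (auto intro: free_on_mult)
  note * = hdb_car(1)[OF X] parity_pow_add parity_pow_scale act_add_right act_scale_right
    distrib_left fscale_mult_right
  show "dirac_form \<beta> (m + m') a = dirac_form \<beta> m a + dirac_form \<beta> m' a"
    using g q by (simp add: dirac_form_def * add_left sum.distrib)
  show "dirac_form \<beta> m (a + b) = dirac_form \<beta> m a + dirac_form \<beta> m b"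
    using g q by (simp add: dirac_form_def * add_right sum.distrib)
  show "dirac_form \<beta> (m_scal M c m) a = c * dirac_form \<beta> m a"
    using g q by (simp add: dirac_form_def * scale_left sum_distrib_left)
  show "dirac_form \<beta> m (fscale c a) = c * dirac_form \<beta> m a"
    using g q by (simp add: dirac_form_def * scale_right sum_distrib_left)
qed

text \<open>Only the linear part of the operator is rewritten. The cubic term may stay in the given
  basis, since its needed properties were transferred to every basis. Vanishing on \<open>K\<close>
  makes \<beta> linear in the Clifford letter.\<close>

lemma dirac_form_root_basis:
  assumes K: "\<And>m a. a \<in> K \<Longrightarrow> a \<in> FS \<Longrightarrow> \<beta> m a = 0" and a: "a \<in> FS"
  shows "dirac_form \<beta> m a =
    (\<Sum>i=1..n. \<beta> (act M (Y i) ((parity_op M ^^ par L (Y i)) m)) (gen (Yd i) * a)) + \<beta> m (cubic * a)"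
proof -
  have g: "gen x * a \<in> FS" if "x \<in> S" for x
    using that a by (auto intro: free_on_mult)
  have sub: "\<beta> m u = \<beta> m w" if "u - w \<in> CI" "u \<in> FS" "w \<in> FS" for m u w
  proof -
    have "u - w \<in> FS" using that by (intro fs.subspace_diff free_on_subspace)
    then have "\<beta> m ((u - w) + w) = \<beta> m (u - w) + \<beta> m w" and 0: "\<beta> m (u - w) = 0"
      using that(3) K[OF CI_K[OF that(1)]] add_right by blast+
    then show ?thesis unfolding 0 diff_add_cancel by simp
  qed
  have "bilin_on (scal L) S (\<lambda>x y. \<beta> (act M x ((parity_op M ^^ p) m)) (gen y * a))" for p
    unfolding bilin_on_def
  proof (intro conjI ballI allI)
    fix x y z c assume x: "x \<in> S" and y: "y \<in> S"
    show "\<beta> (act M (scal L c x) ((parity_op M ^^ p) m)) (gen y * a)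
        = c * \<beta> (act M x ((parity_op M ^^ p) m)) (gen y * a)"
      using x y by (simp add: act_scale_left S_car scale_left g)
    have "\<beta> m' (gen (scal L c y) * a) = \<beta> m' (fscale c (gen y * a))" for m'
      using y S_subspace a by (intro sub CI_scale g fs.subspace_scale[OF free_on_subspace])
        (auto simp: vs.subspace_scale)
    then show "\<beta> (act M x ((parity_op M ^^ p) m)) (gen (scal L c y) * a)
        = c * \<beta> (act M x ((parity_op M ^^ p) m)) (gen y * a)"
      using y by (simp add: scale_right g)
    assume z: "z \<in> S"
    show "\<beta> (act M (x + y) ((parity_op M ^^ p) m)) (gen z * a)
        = \<beta> (act M x ((parity_op M ^^ p) m)) (gen z * a) + \<beta> (act M y ((parity_op M ^^ p) m)) (gen z * a)"
      using x y z by (simp add: act_add_left S_car add_left g)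
    have "\<beta> m' (gen (y + z) * a) = \<beta> m' (gen y * a + gen z * a)" for m'
      using y z S_subspace a by (intro sub CI_add g fs.subspace_add[OF free_on_subspace])
        (auto simp: vs.subspace_add)
    then show "\<beta> (act M x ((parity_op M ^^ p) m)) (gen (y + z) * a)
        = \<beta> (act M x ((parity_op M ^^ p) m)) (gen y * a) + \<beta> (act M x ((parity_op M ^^ p) m)) (gen z * a)"
      using y z by (simp add: add_right g)
  qed
  then show ?thesis
    unfolding dirac_form_def
    using hdb_change_basis[OF X rb.hdb, of "\<lambda>p x y. \<beta> (act M x ((parity_op M ^^ p) m)) (gen y * a)"]
    by simp
qed

end

context
  fixes \<Psi> :: "('m \<times> 'g free_alg set set \<Rightarrow>\<^sub>0 complex) \<Rightarrow> complex"
  assumes \<Psi>: "Vector_Spaces.linear fscale (*) \<Psi>" and \<Psi>_R: "\<And>t. t \<in> R \<Longrightarrow> \<Psi> t = 0"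
begin

interpretation \<Psi>: Vector_Spaces.linear fscale "(*)" \<Psi> by (rule \<Psi>)

abbreviation "\<beta> \<equiv> \<lambda>m a. \<Psi> (basis_vec (m, cls a))"

lemma R_bilinear:
  assumes a: "a \<in> FS"
  shows "\<beta> (m + m') a = \<beta> m a + \<beta> m' a"
    and "b \<in> FS \<Longrightarrow> \<beta> m (a + b) = \<beta> m a + \<beta> m b"
    and "\<beta> (m_scal M c m) a = c * \<beta> m a"
    and "\<beta> m (fscale c a) = c * \<beta> m a"
proof -
  note base = osc_tensor_rels_def[of L B S U M, unfolded tensor_rels_def]
  have "basis_vec (m + m', cls a) - basis_vec (m, cls a) - basis_vec (m', cls a) \<in> R"
    unfolding base using osc_class_Osc[OF a] by (intro fs.span_base) blast
  from \<Psi>_R[OF this] show "\<beta> (m + m') a = \<beta> m a + \<beta> m' a" by (simp add: \<Psi>.diff diff_eq_eq add.commute)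
  show "\<beta> m (a + b) = \<beta> m a + \<beta> m b" if b: "b \<in> FS"
  proof -
    have "basis_vec (m, cls a + cls b) - basis_vec (m, cls a) - basis_vec (m, cls b) \<in> R"
      unfolding base using osc_class_Osc[OF a] osc_class_Osc[OF b] by (intro fs.span_base) blast
    from \<Psi>_R[OF this] show ?thesis by (simp add: \<Psi>.diff osc_class_add diff_eq_eq add.commute)
  qed
  have "basis_vec (m_scal M c m, cls a) - fscale c (basis_vec (m, cls a)) \<in> R"
    unfolding base using osc_class_Osc[OF a] by (intro fs.span_base) blast
  from \<Psi>_R[OF this] show "\<beta> (m_scal M c m) a = c * \<beta> m a"
    by (simp only: \<Psi>.diff \<Psi>.scale) simp
  have "basis_vec (m, osc_scale L B S U c (cls a)) - fscale c (basis_vec (m, cls a)) \<in> R"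
    unfolding base using osc_class_Osc[OF a] by (intro fs.span_base) blast
  from \<Psi>_R[OF this] show "\<beta> m (fscale c a) = c * \<beta> m a"
    by (simp only: \<Psi>.diff \<Psi>.scale osc_scale_class) simp
qed

lemma R_bilinear_K: "a \<in> K \<Longrightarrow> \<beta> m a = 0"
proof -
  assume "a \<in> K"
  \<comment> \<open>Zero is written as a multiple by 0 so that the scaling rule yields the value
    0.\<close>
  then have "cls a = cls (fscale 0 1)" by (simp add: osc_class_eq_iff)
  then show "\<beta> m a = 0" using R_bilinear(4)[OF one_in_free_on, of m 0] by simp
qed

text \<open>For every functional killing the relations, its composite with the Dirac operator is
  again bilinear on classes. Hence the operator maps relations to relations.\<close>

lemma dirac_free_R_functional: "t \<in> R \<Longrightarrow> \<Psi> (DF t) = 0"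
  unfolding dirac_free_functional[OF \<Psi>]
proof (erule R_functional[rotated -1])
  note b = dirac_form_bilinear[where \<beta> = \<beta>, OF R_bilinear]
  fix m m' a b c assume a: "a \<in> FS"
  show "(case (m + m', cls a) of (m, w) \<Rightarrow> \<Psi> (DP m w)) =
      (case (m, cls a) of (m, w) \<Rightarrow> \<Psi> (DP m w)) + (case (m', cls a) of (m, w) \<Rightarrow> \<Psi> (DP m w))"
    using a b(1)[of a a m m'] by (simp add: dirac_pure_functional[OF \<Psi>])
  show "(case (m_scal M c m, cls a) of (m, w) \<Rightarrow> \<Psi> (DP m w)) = c * (case (m, cls a) of (m, w) \<Rightarrow> \<Psi> (DP m w))"
    using a b(3)[of a a c m] by (simp add: dirac_pure_functional[OF \<Psi>])
  show "(case (m, cls (fscale c a)) of (m, w) \<Rightarrow> \<Psi> (DP m w)) = c * (case (m, cls a) of (m, w) \<Rightarrow> \<Psi> (DP m w))"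
    using a b(4)[of a a m c] fs.subspace_scale[OF free_on_subspace a, of c]
    by (simp add: dirac_pure_functional[OF \<Psi>])
  assume "b \<in> FS"
  then show "(case (m, cls (a + b)) of (m, w) \<Rightarrow> \<Psi> (DP m w)) =
      (case (m, cls a) of (m, w) \<Rightarrow> \<Psi> (DP m w)) + (case (m, cls b) of (m, w) \<Rightarrow> \<Psi> (DP m w))"
    using a b(2)[of a b m] fs.subspace_add[OF free_on_subspace a, of b]
    by (simp add: dirac_pure_functional[OF \<Psi>])
qed

lemma dirac_highest_functional:
  assumes v: "\<And>x d. root_letter x d \<Longrightarrow> d > 0 \<Longrightarrow> act M x v = 0"
  shows "\<Psi> (DP v (cls 1)) = 0"
proof -
  have z: "\<beta> 0 a = 0" if "a \<in> FS" for a
    using R_bilinear(3)[OF that, of 0 0] by simp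
  have "\<beta> (act M (Y i) ((parity_op M ^^ par L (Y i)) v)) (gen (Yd i) * 1) = 0" if i: "i \<in> {1..n}" for i
  proof (cases "deg i > 0")
    case True
    then have "act M (Y i) ((parity_op M ^^ par L (Y i)) v) = 0"
      using v[OF rb.letter[OF i]] act_parity_pow_zero root_letter_homog[OF rb.letter[OF i]] by blast
    then show ?thesis using z[of "gen (Yd i)"] hdb_dual_S[OF rb.hdb i] by simp
  next
    case False
    then have "- deg i > 0" using rb.letter[OF i] by (simp add: root_letter_def)
    then have "gen (Yd i) * 1 \<in> K"
      using LI_K[OF LI_gen[OF root_letter_U[OF rb.dual_letter[OF i]] one_in_free_on]] by simp
    then show ?thesis by (rule R_bilinear_K)
  qed
  moreover have "\<beta> v (cubic * 1) = 0"
    using R_bilinear_K[OF rb.cubic_term_K[OF X]] by simp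
  ultimately show ?thesis
    unfolding dirac_pure_functional[OF \<Psi> one_in_free_on]
    by (subst dirac_form_root_basis[OF R_bilinear R_bilinear_K]) simp_all
qed

end

lemma dirac_free_cong: "t - t' \<in> R \<Longrightarrow> DF t - DF t' \<in> R"
proof (rule subspace_mem_by_functionals[OF fs.vector_space_axioms R_subspace])
  fix \<Psi> :: "('m \<times> 'g free_alg set set \<Rightarrow>\<^sub>0 complex) \<Rightarrow> complex"
  assume t: "t - t' \<in> R" and \<Psi>: "Vector_Spaces.linear fscale (*) \<Psi>" "\<And>x. x \<in> R \<Longrightarrow> \<Psi> x = 0"
  interpret \<Psi>: Vector_Spaces.linear fscale "(*)" \<Psi> by (rule \<Psi>(1))
  interpret l: Vector_Spaces.linear fscale "(*)" "lext (\<lambda>(m, w). \<Psi> (DP m w))" by (rule linear_lext)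
  show "\<Psi> (DF t - DF t') = 0"
    using dirac_free_R_functional[OF \<Psi> t]
    by (simp add: \<Psi>.diff dirac_free_functional[OF \<Psi>(1)] l.diff)
qed

lemma dirac_op_coset:
  assumes "t \<in> TF" shows "dirac_op L B S U M N X Xd (t +o R) = DF t +o R"
proof -
  let ?t = "inv_into TF (\<lambda>t. t +o R) (t +o R)"
  have "?t +o R = t +o R" by (rule f_inv_into_f) (use assms in blast)
  then have "DF ?t - DF t \<in> R" by (intro dirac_free_cong) (simp add: coset_eq_iff[OF R_subspace])
  then show ?thesis by (simp add: dirac_op_def Let_def coset_eq_iff[OF R_subspace])
qed

lemma dirac_cohomology_nontrivial:
  assumes v: "\<And>x d. root_letter x d \<Longrightarrow> d > 0 \<Longrightarrow> act M x v = 0"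
    and l: "Vector_Spaces.linear (m_scal M) (*) l" "l v = (1 :: complex)"
    and l_neg: "\<And>y d m. root_letter y d \<Longrightarrow> d < 0 \<Longrightarrow> l (act M y m) = 0"
  shows "dirac_cohomology L B S U M N X Xd
    \<noteq> {dirac_ker L B S U M N X Xd \<inter> dirac_im L B S U M N X Xd}"
proof
  let ?ker = "dirac_ker L B S U M N X Xd" and ?im = "dirac_im L B S U M N X Xd"
  let ?v = "basis_vec (v, cls 1)"
  let ?A = "?v +o R"
  interpret l: Vector_Spaces.linear "m_scal M" "(*)" l by (rule l(1))
  have vTF: "?v \<in> TF" using osc_class_Osc[OF one_in_free_on] by (simp add: tensor_free_def)
  have zTF: "0 \<in> TF" by (simp add: tensor_free_def)
  have "DP v (cls 1) \<in> R"
    by (rule subspace_mem_by_functionals[OF fs.vector_space_axioms R_subspace])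
      (rule dirac_highest_functional, assumption+, rule v)
  then have "DF ?v \<in> R" by (simp add: dirac_free_def)
  then have "DF ?v +o R = R"
    using coset_eq_iff[OF R_subspace, of "DF ?v" 0] by (simp add: coset_zero[OF R_subspace])
  then have Aker: "?A \<in> ?ker"
    unfolding dirac_ker_def osc_tensor_def quot_def using vTF by (simp add: dirac_op_coset)
  have R0: "R = 0 +o R" by (simp add: coset_zero[OF R_subspace])
  have RT: "R \<in> osc_tensor L B S U M"
    unfolding osc_tensor_def quot_def by (subst R0) (use zTF in blast)
  have "dirac_op L B S U M N X Xd R = R"
    using dirac_op_coset[OF zTF] by (simp add: dirac_free_def flip: R0)
  \<comment> \<open>\<open>R\<close> is the zero tensor; its membership will show that
    \<open>?A\<close> lies in its own coset.\<close>
  then have Rmem: "R \<in> ?ker \<inter> ?im"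
    using RT by (auto simp: dirac_ker_def dirac_im_def intro!: image_eqI[of R _ R])
  \<comment> \<open>This is \<open>l\<close> tensored with \<open>vev\<close>. A class enters
    through a chosen representative, which \<open>vev_K\<close> renders immaterial.\<close>
  define F where "F = lext (\<lambda>(m, w). l m * rb.vev (inv_into FS cls w))"
  have F: "Vector_Spaces.linear fscale (*) F" unfolding F_def by (rule linear_lext)
  have vev: "rb.vev (inv_into FS cls (cls a)) = rb.vev a" if "a \<in> FS" for a
  proof -
    have "cls (inv_into FS cls (cls a)) = cls a" using that by (intro f_inv_into_f) simp
    then have "rb.vev (inv_into FS cls (cls a) - a) = 0"
      by (intro rb.vev_K) (simp add: osc_class_eq_iff)
    then show ?thesis using rb.vev_add[of "inv_into FS cls (cls a) - a" a] by simp
  qed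
  have F_basis: "F (basis_vec (m, cls a)) = l m * rb.vev a" if "a \<in> FS" for m a
    using vev[OF that] by (simp add: F_def)
  have F_R: "F t = 0" if "t \<in> R" for t
    unfolding F_def
    by (rule R_functional[OF _ _ _ _ that])
      (simp_all add: vev l.add l.scale rb.vev_add rb.vev_scale fs.subspace_add[OF free_on_subspace]
        fs.subspace_scale[OF free_on_subspace] distrib_left distrib_right)
  have F_DP: "F (DP m (cls a)) = 0" if a: "a \<in> FS" for m a
  proof -
    have *: "gen (Xd i) * a \<in> FS" if "i \<in> {1..N}" for i
      using hdb_dual_S[OF X that] a by (auto intro: free_on_mult)
    have c: "cubic * a \<in> FS" using cubic_term_FS[OF X] a by (rule free_on_mult)
    have "F (DP m (cls a)) = dirac_form (\<lambda>m a. l m * rb.vev a) m a"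
      unfolding dirac_pure_functional[OF F a] dirac_form_def
      by (intro arg_cong2[where f = plus] sum.cong refl) (simp_all add: F_basis * c)
    also have "\<dots> = (\<Sum>i=1..n. l (act M (Y i) ((parity_op M ^^ par L (Y i)) m)) * rb.vev (gen (Yd i) * a))
        + l m * rb.vev (cubic * a)"
      by (rule dirac_form_root_basis[where \<beta> = "\<lambda>m a. l m * rb.vev a"])
        (simp_all add: a l.add l.scale rb.vev_add rb.vev_scale rb.vev_K distrib_left distrib_right)
    also have "\<dots> = 0"
    proof -
      \<comment> \<open>Dual letters have opposite nonzero degrees: either the dual letter is
        negative and \<open>vev\<close> vanishes, or \<open>Y i\<close> is negative and
        \<open>l\<close> vanishes.\<close>
      have "l (act M (Y i) m') * rb.vev (gen (Yd i) * a) = 0" if i: "i \<in> {1..n}" for i m'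
      proof (cases "deg i > 0")
        case True
        then show ?thesis using rb.vev_negative_letter[OF rb.dual_letter[OF i]] by simp
      next
        case False
        then have "deg i < 0" using rb.letter[OF i] by (simp add: root_letter_def)
        then show ?thesis using l_neg[OF rb.letter[OF i]] by simp
      qed
      then have "(\<Sum>i=1..n. l (act M (Y i) ((parity_op M ^^ par L (Y i)) m)) * rb.vev (gen (Yd i) * a)) = 0"
        by (intro sum.neutral) blast
      then show ?thesis by (simp only: rb.cubic_term_vev[OF X a] mult_zero_right add_0_left)
    qed
    finally show ?thesis .
  qed
  have A_im: "?A \<notin> ?im"
  proof
    assume "?A \<in> ?im"
    then obtain t where t: "t \<in> TF" "?A = DF t +o R"
      unfolding dirac_im_def osc_tensor_def quot_def by (auto simp: dirac_op_coset)
    have "F (DF t) = 0"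
      unfolding dirac_free_functional[OF F] lext_def
    proof (rule sum.neutral, rule ballI)
      fix k assume "k \<in> Poly_Mapping.keys t"
      then obtain m a where "k = (m, cls a)" "a \<in> FS"
        using t(1) by (auto simp: tensor_free_def oscillator_classes)
      then show "Poly_Mapping.lookup t k * (case k of (m, w) \<Rightarrow> F (DP m w)) = 0" by (simp add: F_DP)
    qed
    moreover have "?v - DF t \<in> R" using t(2) coset_eq_iff[OF R_subspace] by blast
    then have "F (?v - DF t) = 0" by (rule F_R)
    then have "F ?v = F (DF t)"
      using F_def lext_add[of "\<lambda>(m, w). l m * rb.vev (inv_into FS cls w)" "?v - DF t" "DF t"] by simp
    moreover have "F ?v = 1" by (simp add: F_basis l(2) rb.vev_one)
    ultimately show False by simp
  qed
  \<comment> \<open>If the cohomology were zero, the coset of \<open>?A\<close> would equal the zero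
    class, yet it contains \<open>?A\<close>, which is not in the image.\<close>
  assume "dirac_cohomology L B S U M N X Xd = {?ker \<inter> ?im}"
  then have "?A +o (?ker \<inter> ?im) = ?ker \<inter> ?im"
    unfolding dirac_cohomology_def quot_def using Aker by blast
  moreover have "?A + R \<in> ?A +o (?ker \<inter> ?im)"
    using Rmem by (auto simp: elt_set_plus_def)
  moreover have "?A + R = ?A"
    using coset_add[OF R_subspace, of ?v 0] by (simp add: coset_zero[OF R_subspace])
  ultimately show False using A_im by auto
qed

end
end

theorem theorem1p2p2:
  fixes L :: "'g::ab_group_add lsa"
    and B :: "'g \<Rightarrow> 'g \<Rightarrow> complex"
    and h :: "'g set"
    and P :: "('g \<Rightarrow> complex) set"
    and f :: "('g \<Rightarrow> complex) \<Rightarrow> int"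
    and X Xd :: "nat \<Rightarrow> 'g"
    and s :: nat
    and M :: "('g, 'm::ab_group_add) supermod"
    and \<Lambda> :: "'g \<Rightarrow> complex"
  assumes "basic_classical L"
    and "invariant_form L B"
    and "cartan_subalgebra L h"
    and "positive_system L h P"
    and "parabolic_datum L h P f"
    and "homogeneous_dual_bases L B (par_s L h f) (2 * s) X Xd"
    and "highest_weight_supermodule L h P M \<Lambda>"
  shows "dirac_cohomology L B (par_s L h f) (par_u L h f) M (2 * s) X Xd
           \<noteq> {dirac_ker L B (par_s L h f) (par_u L h f) M (2 * s) X Xd
              \<inter> dirac_im L B (par_s L h f) (par_u L h f) M (2 * s) X Xd}"
proof -
  obtain v where v: "v \<noteq> 0" "\<And>x. x \<in> nplus L h P \<Longrightarrow> act M x v = 0"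
    "\<And>H. H \<in> h \<Longrightarrow> act M H v = m_scal M (\<Lambda> H) v" "cyclic_submodule L M v = UNIV"
    using assms(7) unfolding highest_weight_supermodule_def by blast
  interpret module_setting L B h f M
  proof
    show "lie_superalgebra L" "finite_dimensional L"
      using assms(1) by (auto simp: basic_classical_def)
    show "supermodule L M" using assms(7) by (simp add: highest_weight_supermodule_def)
    show "f (a + b) = f a + f b"
      if "a \<in> group_closure (roots L h)" "b \<in> group_closure (roots L h)" for a b
      using assms(5) that unfolding parabolic_datum_def by blast
  qed (rule assms(2), rule assms(3))
  have pos: "{a \<in> roots L h. f a > 0} \<subseteq> P"
    using assms(5) by (simp add: parabolic_datum_def)
  obtain n Y Yd deg where "homogeneous_dual_bases L B S n Y Yd"
    "\<And>i. i \<in> {1..n} \<Longrightarrow> root_letter (Y i) (deg i)"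
    "\<And>i. i \<in> {1..n} \<Longrightarrow> root_letter (Yd i) (- deg i)"
    using exists_root_basis[OF assms(6)] by blast
  then have rb: "root_basis L B h f n Y Yd deg"
    by unfold_locales
  obtain l where "Vector_Spaces.linear (m_scal M) (*) l" "l v = (1 :: complex)"
    "\<And>y d m. root_letter y d \<Longrightarrow> d < 0 \<Longrightarrow> l (act M y m) = 0"
    using highest_weight_functional[OF pos v(2,3,4,1)] by blast
  then show ?thesis
    by (intro dirac_cohomology_nontrivial[OF assms(6) rb, where v = v and l = l]
        v_annihilated[OF pos v(2,3,4,1)])
qed

end
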